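(* Let $q$ be a prime power and let $S$ be a surface of degree $d$ in $\mathbb{P}^3$ over $\mathbb{F}_q$ without $\mathbb{F}_q$-plane components. If $$N_q(S) = (d-1)q^2 + dq + 1,$$ then the degree $d$ of $S$ is either $2$, or $\sqrt{q}+1$ (when $q$ is a square), or $q+1$. Furthermore, $S$ is projectively equivalent over $\mathbb{F}_q$ to one of the following surfaces: (i) $X_0X_1 - X_2X_3 = 0$ if $d = 2$; (ii) $X_0^{\sqrt{q}+1} + X_1^{\sqrt{q}+1} + X_2^{\sqrt{q}+1} + X_3^{\sqrt{q}+1} = 0$ if $d = \sqrt{q}+1$; (iii) $X_0X_1^{q} - X_0^{q}X_1 + X_2X_3^{q} - X_2^{q}X_3 = 0$ if $d = q+1$.
   Context: A surface $S$ of degree $d\ge 1$ in $\mathbb{P}^3$ over $\mathbb{F}_q$ is one defined by a nonzero homogeneous polynomial $F\in\mathbb{F}_q[X_0,X_1,X_2,X_3]$ of degree $d$ (not assumed irreducible). It is without $\mathbb{F}_q$-plane components if $F$ has no linear factor over $\mathbb{F}_q$. $N_q(S)$ denotes the number of $\mathbb{F}_q$-points of $S$, i.e. of points of $\mathbb{P}^3(\mathbb{F}_q)$ at which $F$ vanishes. Two surfaces are projectively equivalent over $\mathbb{F}_q$ if one is carried to the other by an invertible linear change of the coordinates $X_0,\dots,X_3$ with coefficients in $\mathbb{F}_q$ (defining polynomials being considered up to a nonzero scalar in $\mathbb{F}_q$). *)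

theory Defs
  imports "HOL-Analysis.Analysis" "HOL-Library.Poly_Mapping"
begin

text \<open>
  The variables \<open>X\<^sub>0, \<dots>, X\<^sub>3\<close> are indexed by the four-element type \<open>4\<close>, whose elements are the
  numerals \<open>0, 1, 2, 3\<close> (arithmetic is modulo 4, so \<open>4 = 0\<close> there).  The ring structure on
  \<open>'k poly4\<close> is the convolution product of \<open>Poly_Mapping\<close>, so \<open>dvd\<close> is divisibility in
  \<open>k[X\<^sub>0,X\<^sub>1,X\<^sub>2,X\<^sub>3]\<close>.
\<close>

type_synonym 'k poly4 = "(4 \<Rightarrow>\<^sub>0 nat) \<Rightarrow>\<^sub>0 'k"

definition Const :: "'k::comm_ring_1 \<Rightarrow> 'k poly4" where
  "Const c = Poly_Mapping.single 0 c"

definition Var :: "4 \<Rightarrow> 'k::comm_ring_1 poly4" where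
  "Var i = Poly_Mapping.single (Poly_Mapping.single i 1) 1"

definition homogeneous :: "nat \<Rightarrow> 'k::comm_ring_1 poly4 \<Rightarrow> bool" where
  "homogeneous d F \<longleftrightarrow> (\<forall>m\<in>Poly_Mapping.keys F. (\<Sum>i\<in>UNIV. Poly_Mapping.lookup m i) = d)"

definition eval4 :: "'k::comm_ring_1 poly4 \<Rightarrow> 'k ^ 4 \<Rightarrow> 'k" where
  "eval4 F v = (\<Sum>m\<in>Poly_Mapping.keys F. Poly_Mapping.lookup F m * (\<Prod>i\<in>UNIV. (v $ i) ^ Poly_Mapping.lookup m i))"

definition subst4 :: "(4 \<Rightarrow> 'k::comm_ring_1 poly4) \<Rightarrow> 'k poly4 \<Rightarrow> 'k poly4" where
  "subst4 p F = (\<Sum>m\<in>Poly_Mapping.keys F. Const (Poly_Mapping.lookup F m) * (\<Prod>i\<in>UNIV. p i ^ Poly_Mapping.lookup m i))"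

text \<open>A surface is represented by a defining polynomial, not by its set of rational points.\<close>

definition surface :: "nat \<Rightarrow> 'k::field poly4 \<Rightarrow> bool" where
  "surface d F \<longleftrightarrow> d \<ge> 1 \<and> F \<noteq> 0 \<and> homogeneous d F"

definition without_plane_components :: "'k::field poly4 \<Rightarrow> bool" where
  "without_plane_components F \<longleftrightarrow> \<not> (\<exists>L. L \<noteq> 0 \<and> homogeneous 1 L \<and> L dvd F)"

definition proj_rel :: "('k::field ^ 4) rel" where
  "proj_rel = {(v, w). v \<noteq> 0 \<and> w \<noteq> 0 \<and> (\<exists>c. c \<noteq> 0 \<and> w = c *s v)}"

definition proj_space :: "('k::field ^ 4) set set" where
  "proj_space = (UNIV - {0}) // proj_rel"

text \<open>
  For homogeneous \<open>F\<close>, vanishing does not depend on the representative of a point, so the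
  quantifier over the class \<open>P\<close> could equally well be existential.
\<close>

definition surface_points :: "'k::field poly4 \<Rightarrow> ('k ^ 4) set set" where
  "surface_points F = {P \<in> proj_space. \<forall>v\<in>P. eval4 F v = 0}"

definition num_points :: "'k::{field,finite} poly4 \<Rightarrow> nat" where
  "num_points F = card (surface_points F)"

definition linear_change :: "'k::field ^ 4 ^ 4 \<Rightarrow> 'k poly4 \<Rightarrow> 'k poly4" where
  "linear_change A = subst4 (\<lambda>i. \<Sum>j\<in>UNIV. Const (A $ i $ j) * Var j)"

definition proj_equivalent :: "'k::field poly4 \<Rightarrow> 'k poly4 \<Rightarrow> bool" where
  "proj_equivalent F G \<longleftrightarrow>
     (\<exists>A c. invertible A \<and> c \<noteq> 0 \<and> linear_change A F = Const c * G)"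

end

theory Submission imports Defs begin

text \<open>
  Let \<open>B x y\<close> be the derivative of \<open>F\<close> at \<open>x\<close> in direction \<open>y\<close>. If \<open>d = q + 1\<close>, every rational point lies
  on \<open>F\<close>, so \<open>B\<close> is an alternating bilinear form that determines \<open>F\<close>, and a symplectic basis gives
  (iii); a degenerate form would have a linear factor.

  Let \<open>d \<le> q\<close>. Counting along lines through a point of the surface shows that it contains a rational
  line. Counting in the planes through such a line, the bound is attained only if every one of these
  planes cuts the surface in \<open>d\<close> distinct concurrent lines. Hence all rational points are nonsingular,
  two of them are joined by a contained line iff \<open>B x y = 0\<close>, and \<open>B a z = 0\<close> implies \<open>B z a = 0\<close> for a
  point \<open>a\<close> and every \<open>z\<close>, because \<open>B _ a\<close> has degree \<open>d - 1\<close> and vanishes on \<open>d\<close> lines of the tangent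
  plane. There are points \<open>a, b, a', b'\<close> forming a skew quadrilateral of contained lines; in these
  coordinates \<open>d = 2\<close> immediately gives (i). For \<open>d \<ge> 3\<close> one first shows that the characteristic divides
  \<open>d - 1\<close>; then \<open>F\<close> splits as a sum of two binary forms on \<open>\<langle>a, b\<rangle>\<close> and \<open>\<langle>a', b'\<rangle>\<close>, and the implication
  above forces \<open>B x u\<close> to be a multiple of \<open>(B u x) ^ (d - 1)\<close> on each. With \<open>s = d - 1\<close> the binary forms
  are \<open>c x y ^ s + c' x ^ s y\<close>, the map \<open>x \<mapsto> x ^ s\<close> is an involution of the field whose fixed field has
  \<open>s\<close> elements, so \<open>q = s ^ 2\<close> and \<open>F\<close> is Hermitian.
\<close>


section \<open>Evaluation of polynomials along ring homomorphisms\<close>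

definition ev :: "('k::comm_ring_1 \<Rightarrow> 'r::comm_ring_1) \<Rightarrow> (4 \<Rightarrow> 'r) \<Rightarrow> 'k poly4 \<Rightarrow> 'r" where
  "ev h x F = (\<Sum>m\<in>Poly_Mapping.keys F. h (Poly_Mapping.lookup F m) * (\<Prod>i\<in>UNIV. x i ^ Poly_Mapping.lookup m i))"

definition ring_map :: "('a::comm_ring_1 \<Rightarrow> 'b::comm_ring_1) \<Rightarrow> bool" where
  "ring_map h \<longleftrightarrow> h 0 = 0 \<and> h 1 = 1 \<and> (\<forall>a b. h (a + b) = h a + h b) \<and> (\<forall>a b. h (a * b) = h a * h b)"

lemma ring_mapD:
  assumes "ring_map h"
  shows "h 0 = 0" "h 1 = 1" "h (a + b) = h a + h b" "h (a * b) = h a * h b"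
  using assms by (auto simp: ring_map_def)

lemma ring_map_sum: "ring_map h \<Longrightarrow> h (sum f A) = (\<Sum>a\<in>A. h (f a))"
  by (induction A rule: infinite_finite_induct) (auto simp: ring_mapD)

lemma ring_map_prod: "ring_map h \<Longrightarrow> h (prod f A) = (\<Prod>a\<in>A. h (f a))"
  by (induction A rule: infinite_finite_induct) (auto simp: ring_mapD)

lemma ring_map_power: "ring_map h \<Longrightarrow> h (a ^ n) = h a ^ n"
  by (induction n) (auto simp: ring_mapD)

lemma ring_map_minus: "ring_map h \<Longrightarrow> h (a - b) = h a - h b"
  by (metis add_diff_cancel diff_add_cancel ring_mapD(3))

lemma poly4_induct [case_names zero single add]:
  fixes F :: "('a \<Rightarrow>\<^sub>0 'b::comm_monoid_add)"
  assumes "P 0" and "\<And>m c. P (Poly_Mapping.single m c)" and "\<And>F G. P F \<Longrightarrow> P G \<Longrightarrow> P (F + G)"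
  shows "P F"
proof -
  have "P (\<Sum>m\<in>A. Poly_Mapping.single m (Poly_Mapping.lookup F m))" for A
    by (induction A rule: infinite_finite_induct) (auto intro: assms)
  moreover have "F = (\<Sum>m\<in>Poly_Mapping.keys F. Poly_Mapping.single m (Poly_Mapping.lookup F m))"
    by (rule poly_mapping_eqI)
       (simp add: lookup_sum lookup_single when_def in_keys_iff)
  ultimately show ?thesis by metis
qed

lemma ev_superset:
  assumes "h 0 = 0" "finite A" "Poly_Mapping.keys F \<subseteq> A"
  shows "ev h x F = (\<Sum>m\<in>A. h (Poly_Mapping.lookup F m) * (\<Prod>i\<in>UNIV. x i ^ Poly_Mapping.lookup m i))"
  unfolding ev_def using assms by (intro sum.mono_neutral_left) (auto simp: in_keys_iff)

lemma ev_add: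
  assumes "ring_map h"
  shows "ev h x (F + G) = ev h x F + ev h x G"
proof -
  let ?A = "Poly_Mapping.keys F \<union> Poly_Mapping.keys G"
  have "Poly_Mapping.keys (F + G) \<subseteq> ?A" by (rule keys_add)
  then show ?thesis
    using ring_mapD[OF assms]
    by (simp add: ev_superset[where A = ?A] lookup_add distrib_right sum.distrib)
qed

lemma ev_zero [simp]: "ev h x 0 = 0"
  by (simp add: ev_def)

lemma ev_single:
  assumes "ring_map h"
  shows "ev h x (Poly_Mapping.single m c) = h c * (\<Prod>i\<in>UNIV. x i ^ Poly_Mapping.lookup m i)"
  using ring_mapD[OF assms] by (simp add: ev_def)

lemma ev_mult:
  assumes h: "ring_map h"
  shows "ev h x (F * G) = ev h x F * ev h x G"
proof (induction F rule: poly4_induct)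
  case (single m c)
  show ?case
    by (induction G rule: poly4_induct)
       (auto simp: mult_single ev_single[OF h] ring_mapD[OF h] lookup_add power_add prod.distrib
          distrib_left ev_add[OF h])
qed (auto simp: ev_add[OF h] distrib_right)

lemma Const_ring_map: "ring_map Const"
  by (auto simp: ring_map_def Const_def single_add mult_single)

lemma ev_Const: "ring_map h \<Longrightarrow> ev h x (Const c) = h c"
  by (simp add: Const_def ev_single)

lemma ev_Var: "ring_map h \<Longrightarrow> ev h x (Var i) = x i"
proof -
  assume h: "ring_map h"
  have "(\<Prod>j\<in>UNIV. x j ^ Poly_Mapping.lookup (Poly_Mapping.single i (1::nat)) j) = (\<Prod>j\<in>UNIV. if j = i then x j else 1)"
    by (rule prod.cong) (auto simp: lookup_single when_def)
  then show ?thesis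
    by (simp add: Var_def ev_single[OF h] ring_mapD[OF h])
qed

lemma ev_ring_map:
  fixes h :: "'k::comm_ring_1 \<Rightarrow> 'r::comm_ring_1"
  assumes h: "ring_map h"
  shows "ring_map (ev h x)"
proof -
  have "Const (1::'k) = 1" by (rule ring_mapD(2)[OF Const_ring_map])
  then have "ev h x 1 = 1" using ev_Const[OF h, of x 1] ring_mapD(2)[OF h] by metis
  then show ?thesis by (auto simp: ring_map_def ev_add[OF h] ev_mult[OF h])
qed

text \<open>\<open>ev\<close> covers evaluation, substitution and restriction to a line at once.
  Naturality is the source of \<open>poly_linepoly\<close>, \<open>linepoly_shift\<close> and
  \<open>eval4_linear_change\<close>.\<close>

lemma ev_natural:
  assumes "ring_map g"
  shows "g (ev h x F) = ev (g \<circ> h) (g \<circ> x) F"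
  by (simp add: ev_def ring_map_sum[OF assms] ring_map_prod[OF assms] ring_map_power[OF assms] ring_mapD[OF assms])

lemma ring_map_id: "ring_map (\<lambda>x. x)"
  by (auto simp: ring_map_def)

lemma eval4_ev: "eval4 F v = ev (\<lambda>c. c) (($) v) F"
  by (simp add: eval4_def ev_def)

lemma eval4_ring_map: "ring_map (\<lambda>F. eval4 F v)"
  unfolding eval4_ev by (rule ev_ring_map[OF ring_map_id])

lemmas eval4_simps = ring_mapD[OF eval4_ring_map] ring_map_minus[OF eval4_ring_map]
  ring_map_power[OF eval4_ring_map] ring_map_sum[OF eval4_ring_map]

lemma eval4_Const [simp]: "eval4 (Const c) v = c"
  by (simp add: eval4_ev ev_Const ring_map_id)

lemma eval4_Var [simp]: "eval4 (Var i) v = v $ i"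
  by (simp add: eval4_ev ev_Var ring_map_id)

text \<open>The restriction to \<open>v + t *s w\<close> is kept as a polynomial in
  \<open>t\<close>: over a finite field values alone may lose coefficients, and these carry the
  tangent data.\<close>

definition linepoly :: "'k::comm_ring_1 poly4 \<Rightarrow> 'k ^ 4 \<Rightarrow> 'k ^ 4 \<Rightarrow> 'k poly" where
  "linepoly F v w = ev (\<lambda>c. [:c:]) (\<lambda>i. [:v $ i, w $ i:]) F"

lemma const_poly_ring_map: "ring_map (\<lambda>c. [:c:])"
  by (auto simp: ring_map_def one_pCons)

lemma linepoly_ring_map: "ring_map (\<lambda>F. linepoly F v w)"
  unfolding linepoly_def by (rule ev_ring_map[OF const_poly_ring_map])

lemmas linepoly_simps = ring_mapD[OF linepoly_ring_map] ring_map_minus[OF linepoly_ring_map]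
  ring_map_power[OF linepoly_ring_map] ring_map_sum[OF linepoly_ring_map]

lemma linepoly_Const [simp]: "linepoly (Const c) v w = [:c:]"
  by (simp add: linepoly_def ev_Const const_poly_ring_map)

lemma linepoly_Var [simp]: "linepoly (Var i) v w = [:v $ i, w $ i:]"
  by (simp add: linepoly_def ev_Var const_poly_ring_map)

lemma poly_ring_map: "ring_map (\<lambda>p. poly p (t::'a::comm_ring_1))"
  by (auto simp: ring_map_def)

lemma poly_linepoly: "poly (linepoly F v w) t = eval4 F (v + t *s w)"
  unfolding linepoly_def eval4_ev
  by (subst ev_natural[OF poly_ring_map]) (auto intro!: arg_cong2[where f = "\<lambda>a b. ev a b F"] simp: fun_eq_iff)

lemma pcompose_ring_map: "ring_map (\<lambda>p. pcompose p (r::'a::comm_ring_1 poly))"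
  by (auto simp: ring_map_def pcompose_add pcompose_mult pcompose_1)

lemma linepoly_shift: "linepoly F (v + t *s w) w = pcompose (linepoly F v w) [:t, 1:]"
  unfolding linepoly_def
  by (subst ev_natural[OF pcompose_ring_map])
     (auto intro!: arg_cong2[where f = "\<lambda>a b. ev a b F"] simp: fun_eq_iff pcompose_pCons)

lemma linear_change_ev: "linear_change A F = ev Const (\<lambda>i. \<Sum>j\<in>UNIV. Const (A $ i $ j) * Var j) F"
  by (simp add: linear_change_def subst4_def ev_def)

lemma eval4_linear_change: "eval4 (linear_change A F) v = eval4 F (A *v v)"
  unfolding linear_change_ev
  by (subst ev_natural[OF eval4_ring_map])
     (auto intro!: arg_cong2[where f = "\<lambda>a b. ev a b F"]
       simp: fun_eq_iff eval4_ev[of F] eval4_simps matrix_vector_mult_def)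

lemma linepoly_linear_change: "linepoly (linear_change A F) v w = linepoly F (A *v v) (A *v w)"
  unfolding linear_change_ev
  by (subst ev_natural[OF linepoly_ring_map], subst (3) linepoly_def)
     (auto intro!: arg_cong2[where f = "\<lambda>a b. ev a b F"]
       simp: fun_eq_iff linepoly_simps matrix_vector_mult_def sum_to_poly, simp add: poly_eq_iff coeff_sum coeff_pCons mult.commute split: nat.splits)

section \<open>Homogeneous polynomials\<close>

definition mdeg :: "(4 \<Rightarrow>\<^sub>0 nat) \<Rightarrow> nat" where
  "mdeg m = (\<Sum>i\<in>UNIV. Poly_Mapping.lookup m i)"

lemma mdeg_add: "mdeg (m + m') = mdeg m + mdeg m'"
  by (simp add: mdeg_def lookup_add sum.distrib)

lemma homogeneous_mdeg: "homogeneous d F \<longleftrightarrow> (\<forall>m\<in>Poly_Mapping.keys F. mdeg m = d)"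
  by (simp add: homogeneous_def mdeg_def)

lemma homogeneous_lookup: "homogeneous d F \<longleftrightarrow> (\<forall>m. Poly_Mapping.lookup F m \<noteq> 0 \<longrightarrow> mdeg m = d)"
  by (auto simp: homogeneous_mdeg in_keys_iff)

lemma homogeneous_induct [consumes 1, case_names zero single add]:
  fixes F :: "'k::comm_ring_1 poly4"
  assumes "homogeneous d F" and "P 0" and "\<And>m c. mdeg m = d \<Longrightarrow> P (Poly_Mapping.single m c)"
    and "\<And>F G. P F \<Longrightarrow> P G \<Longrightarrow> P (F + G)"
  shows "P F"
proof -
  have "P (\<Sum>m\<in>A. Poly_Mapping.single m (Poly_Mapping.lookup F m))" if "A \<subseteq> Poly_Mapping.keys F" for A
    using that assms(1)
    by (induction A rule: infinite_finite_induct) (auto intro!: assms(2-4) simp: homogeneous_mdeg)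
  moreover have "F = (\<Sum>m\<in>Poly_Mapping.keys F. Poly_Mapping.single m (Poly_Mapping.lookup F m))"
    by (rule poly_mapping_eqI)
       (simp add: lookup_sum lookup_single when_def in_keys_iff)
  ultimately show ?thesis by (metis order_refl)
qed

lemma homogeneous_zero [simp]: "homogeneous d 0"
  by (simp add: homogeneous_def)

lemma homogeneous_single: "mdeg m = d \<Longrightarrow> homogeneous d (Poly_Mapping.single m c)"
  by (simp add: homogeneous_mdeg)

lemma homogeneous_add: "homogeneous d F \<Longrightarrow> homogeneous d G \<Longrightarrow> homogeneous d (F + G)"
  using keys_add[of F G] by (auto simp: homogeneous_def)

lemma homogeneous_sum: "(\<And>a. a \<in> A \<Longrightarrow> homogeneous d (f a)) \<Longrightarrow> homogeneous d (sum f A)"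
  by (induction A rule: infinite_finite_induct) (auto intro: homogeneous_add)

lemma homogeneous_mult: "homogeneous d F \<Longrightarrow> homogeneous e G \<Longrightarrow> homogeneous (d + e) (F * G)"
  using keys_mult[of F G] by (fastforce simp: homogeneous_mdeg mdeg_add)

lemma homogeneous_Const: "homogeneous 0 (Const c)"
  unfolding Const_def by (rule homogeneous_single) (simp add: mdeg_def)

lemma homogeneous_Var: "homogeneous 1 (Var i)"
  unfolding Var_def by (rule homogeneous_single) (simp add: mdeg_def lookup_single when_def)

lemma homogeneous_power: "homogeneous d F \<Longrightarrow> homogeneous (n * d) (F ^ n)"
proof (induction n)
  case 0
  then show ?case using homogeneous_Const[of 1] by (simp add: ring_mapD[OF Const_ring_map])
qed (auto intro: homogeneous_mult)

lemma homogeneous_Const_mult: "homogeneous d F \<Longrightarrow> homogeneous d (Const c * F)"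
  using homogeneous_mult[OF homogeneous_Const, of d F c] by simp

lemma homogeneous_diff: "homogeneous d F \<Longrightarrow> homogeneous d G \<Longrightarrow> homogeneous d (F - G)"
  for F :: "'k::comm_ring_1 poly4"
  unfolding homogeneous_lookup
proof (intro allI impI)
  fix m assume "\<forall>m. Poly_Mapping.lookup F m \<noteq> 0 \<longrightarrow> mdeg m = d" "\<forall>m. Poly_Mapping.lookup G m \<noteq> 0 \<longrightarrow> mdeg m = d"
    "Poly_Mapping.lookup (F - G) m \<noteq> 0"
  then show "mdeg m = d" by (cases "Poly_Mapping.lookup G m = 0") (auto simp: lookup_minus)
qed

lemma homogeneous_prod:
  "(\<And>a. a \<in> A \<Longrightarrow> homogeneous (n a) (f a)) \<Longrightarrow> homogeneous (sum n A) (prod f A)"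
proof (induction A rule: infinite_finite_induct)
  case empty
  then show ?case using homogeneous_Const[of 1] by (simp add: ring_mapD[OF Const_ring_map])
next
  case (infinite A)
  then show ?case using homogeneous_Const[of 1] by (simp add: ring_mapD[OF Const_ring_map])
qed (auto intro: homogeneous_mult)

lemma homogeneous_ev_Const:
  assumes "homogeneous d F" "\<And>i. homogeneous 1 (x i)"
  shows "homogeneous d (ev Const x F)"
  unfolding ev_def
proof (intro homogeneous_sum homogeneous_Const_mult)
  fix m assume "m \<in> Poly_Mapping.keys F"
  then have "(\<Sum>i\<in>UNIV. Poly_Mapping.lookup m i * 1) = d"
    using assms(1) by (simp add: homogeneous_def)
  moreover have "homogeneous (\<Sum>i\<in>UNIV. Poly_Mapping.lookup m i * 1) (\<Prod>i\<in>UNIV. x i ^ Poly_Mapping.lookup m i)"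
    by (intro homogeneous_prod homogeneous_power assms(2))
  ultimately show "homogeneous d (\<Prod>i\<in>UNIV. x i ^ Poly_Mapping.lookup m i)" by (simp only:)
qed

definition linform :: "(4 \<Rightarrow> 'k::comm_ring_1) \<Rightarrow> 'k poly4" where
  "linform c = (\<Sum>i\<in>UNIV. Const (c i) * Var i)"

lemma homogeneous_linform: "homogeneous 1 (linform c)"
  unfolding linform_def by (intro homogeneous_sum homogeneous_Const_mult homogeneous_Var)

lemma homogeneous_linear_change: "homogeneous d F \<Longrightarrow> homogeneous d (linear_change A F)"
  unfolding linear_change_ev
  by (intro homogeneous_ev_Const homogeneous_sum homogeneous_Const_mult homogeneous_Var)

lemma eval4_scale:
  assumes "homogeneous d F"
  shows "eval4 F (c *s v) = c ^ d * eval4 F v"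
  using assms
proof (induction F rule: homogeneous_induct)
  case (single m a)
  then show ?case
    by (simp add: eval4_ev ev_single ring_map_id power_mult_distrib prod.distrib mdeg_def power_sum
        flip: power_sum)
qed (auto simp: eval4_simps distrib_left)

lemma eval4_0: "homogeneous d F \<Longrightarrow> d > 0 \<Longrightarrow> eval4 F 0 = 0"
  using eval4_scale[of d F 0 0] by (simp add: zero_power)

section \<open>Restriction to lines\<close>

text \<open>Reversal in formal degree \<open>d\<close>, that is p(t) = t^d q(1/t); the true degrees
  may be smaller.\<close>

definition hrev :: "nat \<Rightarrow> 'a::comm_ring_1 poly \<Rightarrow> 'a poly \<Rightarrow> bool" where
  "hrev d p q \<longleftrightarrow> (\<forall>j\<le>d. coeff p j = coeff q (d - j)) \<and> (\<forall>j>d. coeff p j = 0 \<and> coeff q j = 0)"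

lemma coeff_mult_bounded:
  fixes p q :: "'a::comm_ring_1 poly"
  assumes "\<forall>j>a. coeff p j = 0" "\<forall>j>b. coeff q j = 0"
  shows "coeff (p * q) n = (\<Sum>i\<le>a. \<Sum>j\<le>b. if i + j = n then coeff p i * coeff q j else 0)"
proof -
  have "p = (\<Sum>i\<le>a. monom (coeff p i) i)" "q = (\<Sum>j\<le>b. monom (coeff q j) j)"
    using assms by (auto simp: poly_eq_iff coeff_sum not_le)
  then have "coeff (p * q) n = coeff ((\<Sum>i\<le>a. monom (coeff p i) i) * (\<Sum>j\<le>b. monom (coeff q j) j)) n"
    by metis
  also have "\<dots> = (\<Sum>i\<le>a. \<Sum>j\<le>b. if i + j = n then coeff p i * coeff q j else 0)"
    by (simp add: sum_product coeff_sum mult_monom)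
  finally show ?thesis .
qed

lemma sum_rev_atMost: "(\<Sum>i\<le>(n::nat). f i) = (\<Sum>i\<le>n. f (n - i))"
  by (rule sum.reindex_bij_witness[of _ "\<lambda>i. n - i" "\<lambda>i. n - i"]) auto

lemma hrev_mult:
  assumes "hrev a p q" "hrev b p' q'"
  shows "hrev (a + b) (p * p') (q * q')"
proof -
  have z: "\<forall>j>a. coeff p j = 0" "\<forall>j>a. coeff q j = 0" "\<forall>j>b. coeff p' j = 0" "\<forall>j>b. coeff q' j = 0"
    using assms by (auto simp: hrev_def)
  note cp = coeff_mult_bounded[OF z(1,3)] and cq = coeff_mult_bounded[OF z(2,4)]
  have "coeff (p * p') j = coeff (q * q') (a + b - j)" if "j \<le> a + b" for j
    unfolding cp cq
    by (subst sum_rev_atMost, rule sum.cong[OF refl], subst sum_rev_atMost, rule sum.cong[OF refl])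
       (use that assms in \<open>auto simp: hrev_def\<close>)
  moreover have "coeff (p * p') j = 0 \<and> coeff (q * q') j = 0" if "j > a + b" for j
    unfolding cp cq using that by (auto intro!: sum.neutral)
  ultimately show ?thesis by (auto simp: hrev_def)
qed

lemma hrev_add: "hrev d p q \<Longrightarrow> hrev d p' q' \<Longrightarrow> hrev d (p + p') (q + q')"
  by (auto simp: hrev_def)

lemma hrev_const: "hrev 0 [:c:] [:c:]"
  by (auto simp: hrev_def coeff_pCons split: nat.splits)

lemma hrev_linear: "hrev 1 [:a, b:] [:b, a:]"
  by (auto simp: hrev_def coeff_pCons le_Suc_eq split: nat.splits)

lemma hrev_power: "hrev d p q \<Longrightarrow> hrev (n * d) (p ^ n) (q ^ n)"
  using hrev_const[of 1] by (induction n) (auto intro: hrev_mult simp: one_pCons)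

lemma hrev_prod: "(\<And>i. i \<in> A \<Longrightarrow> hrev (n i) (p i) (q i)) \<Longrightarrow> hrev (sum n A) (prod p A) (prod q A)"
  using hrev_const[of 1]
  by (induction A rule: infinite_finite_induct) (auto intro: hrev_mult simp: one_pCons)

lemma linepoly_single:
  "linepoly (Poly_Mapping.single m c) v w = [:c:] * (\<Prod>i\<in>UNIV. [:v $ i, w $ i:] ^ Poly_Mapping.lookup m i)"
  by (simp add: linepoly_def ev_single[OF const_poly_ring_map])

lemma eval4_single:
  "eval4 (Poly_Mapping.single m c) v = c * (\<Prod>i\<in>UNIV. v $ i ^ Poly_Mapping.lookup m i)"
  by (simp add: eval4_ev ev_single[OF ring_map_id])

text \<open>Homogeneity gives F(v + t w) = t^d F(w + t^(-1) v), so exchanging base point and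
  direction reverses the coefficients.\<close>

lemma linepoly_hrev:
  assumes "homogeneous d F"
  shows "hrev d (linepoly F v w) (linepoly F w v)"
  using assms
proof (induction F rule: homogeneous_induct)
  case (single m c)
  have "hrev (0 + (\<Sum>i\<in>UNIV. Poly_Mapping.lookup m i * 1))
      (linepoly (Poly_Mapping.single m c) v w) (linepoly (Poly_Mapping.single m c) w v)"
    unfolding linepoly_single by (intro hrev_mult hrev_const hrev_prod hrev_power hrev_linear)
  then show ?case using single by (simp add: mdeg_def)
qed (auto simp: linepoly_simps hrev_add, simp add: hrev_def)

lemma coeff_linepoly_rev:
  "homogeneous d F \<Longrightarrow> j \<le> d \<Longrightarrow> coeff (linepoly F v w) j = coeff (linepoly F w v) (d - j)"
  using linepoly_hrev[of d F v w] by (auto simp: hrev_def)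

lemma coeff_linepoly_above: "homogeneous d F \<Longrightarrow> j > d \<Longrightarrow> coeff (linepoly F v w) j = 0"
  using linepoly_hrev[of d F v w] by (auto simp: hrev_def)

lemma coeff_linepoly_0: "coeff (linepoly F v w) 0 = eval4 F v"
  using poly_linepoly[of F v w 0] by (simp add: poly_0_coeff_0)

lemma coeff_linepoly_top: "homogeneous d F \<Longrightarrow> coeff (linepoly F v w) d = eval4 F w"
  by (simp add: coeff_linepoly_rev coeff_linepoly_0)

lemma poly_eq_0_of_roots:
  fixes p :: "'k::{field,finite} poly"
  assumes "degree p < card {t. poly p t = 0}"
  shows "p = 0"
  using card_poly_roots_bound[of p] assms by fastforce

section \<open>Derivatives\<close>

definition pd :: "4 \<Rightarrow> 'k::field poly4 \<Rightarrow> 'k poly4" where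
  "pd i F = Poly_Mapping.map_key (\<lambda>m. m + Poly_Mapping.single i 1)
     (Poly_Mapping.mapp (\<lambda>m c. of_nat (Poly_Mapping.lookup m i) * c) F)"

lemma lookup_pd: "Poly_Mapping.lookup (pd i F) m =
  of_nat (Poly_Mapping.lookup m i + 1) * Poly_Mapping.lookup F (m + Poly_Mapping.single i 1)"
proof -
  have inj: "inj (\<lambda>m. m + Poly_Mapping.single i (1::nat))" by (auto simp: inj_def)
  show ?thesis
    unfolding pd_def Poly_Mapping.map_key.rep_eq[OF inj]
    by (simp add: lookup_mapp lookup_add in_keys_iff when_def)
qed

lemma pd_add: "pd i (F + G) = pd i F + pd i G"
  by (rule poly_mapping_eqI) (simp add: lookup_pd lookup_add algebra_simps)

lemma pd_zero [simp]: "pd i 0 = 0"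
  by (rule poly_mapping_eqI) (simp add: lookup_pd)

lemma pd_single: "pd i (Poly_Mapping.single m c) =
  Poly_Mapping.single (m - Poly_Mapping.single i 1) (of_nat (Poly_Mapping.lookup m i) * c)"
proof (rule poly_mapping_eqI)
  fix m'
  have "m - Poly_Mapping.single i 1 = m' \<and> Poly_Mapping.lookup m i \<noteq> 0 \<longleftrightarrow> m = m' + Poly_Mapping.single i 1"
    by (auto simp: poly_mapping_eq_iff fun_eq_iff lookup_add lookup_minus lookup_single when_def)
  then show "Poly_Mapping.lookup (pd i (Poly_Mapping.single m c)) m' =
      Poly_Mapping.lookup (Poly_Mapping.single (m - Poly_Mapping.single i 1) (of_nat (Poly_Mapping.lookup m i) * c)) m'"
    by (auto simp: lookup_pd lookup_single when_def lookup_add) (metis of_nat_0 neq0_conv)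
qed

lemma lookup_Const_mult: "Poly_Mapping.lookup (Const c * F) m = c * Poly_Mapping.lookup F m"
  unfolding Const_def mult_map_scale_conv_mult[symmetric] by (simp add: Poly_Mapping.map.rep_eq when_def)

lemma pd_Const_mult: "pd i (Const c * F) = Const c * pd i F"
  by (rule poly_mapping_eqI) (simp add: lookup_pd lookup_Const_mult)

lemma pd_sum: "pd i (sum f A) = (\<Sum>a\<in>A. pd i (f a))"
  by (induction A rule: infinite_finite_induct) (auto simp: pd_add)

lemma pd_commute: "pd i (pd j F) = pd j (pd i F)"
proof (rule poly_mapping_eqI)
  fix m
  have "m + Poly_Mapping.single i (1::nat) + Poly_Mapping.single j 1 = m + Poly_Mapping.single j 1 + Poly_Mapping.single i 1"
    by (simp add: add_ac)
  then show "Poly_Mapping.lookup (pd i (pd j F)) m = Poly_Mapping.lookup (pd j (pd i F)) m"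
    by (auto simp: lookup_pd lookup_add lookup_single when_def algebra_simps)
qed

lemma homogeneous_pd:
  assumes "homogeneous d F"
  shows "homogeneous (d - 1) (pd i F)"
  unfolding homogeneous_lookup
proof (intro allI impI)
  fix m assume "Poly_Mapping.lookup (pd i F) m \<noteq> 0"
  then have "Poly_Mapping.lookup F (m + Poly_Mapping.single i 1) \<noteq> 0" by (auto simp: lookup_pd)
  then have "mdeg (m + Poly_Mapping.single i 1) = d" using assms by (auto simp: homogeneous_lookup)
  moreover have "mdeg (Poly_Mapping.single i 1) = 1"
    by (simp add: mdeg_def lookup_single when_def)
  ultimately show "mdeg m = d - 1" by (simp add: mdeg_add)
qed

lemma Euler_poly4:
  assumes "homogeneous d F"
  shows "(\<Sum>i\<in>UNIV. Var i * pd i F) = Const (of_nat d) * F"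
  using assms
proof (induction F rule: homogeneous_induct)
  case (single m c)
  have "Var i * pd i (Poly_Mapping.single m c) = Poly_Mapping.single m (of_nat (Poly_Mapping.lookup m i) * c)" for i
  proof (cases "Poly_Mapping.lookup m i = 0")
    case False
    have "Poly_Mapping.single i 1 + (m - Poly_Mapping.single i 1) = m"
      using False by (intro poly_mapping_eqI) (auto simp: lookup_add lookup_minus lookup_single when_def)
    then show ?thesis by (simp add: pd_single Var_def mult_single)
  qed (simp add: pd_single)
  then have "(\<Sum>i\<in>UNIV. Var i * pd i (Poly_Mapping.single m c)) = (\<Sum>i\<in>UNIV. Poly_Mapping.single m (of_nat (Poly_Mapping.lookup m i) * c))"
    by simp
  also have "\<dots> = Poly_Mapping.single m (\<Sum>i\<in>UNIV. of_nat (Poly_Mapping.lookup m i) * c)"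
    by (rule poly_mapping_eqI) (simp add: lookup_sum lookup_single when_def)
  also have "\<dots> = Const (of_nat d) * Poly_Mapping.single m c"
    using single by (simp add: Const_def mult_single mdeg_def del: single_of_nat flip: sum_distrib_right of_nat_sum)
  finally show ?case .
qed (auto simp: pd_add distrib_left sum.distrib)

definition dird :: "'k::field poly4 \<Rightarrow> 'k ^ 4 \<Rightarrow> 'k ^ 4 \<Rightarrow> 'k" where
  "dird F v w = coeff (linepoly F v w) 1"

lemma dird_pderiv: "dird F v w = poly (pderiv (linepoly F v w)) 0"
  by (simp add: dird_def poly_0_coeff_0 coeff_pderiv)

lemma dird_eq_pd: "dird F v w = (\<Sum>i\<in>UNIV. w $ i * eval4 (pd i F) v)"
proof (induction F rule: poly4_induct)
  case zero
  then show ?case by (simp add: dird_def linepoly_simps eval4_simps)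
next
  case (add F G)
  then show ?case by (simp add: dird_def linepoly_simps eval4_simps pd_add distrib_left sum.distrib)
next
  case (single m c)
  have pdd: "pderiv ([:v $ i, w $ i:] ^ n) = smult (of_nat n) ([:v $ i, w $ i:] ^ (n - 1) * [:w $ i:])" for i n
    by (cases n) (simp_all add: pderiv_power_Suc pderiv_pCons mult.commute del: power_Suc)
  have pr: "(\<Prod>k\<in>UNIV - {i}. v $ k ^ Poly_Mapping.lookup m k) * v $ i ^ (Poly_Mapping.lookup m i - 1)
      = (\<Prod>k\<in>UNIV. v $ k ^ Poly_Mapping.lookup (m - Poly_Mapping.single i 1) k)" for i
    by (subst (2) prod.remove[of _ i])
       (auto simp: lookup_minus lookup_single when_def intro!: prod.cong)
  show ?case
    unfolding dird_pderiv linepoly_single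
    by (simp add: pderiv_smult pderiv_prod pdd poly_sum poly_prod sum_distrib_left pd_single eval4_single
        pr[unfolded One_nat_def, symmetric]) (simp add: algebra_simps)
qed

lemma dird_add: "dird F v (w + w') = dird F v w + dird F v w'"
  by (simp add: dird_eq_pd distrib_right sum.distrib)

lemma dird_scale: "dird F v (c *s w) = c * dird F v w"
  by (simp add: dird_eq_pd sum_distrib_left mult.assoc)

lemma dird_zero [simp]: "dird F v 0 = 0"
  by (simp add: dird_eq_pd)

lemma dird_minus: "dird F v (w - w') = dird F v w - dird F v w'"
  by (simp add: dird_eq_pd left_diff_distrib sum_subtractf)

lemma dird_self: "homogeneous d F \<Longrightarrow> dird F v v = of_nat d * eval4 F v"
  using arg_cong[OF Euler_poly4[of d F], of "\<lambda>G. eval4 G v"] by (simp add: dird_eq_pd eval4_simps)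

lemma dird_shift: "dird F (v + t *s w) w = poly (pderiv (linepoly F v w)) t"
  by (simp add: dird_pderiv linepoly_shift pderiv_pcompose poly_pcompose pderiv_pCons)

lemma dird_linear_change: "dird (linear_change A F) v w = dird F (A *v v) (A *v w)"
  by (simp add: dird_def linepoly_linear_change)

text \<open>The polar \<open>dird F _ w\<close> as a form in its first argument, so that it can
  itself be restricted to lines and differentiated.\<close>

definition dirpoly :: "'k::field poly4 \<Rightarrow> 'k ^ 4 \<Rightarrow> 'k poly4" where
  "dirpoly F w = (\<Sum>i\<in>UNIV. Const (w $ i) * pd i F)"

lemma eval4_dirpoly: "eval4 (dirpoly F w) v = dird F v w"
  by (simp add: dirpoly_def dird_eq_pd eval4_simps)

lemma homogeneous_dirpoly: "homogeneous d F \<Longrightarrow> homogeneous (d - 1) (dirpoly F w)"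
  unfolding dirpoly_def by (intro homogeneous_sum homogeneous_Const_mult homogeneous_pd)

lemma dird_dirpoly: "dird (dirpoly F u) v w = (\<Sum>i\<in>UNIV. \<Sum>j\<in>UNIV. w $ i * u $ j * eval4 (pd i (pd j F)) v)"
  by (simp add: dird_eq_pd dirpoly_def pd_sum pd_Const_mult eval4_simps sum_distrib_left mult.assoc)

lemma dird_dirpoly_commute: "dird (dirpoly F u) v w = dird (dirpoly F w) v u"
  unfolding dird_dirpoly by (subst sum.swap) (simp add: pd_commute mult.commute)

lemma dird_dirpoly_add: "dird (dirpoly F (u + u')) v w = dird (dirpoly F u) v w + dird (dirpoly F u') v w"
  by (simp add: dird_dirpoly_commute[of F _ v w] dird_add)

lemma dird_dirpoly_scale: "dird (dirpoly F (c *s u)) v w = c * dird (dirpoly F u) v w"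
  by (simp add: dird_dirpoly_commute[of F _ v w] dird_scale)

text \<open>By symmetry of second derivatives this is Euler's relation for the form
  \<open>dirpoly F w\<close> of degree \<open>d - 1\<close>.\<close>

lemma dird_dirpoly_self:
  "homogeneous d F \<Longrightarrow> dird (dirpoly F v) v w = of_nat (d - 1) * dird F v w"
  by (simp add: dird_dirpoly_commute[of F v] dird_self[OF homogeneous_dirpoly] eval4_dirpoly)

section \<open>Polynomials vanishing at all rational points\<close>

definition slice :: "4 \<Rightarrow> nat \<Rightarrow> 'k::field poly4 \<Rightarrow> 'k poly4" where
  "slice i j F = Poly_Mapping.mapp (\<lambda>m c. if Poly_Mapping.lookup m i = j then c else 0) F"

lemma lookup_slice:
  "Poly_Mapping.lookup (slice i j F) m = (if Poly_Mapping.lookup m i = j then Poly_Mapping.lookup F m else 0)"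
  by (simp add: slice_def lookup_mapp in_keys_iff when_def)

lemma slice_add: "slice i j (F + G) = slice i j F + slice i j G"
  by (rule poly_mapping_eqI) (simp add: lookup_slice lookup_add)

lemma slice_zero [simp]: "slice i j 0 = 0"
  by (rule poly_mapping_eqI) (simp add: lookup_slice)

lemma slice_single: "slice i j (Poly_Mapping.single m c) = (if Poly_Mapping.lookup m i = j then Poly_Mapping.single m c else 0)"
  by (rule poly_mapping_eqI) (simp add: lookup_slice lookup_single when_def)

lemma homogeneous_slice: "homogeneous d F \<Longrightarrow> homogeneous d (slice i j F)"
  by (auto simp: homogeneous_lookup lookup_slice)

text \<open>The line is parametrised by the \<open>i\<close>-th coordinate itself, so its
  coefficients sort the monomials by their exponent at \<open>i\<close>.\<close>

lemma eval4_slice: "eval4 (slice i j F) v = v $ i ^ j * coeff (linepoly F (v - v $ i *s axis i 1) (axis i 1)) j"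
proof (induction F rule: poly4_induct)
  case zero
  then show ?case by (simp add: linepoly_simps eval4_simps)
next
  case (add F G)
  then show ?case by (simp add: linepoly_simps eval4_simps slice_add distrib_left)
next
  case (single m c)
  have "(\<Prod>k\<in>UNIV. [:(v - v $ i *s axis i 1) $ k, axis i 1 $ k:] ^ Poly_Mapping.lookup m k)
    = [:0, 1:] ^ Poly_Mapping.lookup m i * (\<Prod>k\<in>UNIV - {i}. [:v $ k:] ^ Poly_Mapping.lookup m k)"
    by (subst prod.remove[of _ i]) (auto simp: axis_def intro!: prod.cong)
  also have "\<dots> = monom (\<Prod>k\<in>UNIV - {i}. v $ k ^ Poly_Mapping.lookup m k) (Poly_Mapping.lookup m i)"
    by (simp add: monom_altdef mult.commute poly_const_pow
        flip: ring_map_prod[OF const_poly_ring_map])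
  finally have *: "linepoly (Poly_Mapping.single m c) (v - v $ i *s axis i 1) (axis i 1)
    = monom (c * (\<Prod>k\<in>UNIV - {i}. v $ k ^ Poly_Mapping.lookup m k)) (Poly_Mapping.lookup m i)"
    unfolding linepoly_single by (simp add: smult_monom)
  show ?case
    unfolding * by (auto simp: slice_single eval4_single prod.remove[of UNIV i] eval4_simps)
qed

lemma slice_vanishes:
  fixes F :: "'k::{field,finite} poly4"
  assumes h: "homogeneous d F" and d: "d \<le> CARD('k)" and z: "\<And>v. eval4 F v = 0"
  shows "eval4 (slice i j F) v = 0"
proof -
  let ?p = "linepoly F (v - v $ i *s axis i 1) (axis i 1)"
  \<comment> \<open>If \<open>d\<close> equals the field size, the degree drops below it because the
    coefficient of t^d is a value of \<open>F\<close>.\<close>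
  have "coeff ?p n = 0" if "n \<ge> CARD('k)" for n
    using that d coeff_linepoly_above[OF h] coeff_linepoly_top[OF h] z by (metis le_neq_implies_less le_trans)
  then have "degree ?p < CARD('k)"
    by (metis degree_0 leI leading_coeff_0_iff zero_less_card_finite)
  then have "?p = 0"
    by (intro poly_eq_0_of_roots) (simp add: poly_linepoly z)
  then show ?thesis by (simp add: eval4_slice)
qed

lemma vanishing_imp_zero:
  fixes F :: "'k::{field,finite} poly4"
  assumes h: "homogeneous d F" and d: "d \<le> CARD('k)" and z: "\<And>v. eval4 F v = 0"
  shows "F = 0"
proof (rule poly_mapping_eqI)
  fix m :: "4 \<Rightarrow>\<^sub>0 nat"
  let ?l = "Poly_Mapping.lookup m"
  \<comment> \<open>Slicing in all four variables leaves a single monomial, whose value at the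
    all-ones vector is its coefficient.\<close>
  let ?S = "slice 4 (?l 4) (slice 3 (?l 3) (slice 2 (?l 2) (slice 1 (?l 1) F)))"
  have "?S = Poly_Mapping.single m (Poly_Mapping.lookup F m)"
  proof (rule poly_mapping_eqI)
    fix m'
    have "m = m' \<longleftrightarrow> (\<forall>i. Poly_Mapping.lookup m' i = ?l i)"
      by (auto simp: poly_mapping_eq_iff fun_eq_iff)
    then show "Poly_Mapping.lookup ?S m' = Poly_Mapping.lookup (Poly_Mapping.single m (Poly_Mapping.lookup F m)) m'"
      unfolding forall_4 by (auto simp: lookup_slice lookup_single when_def)
  qed
  moreover have "eval4 ?S (\<chi> i. 1) = 0"
    by (intro slice_vanishes[OF _ d] homogeneous_slice h z)
  ultimately show "Poly_Mapping.lookup F m = Poly_Mapping.lookup 0 m"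
    by (simp add: eval4_single)
qed

lemma eq_of_eval4_eq:
  fixes F G :: "'k::{field,finite} poly4"
  assumes "homogeneous d F" "homogeneous d G" "d \<le> CARD('k)" "\<And>v. eval4 F v = eval4 G v"
  shows "F = G"
proof -
  have "F - G = 0"
    by (rule vanishing_imp_zero[OF homogeneous_diff[OF assms(1,2)] assms(3)]) (simp add: eval4_simps assms(4))
  then show ?thesis by simp
qed

lemma of_nat_CARD: "of_nat CARD('k::{field,finite}) = (0::'k)"
proof -
  have "(\<Sum>x\<in>UNIV. x + 1) = (\<Sum>x\<in>UNIV. (x::'k))"
    by (rule sum.reindex_bij_witness[of _ "\<lambda>x. x - 1" "\<lambda>x. x + 1"]) auto
  then show ?thesis by (simp add: sum.distrib)
qed

lemma power_CARD: "(x::'k::{field,finite}) ^ CARD('k) = x"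
proof (cases "x = 0")
  case False
  have "(\<Prod>y\<in>UNIV-{0}. x * y) = (\<Prod>y\<in>UNIV-{0::'k}. y)"
    by (rule prod.reindex_bij_witness[of _ "\<lambda>y. y / x" "\<lambda>y. x * y"]) (use False in auto)
  then have "x ^ card (UNIV - {0::'k}) * (\<Prod>y\<in>UNIV-{0::'k}. y) = (\<Prod>y\<in>UNIV-{0::'k}. y)"
    by (simp add: prod.distrib)
  then have "x ^ card (UNIV - {0::'k}) = 1" by simp
  moreover have "Suc (card (UNIV - {0::'k})) = CARD('k)" by (rule card_Suc_Diff1) auto
  ultimately show ?thesis by (metis mult.right_neutral power_Suc)
qed (simp add: zero_power)

text \<open>In degree q + 1 a nonzero form may vanish everywhere. But the partial derivatives of the
  difference have degree q and vanish, and Euler's relation recovers the difference because q + 1 =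
  1 in the field.\<close>

lemma eq_of_dird_eq:
  fixes F G :: "'k::{field,finite} poly4"
  assumes hF: "homogeneous (CARD('k) + 1) F" and hG: "homogeneous (CARD('k) + 1) G"
    and "\<And>v w. dird F v w = dird G v w"
  shows "F = G"
proof -
  define H where "H = F - G"
  have h: "homogeneous (CARD('k) + 1) H" unfolding H_def by (rule homogeneous_diff[OF hF hG])
  have d0: "dird H v w = 0" for v w
    using assms(3)[of v w] by (simp add: dird_def H_def linepoly_simps)
  have "pd i H = 0" for i
  proof (rule vanishing_imp_zero)
    show "homogeneous (CARD('k)) (pd i H)" using homogeneous_pd[OF h, of i] by simp
    have "eval4 (pd i H) v = dird H v (axis i 1)" for v
      unfolding dird_eq_pd by (subst sum.remove[of _ i]) (auto simp: axis_def intro!: sum.neutral)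
    then show "eval4 (pd i H) v = 0" for v by (simp add: d0)
  qed simp
  then have "Const (of_nat (CARD('k) + 1)) * H = 0"
    using Euler_poly4[OF h] by simp
  then have "H = 0" by (simp add: of_nat_CARD ring_mapD[OF Const_ring_map])
  then show ?thesis by (simp add: H_def)
qed

section \<open>Linear factors\<close>

lemma dvd_power_diff: "(L::'r::comm_ring_1) dvd a - b \<Longrightarrow> L dvd a ^ n - b ^ n"
proof (induction n)
  case (Suc n)
  have "a ^ Suc n - b ^ Suc n = a * (a ^ n - b ^ n) + (a - b) * b ^ n" by (simp add: algebra_simps)
  then show ?case using Suc by (metis dvd_add dvd_mult dvd_mult2)
qed simp

lemma dvd_prod_diff:
  fixes L :: "'r::comm_ring_1"
  assumes "\<And>i. i \<in> A \<Longrightarrow> L dvd f i - g i"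
  shows "L dvd prod f A - prod g A"
  using assms
proof (induction A rule: infinite_finite_induct)
  case (insert x A)
  have "prod f (insert x A) - prod g (insert x A) = f x * (prod f A - prod g A) + (f x - g x) * prod g A"
    using insert by (simp add: algebra_simps)
  then show ?case using insert by (metis dvd_add dvd_mult dvd_mult2 insertI1 insertI2)
qed auto

lemma dvd_ev_diff:
  assumes "\<And>i. L dvd x i - y i"
  shows "L dvd ev h x F - ev h y F"
  unfolding ev_def sum_subtractf[symmetric] right_diff_distrib[symmetric]
  by (intro dvd_sum dvd_mult dvd_prod_diff dvd_power_diff assms)

lemma ev_Const_Var: "ev Const Var F = F"
proof (induction F rule: poly4_induct)
  case (single m c)
  have pw: "Var i ^ n = Poly_Mapping.single (Poly_Mapping.single i n) 1" for i n
    by (induction n) (auto simp: Var_def mult_single simp flip: single_add)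
  have pr: "(\<Prod>i\<in>A. Poly_Mapping.single (f i) (1::'a)) = Poly_Mapping.single (\<Sum>i\<in>A. f i) 1" for A and f :: "4 \<Rightarrow> 4 \<Rightarrow>\<^sub>0 nat"
    by (induction A rule: infinite_finite_induct) (auto simp: mult_single)
  have "(\<Sum>i\<in>UNIV. Poly_Mapping.single i (Poly_Mapping.lookup m i)) = m"
    by (rule poly_mapping_eqI) (simp add: lookup_sum lookup_single when_def)
  then show ?case
    unfolding ev_single[OF Const_ring_map] pw pr by (simp add: Const_def mult_single)
qed (auto simp: ev_add[OF Const_ring_map])

lemma eval4_linform: "eval4 (linform c) v = (\<Sum>i\<in>UNIV. c i * v $ i)"
  by (simp add: linform_def eval4_simps)

text \<open>\<open>x\<close> projects along \<open>D\<close> onto the kernel of the linear form.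
  Substituting it gives a form vanishing everywhere, hence zero, and \<open>F\<close> is congruent
  to that form modulo \<open>linform c\<close>.\<close>

lemma linform_dvd:
  fixes F :: "'k::{field,finite} poly4"
  assumes h: "homogeneous d F" and d: "d \<le> CARD('k)"
    and D: "eval4 (linform c) D = 1"
    and z: "\<And>v. eval4 (linform c) v = 0 \<Longrightarrow> eval4 F v = 0"
  shows "linform c dvd F"
proof -
  define x where "x i = Var i - Const (D $ i) * linform c" for i
  have "ev Const x F = 0"
  proof (rule vanishing_imp_zero[OF _ d])
    show "homogeneous d (ev Const x F)"
      unfolding x_def
      by (intro homogeneous_ev_Const h homogeneous_diff homogeneous_Const_mult homogeneous_linform homogeneous_Var)
    fix v
    have "eval4 (ev Const x F) v = eval4 F (v - eval4 (linform c) v *s D)"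
      by (subst ev_natural[OF eval4_ring_map])
         (auto intro!: arg_cong2[where f = "\<lambda>a b. ev a b F"]
           simp: fun_eq_iff eval4_ev[of F] eval4_simps x_def mult.commute)
    also have "\<dots> = 0"
    proof (rule z)
      have "eval4 (linform c) (v - a *s D) = eval4 (linform c) v - a * eval4 (linform c) D" for a
        by (simp add: eval4_linform right_diff_distrib sum_subtractf sum_distrib_left mult.left_commute)
      then show "eval4 (linform c) (v - eval4 (linform c) v *s D) = 0" by (simp add: D)
    qed
    finally show "eval4 (ev Const x F) v = 0" .
  qed
  moreover have "linform c dvd ev Const Var F - ev Const x F"
    by (rule dvd_ev_diff) (simp add: x_def)
  ultimately show ?thesis by (simp add: ev_Const_Var)
qed

section \<open>Two-dimensional subspaces\<close>

lemma roots_card_less: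
  fixes p :: "'k::{field,finite} poly"
  assumes "p \<noteq> 0" "\<And>n. n \<ge> k \<Longrightarrow> coeff p n = 0"
  shows "card {t. poly p t = 0} < k"
proof -
  have "degree p < k" using assms by (metis leI leading_coeff_0_iff)
  then show ?thesis using card_poly_roots_bound[OF assms(1)] by simp
qed

definition indep :: "'k::field ^ 4 \<Rightarrow> 'k ^ 4 \<Rightarrow> bool" where
  "indep P Q \<longleftrightarrow> P \<noteq> 0 \<and> (\<forall>c. Q \<noteq> c *s P)"

definition join :: "'k::field ^ 4 \<Rightarrow> 'k ^ 4 \<Rightarrow> ('k ^ 4) set" where
  "join P Q = (\<lambda>(x, y). x *s P + y *s Q) ` UNIV"

text \<open>A projective line is its two-dimensional vector space; the cardinality stands in for the
  dimension because the arguments are counts.\<close>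

definition line :: "('k::{field,finite} ^ 4) set \<Rightarrow> bool" where
  "line l \<longleftrightarrow> vec.subspace l \<and> card l = CARD('k) ^ 2"

lemma indepD:
  assumes "indep P Q" "x *s P + y *s Q = 0"
  shows "x = 0 \<and> y = 0"
proof -
  have "y = 0"
  proof (rule ccontr)
    assume "y \<noteq> 0"
    have "(1 / y) *s (x *s P + y *s Q) = 0" using assms(2) by simp
    then have "Q = (- x / y) *s P" using \<open>y \<noteq> 0\<close>
      by (simp add: vec_eq_iff field_simps) (metis add.commute add_eq_0_iff)
    then show False using assms(1) unfolding indep_def by blast
  qed
  then show ?thesis using assms by (auto simp: indep_def)
qed

lemma join_inj: "indep P Q \<Longrightarrow> inj (\<lambda>(x, y). x *s P + y *s Q)"
proof (rule injI, clarify)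
  fix x y x' y' assume i: "indep P Q" and "x *s P + y *s Q = x' *s P + y' *s Q"
  then have "(x - x') *s P + (y - y') *s Q = 0" by (simp add: vec_eq_iff algebra_simps)
  then show "x = x' \<and> y = y'" using indepD[OF i] by fastforce
qed

lemma joinI: "x *s P + y *s Q \<in> join P Q"
  unfolding join_def by (rule image_eqI[of _ _ "(x, y)"]) auto

lemma subspace_join: "vec.subspace (join P Q)"
proof (rule vec.subspaceI)
  show "0 \<in> join P Q" using joinI[of 0 P 0 Q] by simp
next
  fix u v assume "u \<in> join P Q" "v \<in> join P Q"
  then obtain x y x' y' where "u = x *s P + y *s Q" "v = x' *s P + y' *s Q" by (auto simp: join_def)
  then have "u + v = (x + x') *s P + (y + y') *s Q" by (simp add: vec_eq_iff algebra_simps)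
  then show "u + v \<in> join P Q" by (simp only: joinI)
next
  fix c u assume "u \<in> join P Q"
  then obtain x y where "u = x *s P + y *s Q" by (auto simp: join_def)
  then have "c *s u = (c * x) *s P + (c * y) *s Q" by (simp add: vec_eq_iff algebra_simps)
  then show "c *s u \<in> join P Q" by (simp only: joinI)
qed

lemma line_join:
  fixes P Q :: "'k::{field,finite} ^ 4"
  assumes "indep P Q"
  shows "line (join P Q)"
  unfolding line_def using subspace_join card_image[OF join_inj[OF assms]]
  by (simp add: join_def power2_eq_square card_cartesian_product flip: UNIV_Times_UNIV)

lemma join_mem: "P \<in> join P Q" "Q \<in> join P Q"
  using joinI[of 1 P 0 Q] joinI[of 0 P 1 Q] by auto

lemma line_simps:
  assumes "line l"
  shows "0 \<in> l" "u \<in> l \<Longrightarrow> v \<in> l \<Longrightarrow> u + v \<in> l" "u \<in> l \<Longrightarrow> c *s u \<in> l" "u \<in> l \<Longrightarrow> v \<in> l \<Longrightarrow> u - v \<in> l"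
  using assms by (auto simp: line_def vec.subspace_0 vec.subspace_add vec.subspace_scale vec.subspace_diff)

lemma line_card: "line l \<Longrightarrow> card l = CARD('k) ^ 2" for l :: "('k::{field,finite} ^ 4) set"
  by (simp add: line_def)

lemma line_eq_join:
  assumes "line l" "P \<in> l" "Q \<in> l" "indep P Q"
  shows "l = join P Q"
proof -
  have "join P Q \<subseteq> l" using assms line_simps[OF assms(1)] by (auto simp: join_def)
  moreover have "card (join P Q) = card l" using line_join[OF assms(4)] assms(1) by (simp add: line_def)
  ultimately show ?thesis by (metis card_subset_eq finite)
qed

lemma card_field_ge2: "CARD('k::{field,finite}) \<ge> 2"
proof -
  have "card {0, 1::'k} \<le> CARD('k)" by (intro card_mono) auto
  then show ?thesis by simp
qed

lemma line_other_point:
  fixes l :: "('k::{field,finite} ^ 4) set"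
  assumes "line l" "P \<noteq> 0"
  obtains Q where "Q \<in> l" "indep P Q"
proof -
  have "card (range (\<lambda>c. c *s P)) \<le> CARD('k)" by (rule card_image_le) simp
  also have "\<dots> < card l" using line_card[OF assms(1)] card_field_ge2[where 'k='k] by (simp add: power2_eq_square)
  finally have "\<not> l \<subseteq> range (\<lambda>c. c *s P)" by (metis card_mono finite not_le)
  then show ?thesis using that assms(2) by (auto simp: indep_def)
qed

text \<open>A projective plane if \<open>w\<close> lies outside the line \<open>l\<close>; for
  \<open>w\<close> in \<open>l\<close> it collapses to \<open>l\<close>.\<close>

definition plane :: "('k::field ^ 4) set \<Rightarrow> 'k ^ 4 \<Rightarrow> ('k ^ 4) set" where
  "plane l w = (\<lambda>(c, u). c *s w + u) ` (UNIV \<times> l)"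

lemma planeI: "u \<in> l \<Longrightarrow> c *s w + u \<in> plane l w"
  unfolding plane_def by (rule image_eqI[of _ _ "(c, u)"]) auto

lemma plane_add: "line l \<Longrightarrow> v \<in> plane l w \<Longrightarrow> v' \<in> plane l w \<Longrightarrow> v + v' \<in> plane l w"
proof -
  assume l: "line l" and "v \<in> plane l w" "v' \<in> plane l w"
  then obtain c u c' u' where "u \<in> l" "u' \<in> l" and e: "v = c *s w + u" "v' = c' *s w + u'"
    by (auto simp: plane_def)
  then have "(c + c') *s w + (u + u') \<in> plane l w" by (intro planeI line_simps(2)[OF l])
  then show ?thesis by (simp add: e vec.scale_left_distrib add_ac)
qed

lemma plane_scale: "line l \<Longrightarrow> v \<in> plane l w \<Longrightarrow> a *s v \<in> plane l w"
proof -
  assume l: "line l" and "v \<in> plane l w"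
  then obtain c u where "u \<in> l" and e: "v = c *s w + u" by (auto simp: plane_def)
  then have "(a * c) *s w + a *s u \<in> plane l w" by (intro planeI line_simps(3)[OF l])
  then show ?thesis by (simp add: e vec.scale_right_distrib)
qed

lemma CARD_space: "CARD('k::{field,finite} ^ 4) = CARD('k) ^ 4"
  by (simp add: CARD_vec)

lemma card_plane_le:
  fixes l :: "('k::{field,finite} ^ 4) set"
  assumes "line l"
  shows "card (plane l w) \<le> CARD('k) ^ 3"
proof -
  have "card (plane l w) \<le> card ((UNIV :: 'k set) \<times> l)" unfolding plane_def by (rule card_image_le) simp
  then show ?thesis using line_card[OF assms] by (simp add: card_cartesian_product power2_eq_square power3_eq_cube)
qed

lemma outside_plane:
  fixes l :: "('k::{field,finite} ^ 4) set"
  assumes "line l"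
  obtains D where "D \<notin> plane l w"
proof -
  have "CARD('k) ^ 3 < CARD('k) ^ 4" using card_field_ge2[where 'k='k] by (intro power_strict_increasing) auto
  then have "card (plane l w) < card (UNIV :: ('k ^ 4) set)" using card_plane_le[OF assms, of w] by (simp add: CARD_space)
  then have "plane l w \<noteq> UNIV" by auto
  then show ?thesis using that by auto
qed

lemma line_not_scale: "line l \<Longrightarrow> w \<notin> l \<Longrightarrow> c *s w + u \<in> l \<Longrightarrow> u \<in> l \<Longrightarrow> c = 0"
proof (rule ccontr)
  assume l: "line l" and w: "w \<notin> l" and a: "c *s w + u \<in> l" "u \<in> l" and c: "c \<noteq> 0"
  have "(1 / c) *s (c *s w + u - u) \<in> l" by (intro line_simps[OF l] a)
  then show False using w c by simp
qed

text \<open>Coordinate along \<open>D\<close> in the decomposition of the space into a plane and \<open>D\<close>.\<close>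

lemma plane_functional:
  fixes l :: "('k::{field,finite} ^ 4) set"
  assumes l: "line l" and w: "w \<notin> l" and D: "D \<notin> plane l w"
  obtains c where "eval4 (linform c) D = 1" "\<And>v. eval4 (linform c) v = 0 \<Longrightarrow> v \<in> plane l w"
proof -
  define W where "W = plane l w"
  have W: "v \<in> W \<Longrightarrow> v' \<in> W \<Longrightarrow> v + v' \<in> W" "v \<in> W \<Longrightarrow> a *s v \<in> W" for v v' a
    unfolding W_def by (auto intro: plane_add plane_scale l)
  have uniq: "a = b" if "a *s D + v = b *s D + v'" "v \<in> W" "v' \<in> W" for a b v v'
  proof (rule ccontr)
    assume "a \<noteq> b"
    define e where "e = a - b"
    have "v' + (-1) *s v = e *s D" using that(1) by (simp add: vec_eq_iff algebra_simps e_def)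
    then have "e *s D \<in> W" using W that by metis
    then have "(1 / e) *s (e *s D) \<in> W" by (rule W)
    moreover have "e \<noteq> 0" using \<open>a \<noteq> b\<close> by (simp add: e_def)
    ultimately show False using D by (simp add: W_def)
  qed
  have cW: "card W = CARD('k) ^ 3"
  proof -
    have "inj_on (\<lambda>(c, u). c *s w + u) (UNIV \<times> l)"
    proof (rule inj_onI, clarify)
      fix a u b v assume u: "u \<in> l" "v \<in> l" and e: "a *s w + u = b *s w + v"
      have "(a - b) *s w + u = v" using e by (simp add: vec_eq_iff algebra_simps)
      then have "a - b = 0" using line_not_scale[OF l w] u by metis
      then show "a = b \<and> u = v" using e by simp
    qed
    then show ?thesis unfolding W_def plane_def
      using line_card[OF l] by (simp add: card_image card_cartesian_product power2_eq_square power3_eq_cube)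
  qed
  \<comment> \<open>Since q * q^3 = q^4, injectivity already shows that \<open>W\<close> and
    \<open>D\<close> span the space.\<close>
  have "inj_on (\<lambda>(c, u). c *s D + u) (UNIV \<times> W)"
    by (rule inj_onI, clarify) (use uniq in \<open>metis add_left_cancel\<close>)
  then have "card ((\<lambda>(c, u). c *s D + u) ` (UNIV \<times> W)) = CARD('k ^ 4)"
    by (simp add: card_image card_cartesian_product cW CARD_space power4_eq_xxxx power3_eq_cube)
  then have surj: "(\<lambda>(c, u). c *s D + u) ` (UNIV \<times> W) = UNIV"
    by (intro card_subset_eq) auto
  define \<delta> where "\<delta> v = (THE a. \<exists>u\<in>W. v = a *s D + u)" for v
  have \<delta>I: "\<delta> (a *s D + u) = a" if "u \<in> W" for a u
    unfolding \<delta>_def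
  proof (rule the_equality)
    show "\<exists>v\<in>W. a *s D + u = a *s D + v" using that by blast
  next
    fix b assume "\<exists>v\<in>W. a *s D + u = b *s D + v"
    then show "b = a" using uniq that by metis
  qed
  have \<delta>E: "\<exists>u\<in>W. v = \<delta> v *s D + u" for v
  proof -
    have "v \<in> (\<lambda>(c, u). c *s D + u) ` (UNIV \<times> W)" by (simp add: surj)
    then obtain a u where "v = a *s D + u" "u \<in> W" by auto
    then show ?thesis using \<delta>I by auto
  qed
  have add: "\<delta> (v + v') = \<delta> v + \<delta> v'" for v v'
  proof -
    obtain u u' where u: "u \<in> W" "u' \<in> W" and "v = \<delta> v *s D + u" "v' = \<delta> v' *s D + u'" using \<delta>E by metis
    then have "v + v' = (\<delta> v + \<delta> v') *s D + (u + u')"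
      by (metis (no_types, opaque_lifting) add.assoc add.left_commute vec.scale_left_distrib)
    then show ?thesis using \<delta>I[OF W(1)[OF u]] by metis
  qed
  have scale: "\<delta> (b *s v) = b * \<delta> v" for b v
  proof -
    obtain u where u: "u \<in> W" and "v = \<delta> v *s D + u" using \<delta>E by metis
    then have "b *s v = (b * \<delta> v) *s D + b *s u" by (metis vec.scale_right_distrib vec.scale_scale)
    then show ?thesis using \<delta>I[OF W(2)[OF u]] by metis
  qed
  have zero: "\<delta> 0 = 0" using scale[of 0 0] by simp
  have "\<delta> v = eval4 (linform (\<lambda>i. \<delta> (axis i 1))) v" for v
  proof -
    have "\<delta> (\<Sum>i\<in>A. v $ i *s axis i 1) = (\<Sum>i\<in>A. \<delta> (axis i 1) * v $ i)" for A
      by (induction A rule: infinite_finite_induct) (auto simp: zero add scale)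
    from this[of UNIV] show ?thesis unfolding eval4_linform basis_expansion .
  qed
  note \<delta> = this
  show ?thesis
  proof (rule that)
    have "0 \<in> W" using W(2)[of w 0] planeI[OF line_simps(1)[OF l], of 1 w] by (simp add: W_def)
    then show "eval4 (linform (\<lambda>i. \<delta> (axis i 1))) D = 1" using \<delta>I[of 0 1] by (simp flip: \<delta>)
  next
    fix v assume "eval4 (linform (\<lambda>i. \<delta> (axis i 1))) v = 0"
    then have "\<delta> v = 0" by (simp flip: \<delta>)
    then show "v \<in> plane l w" using \<delta>E[of v] by (simp add: W_def)
  qed
qed

text \<open>The kernel of a functional has dimension at least three. The witness is a vector outside
  a plane through \<open>l\<close>, corrected along a direction of that plane on which the
  functional is nonzero.\<close>

lemma kernel_outside_line:
  fixes F :: "'k::{field,finite} poly4"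
  assumes l: "line l"
  obtains w where "w \<notin> l" "dird F Q w = 0"
proof (cases "\<exists>w0. dird F Q w0 \<noteq> 0")
  case True
  then obtain w0 where w0: "dird F Q w0 \<noteq> 0" by blast
  obtain D where D: "D \<notin> plane l w0" using outside_plane[OF l] by blast
  define c where "c = dird F Q D / dird F Q w0"
  have "D - c *s w0 \<notin> l"
  proof
    assume "D - c *s w0 \<in> l"
    then have "c *s w0 + (D - c *s w0) \<in> plane l w0" by (rule planeI)
    then show False using D by simp
  qed
  moreover have "dird F Q (D - c *s w0) = 0" using w0 by (simp add: dird_minus dird_scale c_def)
  ultimately show ?thesis using that by blast
next
  case False
  obtain D where "D \<notin> plane l 0" using outside_plane[OF l] by blast
  then have "D \<notin> l" using planeI[of D l 0 0] by auto
  then show ?thesis using False that by blast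
qed

text \<open>Double counting: each \<open>h t\<close> permutes \<open>l\<close>, so every
  \<open>t\<close> contributes the same number of pairs.\<close>

lemma sum_card_swap:
  assumes "finite S" "finite l" "\<And>t. t \<in> S \<Longrightarrow> bij_betw (h t) l l"
  shows "(\<Sum>u\<in>l. card {t\<in>S. R (h t u)}) = card S * card {u\<in>l. R u}"
proof -
  have "(\<Sum>u\<in>l. card {t\<in>S. R (h t u)}) = (\<Sum>u\<in>l. \<Sum>t\<in>S. of_bool (R (h t u)))"
    using assms(1) by (intro sum.cong refl) (simp add: Int_def)
  also have "\<dots> = (\<Sum>t\<in>S. \<Sum>u\<in>l. of_bool (R (h t u)))" by (rule sum.swap)
  also have "\<dots> = (\<Sum>t\<in>S. \<Sum>u\<in>l. of_bool (R u))"
    by (intro sum.cong refl sum.reindex_bij_betw[OF assms(3)])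
  also have "\<dots> = card S * card {u\<in>l. R u}" using assms(2) by (simp add: Int_def)
  finally show ?thesis .
qed

section \<open>Surfaces of degree at most q attaining the bound\<close>

text \<open>\<open>count\<close> states the number (q - 1) N + 1 of zero vectors, the origin
  included, with \<open>d * q\<close> moved to the left to avoid subtraction. Degree q + 1 is
  treated separately.\<close>

locale extremal_surface =
  fixes F :: "'k::{field,finite} poly4" and d q :: nat
  assumes q_def: "q = CARD('k)" and hom: "homogeneous d F" and d2: "2 \<le> d" and dq: "d \<le> q"
    and noplane: "\<And>c D. eval4 (linform c) D \<noteq> 0 \<Longrightarrow> \<not> linform c dvd F"
    and count: "card {v. eval4 F v = 0} + d * q = (d - 1) * q ^ 3 + q ^ 2 + q"
begin

abbreviation f where "f \<equiv> eval4 F"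
abbreviation B where "B \<equiv> dird F"

section \<open>Lines through a point of the surface\<close>

lemma q2: "q \<ge> 2" using d2 dq by simp

lemma f_scale: "f (c *s v) = c ^ d * f v" by (rule eval4_scale[OF hom])

lemma f_0 [simp]: "f 0 = 0" using eval4_0[OF hom] d2 by simp

lemma B_scale1: "B (c *s v) w = c ^ (d - 1) * B v w"
  using eval4_scale[OF homogeneous_dirpoly[OF hom]] by (simp flip: eval4_dirpoly)

lemma B_0 [simp]: "B 0 w = 0" using B_scale1[of 0 0 w] d2 by (simp add: zero_power)

lemmas B_lin = dird_add dird_scale dird_minus

lemma B_self: "f v = 0 \<Longrightarrow> B v v = 0" by (simp add: dird_self[OF hom])

text \<open>The point \<open>P\<close> sits at infinity of \<open>w + t *s P\<close>. Hence a line
  through \<open>P\<close> that is not contained has at most \<open>d - 1\<close> zeros besides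
  \<open>P\<close>, and at most \<open>d - 2\<close> if it is tangent at \<open>P\<close>.\<close>

lemma coeff_secant:
  assumes "f P = 0"
  shows "n \<ge> d \<Longrightarrow> coeff (linepoly F w P) n = 0" "coeff (linepoly F w P) (d - 1) = B P w"
proof -
  show "n \<ge> d \<Longrightarrow> coeff (linepoly F w P) n = 0"
    using assms coeff_linepoly_top[OF hom] coeff_linepoly_above[OF hom] by (cases "n = d") auto
  show "coeff (linepoly F w P) (d - 1) = B P w"
    using d2 by (subst coeff_linepoly_rev[OF hom]) (auto simp: dird_def)
qed

lemma roots_transversal: "f P = 0 \<Longrightarrow> B P w \<noteq> 0 \<Longrightarrow> card {t. f (w + t *s P) = 0} \<le> d - 1"
  using roots_card_less[of "linepoly F w P" d] coeff_secant(1)[of P _ w] coeff_secant(2)[of P w] d2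
  by (cases "linepoly F w P = 0") (auto simp: poly_linepoly)

lemma roots_le: "f P = 0 \<Longrightarrow> f (w + s *s P) \<noteq> 0 \<Longrightarrow> card {t. f (w + t *s P) = 0} \<le> d - 1"
  using roots_card_less[of "linepoly F w P" d] coeff_secant(1)[of P _ w] coeff_secant(2)[of P w] d2 poly_linepoly[of F w P s]
  by (cases "linepoly F w P = 0") (auto simp: poly_linepoly)

lemma roots_tangent:
  assumes P: "f P = 0" "B P w = 0" and s: "f (w + s *s P) \<noteq> 0"
  shows "card {t. f (w + t *s P) = 0} \<le> d - 2"
proof -
  have "linepoly F w P \<noteq> 0" using s poly_linepoly[of F w P s] by auto
  moreover have "coeff (linepoly F w P) n = 0" if "n \<ge> d - 1" for n
    using that coeff_secant(1)[OF P(1), of n w] coeff_secant(2)[OF P(1), of w] P(2) by (cases "n = d - 1") auto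
  ultimately have "card {t. poly (linepoly F w P) t = 0} < d - 1" by (rule roots_card_less)
  then show ?thesis by (simp add: poly_linepoly)
qed

lemma zero_on_join:
  assumes "f P = 0" "\<And>t. f (w + t *s P) = 0"
  shows "f (x *s P + y *s w) = 0"
proof (cases "y = 0")
  case False
  then have "x *s P + y *s w = y *s (w + (x / y) *s P)" by (simp add: vec.scale_right_distrib add.commute)
  then show ?thesis by (metis assms(2) f_scale mult_zero_right)
qed (simp add: f_scale assms)

text \<open>As \<open>f w = 0\<close>, the degree is below \<open>d \<le> q\<close>, so q zeros
  annihilate the polynomial itself and not only its values.\<close>

lemma B_of_contained:
  assumes "f w = 0" "\<And>t. f (v + t *s w) = 0"
  shows "B v w = 0"
proof -
  have "linepoly F v w = 0"
  proof (rule ccontr)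
    assume "linepoly F v w \<noteq> 0"
    then have "card {t. poly (linepoly F v w) t = 0} < d"
      using coeff_secant(1)[OF assms(1)] by (rule roots_card_less)
    then show False using dq by (simp add: poly_linepoly assms(2) q_def)
  qed
  then show ?thesis by (simp add: dird_def)
qed

section \<open>Lines contained in the surface\<close>

definition cline :: "('k ^ 4) set \<Rightarrow> bool" where
  "cline l \<longleftrightarrow> line l \<and> (\<forall>u\<in>l. f u = 0)"

lemma clineD: "cline l \<Longrightarrow> line l" "cline l \<Longrightarrow> u \<in> l \<Longrightarrow> f u = 0"
  by (auto simp: cline_def)

lemma B_on_cline: "cline l \<Longrightarrow> P \<in> l \<Longrightarrow> Q \<in> l \<Longrightarrow> B P Q = 0"
  by (intro B_of_contained) (auto simp: cline_def intro: line_simps)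

lemma cline_join:
  assumes "f P = 0" "\<And>t. f (w + t *s P) = 0" "indep P w"
  shows "cline (join P w)"
  using zero_on_join[OF assms(1,2)] line_join[OF assms(3)] by (auto simp: cline_def join_def)

text \<open>Without contained lines, every line through a surface point \<open>P\<close> has at most
  \<open>d - 1\<close> further zeros, which is too few for the assumed count.\<close>

lemma exists_cline: "\<exists>l. cline l"
proof (rule ccontr)
  assume no: "\<nexists>l. cline l"
  let ?Z = "card {v. f v = 0}"
  have dq2: "d * q \<le> q ^ 2" using dq by (simp add: power2_eq_square)
  have "(d - 1) * q ^ 3 \<ge> 1 * 1" by (intro mult_le_mono) (use d2 q2 in auto)
  then have "?Z > 1" using count dq2 q2 by linarith
  then have "\<not> {v. f v = 0} \<subseteq> {0}" using card_mono[of "{0}" "{v. f v = 0}"] by fastforce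
  then obtain P where P: "f P = 0" "P \<noteq> 0" by auto
  let ?S = "range (\<lambda>c. c *s P)"
  have cS: "card ?S = q"
  proof -
    have "inj (\<lambda>c. c *s P)" using P(2) by (auto simp: inj_def)
    then show ?thesis by (simp add: card_image q_def)
  qed
  have le: "card {t. f (w + t *s P) = 0} \<le> d - 1" if "w \<notin> ?S" for w
  proof -
    have "indep P w" using that P(2) by (auto simp: indep_def)
    then have "\<not> (\<forall>t. f (w + t *s P) = 0)" using cline_join[OF P(1)] no by blast
    then show ?thesis using roots_le[OF P(1)] by blast
  qed
  \<comment> \<open>Pairs \<open>(w, t)\<close> with \<open>f (w + t *s P) = 0\<close> are counted:
    a multiple \<open>w\<close> of \<open>P\<close> contributes at most \<open>q\<close>, any other
    \<open>w\<close> at most \<open>d - 1\<close>.\<close>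
  have "q * ?Z = (\<Sum>w\<in>UNIV. card {t\<in>UNIV. f (w + t *s P) = 0})"
    by (subst sum_card_swap[where h = "\<lambda>t w. w + t *s P"])
       (auto simp: q_def intro!: bij_betw_byWitness[where f' = "\<lambda>w. w - t *s P" for t])
  also have "\<dots> = (\<Sum>w\<in>?S. card {t. f (w + t *s P) = 0}) + (\<Sum>w\<in>UNIV-?S. card {t. f (w + t *s P) = 0})"
    by (simp add: sum.subset_diff[of ?S UNIV])
  also have "\<dots> \<le> card ?S * q + card (UNIV - ?S) * (d - 1)"
  proof (rule add_mono)
    show "(\<Sum>w\<in>?S. card {t. f (w + t *s P) = 0}) \<le> card ?S * q"
      using sum_bounded_above[of ?S "\<lambda>w. card {t. f (w + t *s P) = 0}" q]
      by (simp add: q_def card_mono)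
    show "(\<Sum>w\<in>UNIV-?S. card {t. f (w + t *s P) = 0}) \<le> card (UNIV - ?S) * (d - 1)"
      using sum_bounded_above[of "UNIV-?S" "\<lambda>w. card {t. f (w + t *s P) = 0}" "d - 1"] le by simp
  qed
  also have "\<dots> = q * q + (q ^ 4 - q) * (d - 1)"
    by (simp add: card_Diff_subset cS CARD_space q_def)
  finally have 1: "q * ?Z \<le> q * q + (q ^ 4 - q) * (d - 1)" .
  obtain e where e: "d = Suc e" "e \<ge> 1" using d2 by (cases d) auto
  have 2: "q * ?Z + q * (d * q) = q * (e * q ^ 3 + q ^ 2 + q)"
    using count by (simp add: e flip: distrib_left)
  \<comment> \<open>Cancelling leaves \<open>q ^ 2 + e \<le> d * q\<close>, impossible for
    \<open>d \<le> q\<close> since \<open>e = d - 1\<close> is positive.\<close>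
  define Y where "Y = (q ^ 4 - q) * e"
  have "Y + q * e = q ^ 4 * e"
    using q2 by (simp add: Y_def self_le_power flip: add_mult_distrib)
  moreover have "q ^ 4 * e = q * (q ^ 3 * e)" by (simp add: power_numeral_reduce)
  moreover have "q * ?Z \<le> q * q + Y" using 1 e by (simp add: Y_def)
  ultimately have "q * (e * q ^ 3 + q ^ 2 + q + e) \<le> q * (q + q ^ 3 * e + d * q)"
    using 2 unfolding distrib_left by (simp only: mult_ac)
  then have "e * q ^ 3 + q ^ 2 + q + e \<le> q + q ^ 3 * e + d * q"
    using q2 by (simp flip: distrib_left)
  then show False using dq2 e by (simp add: mult.commute)
qed

section \<open>Plane sections through a contained line\<close>

definition aff :: "('k ^ 4) set \<Rightarrow> 'k ^ 4 \<Rightarrow> nat" where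
  "aff l w = card {u\<in>l. f (w + u) = 0}"

lemma bij_translate: "line l \<Longrightarrow> v \<in> l \<Longrightarrow> bij_betw (\<lambda>u. u + v) l l"
  by (rule bij_betw_byWitness[where f' = "\<lambda>u. u - v"]) (auto intro: line_simps)

text \<open>For \<open>w\<close> outside \<open>l\<close>, \<open>aff l w\<close> counts the points
  of the plane section off \<open>l\<close>, as each has one representative in the coset of
  \<open>w\<close>. Summing along the direction \<open>P\<close> counts every zero \<open>q\<close>
  times.\<close>

lemma sum_affine: "line l \<Longrightarrow> P \<in> l \<Longrightarrow> (\<Sum>u\<in>l. card {t. f (w + u + t *s P) = 0}) = q * aff l w"
  using sum_card_swap[of UNIV l "\<lambda>t u. u + t *s P" "\<lambda>u. f (w + u) = 0"] bij_translate[of l] line_simps(3)[of l]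
  by (simp add: aff_def q_def add.assoc)

lemma aff_shift: "line l \<Longrightarrow> v \<in> l \<Longrightarrow> aff l (w + v) = aff l w"
  unfolding aff_def
  by (rule bij_betw_same_card[of "\<lambda>u. u + v"], rule bij_betw_byWitness[where f' = "\<lambda>u. u - v"])
     (auto intro: line_simps simp: add_ac)

text \<open>Otherwise homogeneity spreads the zeros over the whole plane, whose linear form would
  then divide \<open>F\<close>.\<close>

lemma plane_not_contained:
  assumes l: "cline l" and w: "w \<notin> l"
  shows "\<exists>u\<in>l. f (w + u) \<noteq> 0"
proof (rule ccontr)
  assume "\<not> ?thesis"
  then have z: "f (w + u) = 0" if "u \<in> l" for u using that by auto
  note l' = clineD(1)[OF l]
  obtain D where "D \<notin> plane l w" using outside_plane[OF l'] .
  then obtain c where c: "eval4 (linform c) D = 1" and ker: "\<And>v. eval4 (linform c) v = 0 \<Longrightarrow> v \<in> plane l w"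
    using plane_functional[OF l' w] by metis
  have "f v = 0" if "v \<in> plane l w" for v
  proof -
    from that obtain a u where u: "u \<in> l" "v = a *s w + u" by (auto simp: plane_def)
    show ?thesis
    proof (cases "a = 0")
      case False
      then have "v = a *s (w + (1 / a) *s u)" using u by (simp add: vec.scale_right_distrib)
      then show ?thesis using z line_simps(3)[OF l' u(1)] by (metis f_scale mult_zero_right)
    qed (use u clineD(2)[OF l] in auto)
  qed
  then have "linform c dvd F" using ker dq by (intro linform_dvd[OF hom _ c]) (auto simp: q_def)
  then show False using noplane[of c D] c by simp
qed

lemma aff_bound_transversal:
  assumes l: "cline l" and P: "P \<in> l" "B P w \<noteq> 0"
  shows "aff l w \<le> (d - 1) * q"
proof -
  note l' = clineD(1)[OF l]
  have "q * aff l w = (\<Sum>u\<in>l. card {t. f (w + u + t *s P) = 0})" using sum_affine[OF l' P(1)] by simp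
  also have "\<dots> \<le> (\<Sum>u\<in>l. d - 1)"
    by (intro sum_mono roots_transversal) (use P clineD[OF l] B_on_cline[OF l] in \<open>auto simp: B_lin\<close>)
  also have "\<dots> = q * ((d - 1) * q)" using line_card[OF l'] by (simp add: power2_eq_square q_def)
  finally show ?thesis using q2 by simp
qed

lemma sum_pencil:
  assumes l: "line l"
  shows "(\<Sum>P\<in>l - {0}. card {t\<in>UNIV-{0}. f (w + t *s P) = 0}) = (q - 1) * card {P\<in>l - {0}. f (w + P) = 0}"
proof -
  have "bij_betw ((*s) t) (l - {0}) (l - {0})" if "t \<in> UNIV - {0}" for t
    by (rule bij_betw_byWitness[where f' = "(*s) (1 / t)"]) (use that in \<open>auto intro: line_simps[OF l]\<close>)
  then show ?thesis
    using sum_card_swap[of "UNIV - {0}" "l - {0}" "(*s)" "\<lambda>u. f (w + u) = 0"] by (simp add: q_def)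
qed

lemma card_line_nonzero: "line l \<Longrightarrow> card (l - {0}) = (q - 1) * (q + 1)" for l :: "('k ^ 4) set"
  using line_card[of l] line_simps(1)[of l]
  by (simp add: card_Diff_singleton q_def power2_eq_square algebra_simps)

text \<open>Take a point \<open>R\<close> of the plane off the surface. Each of the q + 1 lines from
  \<open>R\<close> to \<open>l\<close> is tangent at its point of \<open>l\<close>, so it carries at
  most \<open>d - 2\<close> zeros off \<open>l\<close>. Strictness amounts to
  \<open>d - 2 < q\<close>.\<close>

lemma aff_bound_tangent:
  assumes l: "cline l" and w: "w \<notin> l" and t: "\<And>P. P \<in> l \<Longrightarrow> B P w = 0"
  shows "aff l w < (d - 1) * q"
proof -
  note l' = clineD(1)[OF l]
  obtain u0 where u0: "u0 \<in> l" "f (w + u0) \<noteq> 0" using plane_not_contained[OF l w] by blast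
  define R where "R = w + u0"
  have "(q - 1) * card {P\<in>l - {0}. f (R + P) = 0} = (\<Sum>P\<in>l - {0}. card {t\<in>UNIV-{0}. f (R + t *s P) = 0})"
    by (rule sum_pencil[OF l', symmetric])
  also have "\<dots> \<le> (\<Sum>P\<in>l - {0}. d - 2)"
  proof (rule sum_mono)
    fix P assume P: "P \<in> l - {0}"
    have "card {t\<in>UNIV-{0}. f (R + t *s P) = 0} \<le> card {t. f (R + t *s P) = 0}" by (intro card_mono) auto
    also have "\<dots> \<le> d - 2"
      by (rule roots_tangent[of _ _ 0]) (use P u0 t clineD[OF l] B_on_cline[OF l] in \<open>auto simp: R_def B_lin\<close>)
    finally show "card {t\<in>UNIV-{0}. f (R + t *s P) = 0} \<le> d - 2" .
  qed
  also have "\<dots> = (q - 1) * ((q + 1) * (d - 2))"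
    by (simp only: sum_constant of_nat_id card_line_nonzero[OF l'] mult.assoc)
  finally have "card {P\<in>l - {0}. f (R + P) = 0} \<le> (q + 1) * (d - 2)" using q2 by simp
  moreover have "{P\<in>l - {0}. f (R + P) = 0} = {P\<in>l. f (R + P) = 0}" using u0 by (auto simp: R_def)
  ultimately have "aff l R \<le> (q + 1) * (d - 2)" by (simp add: aff_def)
  moreover have "(q + 1) * (d - 2) < (d - 1) * q"
  proof -
    obtain e where "d = e + 2" using d2 by (metis add.commute le_Suc_ex)
    then show ?thesis using dq by (simp add: algebra_simps)
  qed
  ultimately show ?thesis using aff_shift[OF l' u0(1)] by (simp add: R_def)
qed

text \<open>The bounds for all vectors outside \<open>l\<close>, together with \<open>q ^ 2\<close>
  for each vector of \<open>l\<close>, add up to exactly the assumed count, so no coset may fall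
  short.\<close>

lemma aff_eq:
  assumes l: "cline l" and w: "w \<notin> l"
  shows "aff l w = (d - 1) * q"
proof (rule ccontr)
  assume ne: "aff l w \<noteq> (d - 1) * q"
  note l' = clineD(1)[OF l]
  have le: "aff l v \<le> (d - 1) * q" if "v \<notin> l" for v
    using aff_bound_transversal[OF l] aff_bound_tangent[OF l that] by fastforce
  let ?Z = "card {v. f v = 0}"
  have "q ^ 2 * ?Z = (\<Sum>v\<in>UNIV. aff l v)"
    unfolding aff_def using line_card[OF l']
    by (subst sum_card_swap[where h = "\<lambda>u v. v + u"])
       (auto simp: q_def intro!: bij_betw_byWitness[where f' = "\<lambda>w. w - t" for t])
  also have "\<dots> = (\<Sum>v\<in>l. aff l v) + (\<Sum>v\<in>UNIV-l. aff l v)"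
    by (simp add: sum.subset_diff[of l UNIV])
  also have "(\<Sum>v\<in>l. aff l v) = (\<Sum>v\<in>l. q ^ 2)"
  proof (rule sum.cong[OF refl])
    fix v assume "v \<in> l"
    then have "{u\<in>l. f (v + u) = 0} = l" using clineD[OF l] line_simps[OF l'] by auto
    then show "aff l v = q ^ 2" using line_card[OF l'] by (simp add: aff_def q_def)
  qed
  also have "(\<Sum>v\<in>l. q ^ 2) + (\<Sum>v\<in>UNIV-l. aff l v) < (\<Sum>v\<in>l. q ^ 2) + (\<Sum>v\<in>UNIV-l. (d - 1) * q)"
    by (intro add_strict_left_mono sum_strict_mono_strong[of _ w]) (use le w ne in \<open>auto simp: order.strict_iff_order\<close>)
  also have "\<dots> = q ^ 2 * q ^ 2 + (q ^ 4 - q ^ 2) * ((d - 1) * q)"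
    using line_card[OF l'] by (simp add: card_Diff_subset CARD_space q_def)
  finally have 1: "q ^ 2 * ?Z < q ^ 2 * q ^ 2 + (q ^ 4 - q ^ 2) * ((d - 1) * q)" .
  obtain e where e: "d = Suc e" "e \<ge> 1" using d2 by (cases d) auto
  have e1: "d - 1 = e" using e by simp
  have 2: "q ^ 2 * ?Z + q ^ 2 * (d * q) = q ^ 2 * (e * q ^ 3 + q ^ 2 + q)"
    using count by (simp add: e flip: distrib_left)
  have "q ^ 4 = q ^ 2 * q ^ 2" by (simp flip: power_add)
  then have "(q ^ 4 - q ^ 2) * (e * q) + q ^ 2 * (e * q) = q ^ 2 * (q ^ 2 * (e * q))"
    using q2 by (simp flip: add_mult_distrib)
  then have "q ^ 2 * (e * q ^ 3 + q ^ 2 + q + e * q) < q ^ 2 * (q ^ 2 + q ^ 2 * (e * q) + d * q)"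
    using 1[unfolded e1] 2 by (simp only: distrib_left)
  then have "e * q ^ 3 + q ^ 2 + q + e * q < q ^ 2 + q ^ 2 * (e * q) + d * q" by simp
  then show False by (simp add: e power2_eq_square power3_eq_cube mult_ac)
qed

lemma exists_transversal: "cline l \<Longrightarrow> w \<notin> l \<Longrightarrow> \<exists>P\<in>l. B P w \<noteq> 0"
  using aff_bound_tangent aff_eq by fastforce

text \<open>By \<open>aff_eq\<close> the bound of \<open>aff_bound_transversal\<close> is attained,
  hence attained on each of the lines through \<open>P\<close> that were summed there.\<close>

lemma transversal_count:
  assumes l: "cline l" and w: "w \<notin> l" and P: "P \<in> l" "B P w \<noteq> 0" and u: "u \<in> l"
  shows "card {t. f (w + u + t *s P) = 0} = d - 1"
proof (rule ccontr)
  assume ne: "card {t. f (w + u + t *s P) = 0} \<noteq> d - 1"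
  note l' = clineD(1)[OF l]
  have le: "card {t. f (w + v + t *s P) = 0} \<le> d - 1" if "v \<in> l" for v
    by (rule roots_transversal) (use P that clineD[OF l] B_on_cline[OF l] in \<open>auto simp: B_lin\<close>)
  have "q * aff l w = (\<Sum>v\<in>l. card {t. f (w + v + t *s P) = 0})" using sum_affine[OF l' P(1)] by simp
  also have "\<dots> < (\<Sum>v\<in>l. d - 1)"
    by (rule sum_strict_mono_strong[of _ u]) (use le u ne in \<open>auto simp: order.strict_iff_order\<close>)
  also have "\<dots> = q * ((d - 1) * q)" using line_card[OF l'] by (simp add: power2_eq_square q_def)
  finally show False using aff_eq[OF l w] by simp
qed

text \<open>The root 0 is double, so dividing by the variable keeps the set of roots and lowers the
  degree.\<close>

lemma roots_double:
  fixes p :: "'k poly"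
  assumes "p \<noteq> 0" "coeff p 0 = 0" "coeff p 1 = 0" "\<And>n. n \<ge> Suc k \<Longrightarrow> coeff p n = 0"
  shows "card {t. poly p t = 0} < k"
proof -
  obtain r where p: "p = pCons 0 r" using assms(2) by (metis coeff_pCons_0 pCons_cases)
  have r0: "poly r 0 = 0" using assms(3) by (simp add: p poly_0_coeff_0)
  have "{t. poly p t = 0} = {t. poly r t = 0}" using r0 by (auto simp: p)
  moreover have "card {t. poly r t = 0} < k"
    by (rule roots_card_less) (use assms(1,4) in \<open>auto simp: p coeff_pCons\<close>, metis Suc_le_mono nat.case(2))
  ultimately show ?thesis by simp
qed

text \<open>If none of the q + 1 lines from \<open>w\<close> to \<open>l\<close> were contained,
  each would have at most \<open>d - 2\<close> zeros off \<open>l\<close> besides \<open>w\<close>,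
  but 1 + (q + 1)(d - 2) < (d - 1) q for \<open>d \<le> q\<close>.\<close>

lemma direction_exists:
  assumes l: "cline l" and w: "w \<notin> l" and z: "f w = 0"
  shows "\<exists>P\<in>l. P \<noteq> 0 \<and> (\<forall>t. f (w + t *s P) = 0)"
proof (rule ccontr)
  assume no: "\<not> ?thesis"
  note l' = clineD(1)[OF l]
  have "(q - 1) * card {P\<in>l - {0}. f (w + P) = 0} = (\<Sum>P\<in>l - {0}. card {t\<in>UNIV-{0}. f (w + t *s P) = 0})"
    by (rule sum_pencil[OF l', symmetric])
  also have "\<dots> \<le> (\<Sum>P\<in>l - {0}. d - 2)"
  proof (rule sum_mono)
    fix P assume P: "P \<in> l - {0}"
    have "{t\<in>UNIV-{0}. f (w + t *s P) = 0} = {t. f (w + t *s P) = 0} - {0}" by auto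
    then have "card {t\<in>UNIV-{0}. f (w + t *s P) = 0} = card {t. f (w + t *s P) = 0} - 1"
      using z by (simp add: card_Diff_singleton)
    moreover have "\<exists>s. f (w + s *s P) \<noteq> 0" using no P by auto
    then have "card {t. f (w + t *s P) = 0} \<le> d - 1" using roots_le clineD[OF l] P by blast
    ultimately show "card {t\<in>UNIV-{0}. f (w + t *s P) = 0} \<le> d - 2" by simp
  qed
  also have "\<dots> = (q - 1) * ((q + 1) * (d - 2))"
    by (simp only: sum_constant of_nat_id card_line_nonzero[OF l'] mult.assoc)
  finally have "card {P\<in>l - {0}. f (w + P) = 0} \<le> (q + 1) * (d - 2)" using q2 by simp
  moreover have "{P\<in>l - {0}. f (w + P) = 0} = {P\<in>l. f (w + P) = 0} - {0}" by auto
  then have "card {P\<in>l - {0}. f (w + P) = 0} = aff l w - 1"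
    using z line_simps(1)[OF l'] by (simp add: card_Diff_singleton aff_def)
  ultimately have "aff l w \<le> (q + 1) * (d - 2) + 1" by arith
  then have "(d - 1) * q \<le> (q + 1) * (d - 2) + 1" using aff_eq[OF l w] by simp
  moreover obtain e where "d = e + 2" using d2 by (metis add.commute le_Suc_ex)
  ultimately show False using dq by (simp add: algebra_simps)
qed

text \<open>Two such lines make \<open>w\<close> singular on the plane section. The line from
  \<open>w\<close> to a transversal point of \<open>l\<close> then has a double zero at
  \<open>w\<close>, so it has too few distinct zeros for \<open>transversal_count\<close>.\<close>

lemma direction_unique:
  assumes l: "cline l" and w: "w \<notin> l" and z: "f w = 0"
    and P: "P \<in> l" "\<And>t. f (w + t *s P) = 0" and Q: "Q \<in> l" "\<And>t. f (w + t *s Q) = 0"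
  shows "\<not> indep P Q"
proof
  assume i: "indep P Q"
  obtain P0 where P0: "P0 \<in> l" "B P0 w \<noteq> 0" using exists_transversal[OF l w] by blast
  have "B w P = 0" "B w Q = 0" using B_of_contained P Q clineD(2)[OF l] by auto
  moreover obtain x y where "P0 = x *s P + y *s Q"
    using P0(1) line_eq_join[OF clineD(1)[OF l] P(1) Q(1) i] by (auto simp: join_def)
  ultimately have 0: "B w P0 = 0" by (simp add: B_lin)
  have fP0: "f P0 = 0" using clineD(2)[OF l P0(1)] .
  let ?p = "linepoly F w P0"
  have "card {t. poly ?p t = 0} < d - 1"
  proof (rule roots_double)
    show "?p \<noteq> 0" using coeff_secant(2)[OF fP0, of w] P0(2) by auto
    show "coeff ?p 0 = 0" "coeff ?p 1 = 0" using z 0 by (auto simp: coeff_linepoly_0 dird_def)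
    show "coeff ?p n = 0" if "n \<ge> Suc (d - 1)" for n using coeff_secant(1)[OF fP0] that by simp
  qed
  then show False
    using transversal_count[OF l w P0 line_simps(1)[OF clineD(1)[OF l]]] by (simp add: poly_linepoly)
qed

text \<open>Each plane section through a contained line is a pencil of concurrent lines; its vertex is
  the only point of the line whose tangent plane is that plane.\<close>

lemma vertex:
  assumes l: "cline l" and w: "w \<notin> l"
  obtains P where "P \<in> l" "P \<noteq> 0" "\<And>Q. Q \<in> l \<Longrightarrow> B Q w = 0 \<longleftrightarrow> (\<exists>c. Q = c *s P)"
    "\<And>u t. u \<in> l \<Longrightarrow> f (w + u) = 0 \<Longrightarrow> f (w + u + t *s P) = 0"
proof -
  note l' = clineD(1)[OF l]
  have notin: "w + u \<notin> l" if "u \<in> l" for u using line_not_scale[OF l' w, of 1 u] that by auto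
  have "aff l w > 0" using aff_eq[OF l w] d2 q2 by simp
  then obtain u1 where u1: "u1 \<in> l" "f (w + u1) = 0" unfolding aff_def by (auto simp: card_gt_0_iff)
  obtain P where P: "P \<in> l" "P \<noteq> 0" "\<And>t. f (w + u1 + t *s P) = 0"
    using direction_exists[OF l notin[OF u1(1)] u1(2)] by blast
  have fP: "f P = 0" using clineD(2)[OF l P(1)] .
  have all: "f (w + u + t *s P) = 0" if u: "u \<in> l" "f (w + u) = 0" for u t
  proof -
    obtain P' where P': "P' \<in> l" "P' \<noteq> 0" "\<And>t. f (w + u + t *s P') = 0"
      using direction_exists[OF l notin[OF u(1)] u(2)] by blast
    have "\<not> indep P P'"
    proof
      assume i: "indep P P'"
      \<comment> \<open>The contained lines through \<open>w + u1\<close> and \<open>w + u\<close>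
        would meet in the point \<open>v\<close> below, against
        \<open>direction_unique\<close>.\<close>
      obtain x y where xy: "u - u1 = x *s P + y *s P'"
        using line_simps(4)[OF l' u(1) u1(1)] line_eq_join[OF l' P(1) P'(1) i] by (auto simp: join_def)
      define v where "v = w + (u1 + x *s P)"
      have v: "v = w + (u - y *s P')" using xy by (simp add: v_def algebra_simps)
      have "f (v + t *s P) = 0" for t
        using P(3)[of "x + t"] by (simp add: v_def vec.scale_left_distrib add.assoc)
      moreover have "f (v + t *s P') = 0" for t
        using P'(3)[of "t - y"] by (simp add: v vec.scale_left_diff_distrib algebra_simps)
      moreover have "v \<notin> l" unfolding v_def by (intro notin line_simps[OF l'] u1 P)
      moreover have "f v = 0" using P(3)[of x] by (simp add: v_def add.assoc)
      ultimately show False using direction_unique[OF l, of v P P'] P P' i by blast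
    qed
    then obtain c where c: "P' = c *s P" using P(2) by (auto simp: indep_def)
    then have "c \<noteq> 0" using P'(2) by auto
    then show ?thesis using P'(3)[of "t / c"] by (simp add: c)
  qed
  show ?thesis
  proof (rule that[OF P(1,2) _ all])
    fix Q assume Q: "Q \<in> l"
    have "B P (w + u1) = 0"
    proof (rule B_of_contained[OF u1(2)])
      show "f (P + t *s (w + u1)) = 0" for t
        using zero_on_join[OF fP P(3), of 1 t] by simp
    qed
    then have BP: "B P w = 0" using B_on_cline[OF l P(1) u1(1)] by (simp add: B_lin)
    show "B Q w = 0 \<longleftrightarrow> (\<exists>c. Q = c *s P)"
    proof
      assume "\<exists>c. Q = c *s P" then show "B Q w = 0" using BP by (auto simp: B_scale1)
    next
      assume BQ: "B Q w = 0"
      show "\<exists>c. Q = c *s P"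
      proof (rule ccontr)
        assume no: "\<not> ?thesis"
        then have i: "indep P Q" using P(2) by (auto simp: indep_def)
        \<comment> \<open>A second tangent point \<open>Q\<close> leaves at most
          \<open>d - 2\<close> zeros on each line through it, since a contained one would give a
          second direction at its points. This contradicts \<open>aff_eq\<close>.\<close>
        have le: "card {t. f (w + u + t *s Q) = 0} \<le> d - 2" if u: "u \<in> l" for u
        proof (cases "\<exists>s. f (w + u + s *s Q) \<noteq> 0")
          case True
          then show ?thesis using roots_tangent[of Q "w + u"] BQ B_on_cline[OF l Q u] clineD(2)[OF l Q]
            by (auto simp: B_lin)
        next
          case False
          then have "f (w + u + s *s Q) = 0" for s by auto
          moreover from this[of 0] have "f (w + u) = 0" by simp
          ultimately show ?thesis
            using direction_unique[OF l notin[OF u], of P Q] all[OF u] P(1) Q i by blast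
        qed
        have "q * aff l w = (\<Sum>u\<in>l. card {t. f (w + u + t *s Q) = 0})" using sum_affine[OF l' Q] by simp
        also have "\<dots> \<le> (\<Sum>u\<in>l. d - 2)" by (intro sum_mono le)
        also have "\<dots> = q * ((d - 2) * q)" using line_card[OF l'] by (simp add: power2_eq_square q_def)
        finally have "(d - 1) * q \<le> (d - 2) * q" using aff_eq[OF l w] q2 by simp
        then show False using q2 d2 by simp
      qed
    qed
  qed
qed

section \<open>Tangent planes and polarity\<close>

lemma on_cline:
  assumes "f x = 0" "x \<noteq> 0"
  obtains l where "cline l" "x \<in> l"
proof -
  obtain l where l: "cline l" using exists_cline by blast
  show ?thesis
  proof (cases "x \<in> l")
    case False
    obtain P where P: "P \<in> l" "P \<noteq> 0" "\<And>t. f (x + t *s P) = 0"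
      using direction_exists[OF l False assms(1)] by blast
    have "x \<noteq> c *s P" for c using False P line_simps(3)[OF clineD(1)[OF l]] by auto
    then have "indep P x" using P(2) by (auto simp: indep_def)
    then have "cline (join P x)" using cline_join[of P x] P clineD(2)[OF l] by blast
    then show ?thesis using that join_mem by blast
  qed (use l that in blast)
qed

lemma indep_common_scale: "P = a *s R \<Longrightarrow> Q = b *s R \<Longrightarrow> \<not> indep P Q"
proof
  assume P: "P = a *s R" and Q: "Q = b *s R" and i: "indep P Q"
  then have "a \<noteq> 0" by (auto simp: indep_def)
  then have "Q = (b / a) *s P" by (simp add: P Q)
  then show False using i by (auto simp: indep_def)
qed

text \<open>A plane tangent at another point \<open>Q\<close> of a contained line through
  \<open>P\<close> would also be tangent at \<open>P\<close>, but by \<open>vertex\<close> it is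
  tangent at only one point of that line.\<close>

lemma nonsingular:
  assumes "f P = 0" "P \<noteq> 0"
  shows "\<exists>w. B P w \<noteq> 0"
proof (rule ccontr)
  assume no: "\<not> ?thesis"
  obtain l where l: "cline l" "P \<in> l" using on_cline assms by blast
  obtain Q where Q: "Q \<in> l" "indep P Q" using line_other_point[OF clineD(1)[OF l(1)] assms(2)] .
  obtain w where w: "w \<notin> l" "B Q w = 0" using kernel_outside_line[OF clineD(1)[OF l(1)]] .
  obtain R where "\<And>Q. Q \<in> l \<Longrightarrow> B Q w = 0 \<longleftrightarrow> (\<exists>c. Q = c *s R)" using vertex[OF l(1) w(1)] by metis
  then show False using no w(2) Q l(2) indep_common_scale by metis
qed

text \<open>Tangency makes \<open>x\<close> the vertex of the section by the plane through
  \<open>y\<close> and a contained line through \<open>x\<close>, and the lines from a vertex to the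
  other zeros are contained.\<close>

lemma contained_of_tangent:
  assumes x: "f x = 0" and y: "f y = 0" and B: "B x y = 0"
  shows "f (a *s x + b *s y) = 0"
proof (cases "x = 0")
  case False
  obtain l where l: "cline l" "x \<in> l" using on_cline x False by blast
  note l' = clineD(1)[OF l(1)]
  show ?thesis
  proof (cases "y \<in> l")
    case True
    then show ?thesis using l line_simps[OF l'] clineD(2)[OF l(1)] by auto
  next
    case yl: False
    obtain P where P: "B x y = 0 \<longleftrightarrow> (\<exists>c. x = c *s P)" "\<And>t. f (y + t *s P) = 0"
      using vertex[OF l(1) yl] l(2) y line_simps(1)[OF l'] by (metis add.right_neutral)
    then obtain c where c: "x = c *s P" using B by blast
    show ?thesis by (rule zero_on_join[OF x]) (simp add: c P)
  qed
qed (simp add: f_scale y)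

lemma B_sym0:
  assumes "f x = 0" "f y = 0" "B x y = 0"
  shows "B y x = 0"
  using contained_of_tangent[OF assms, of _ 1] B_of_contained[OF assms(1), of y] by (simp add: add.commute)

lemma B_sym: "f x = 0 \<Longrightarrow> f y = 0 \<Longrightarrow> B x y = 0 \<longleftrightarrow> B y x = 0"
  using B_sym0 by blast

lemma secant_count:
  assumes "f P = 0" "B P w \<noteq> 0"
  shows "card {t. f (w + t *s P) = 0} = d - 1"
proof -
  have "P \<noteq> 0" using assms(2) by auto
  then obtain l where l: "cline l" "P \<in> l" using on_cline assms by blast
  have "w \<notin> l" using B_on_cline[OF l] assms(2) by auto
  then show ?thesis
    using transversal_count[OF l(1) _ l(2) assms(2) line_simps(1)[OF clineD(1)[OF l(1)]]] by simp
qed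

text \<open>The polar \<open>B _ a\<close> has degree \<open>d - 1\<close> and vanishes on the \<open>d\<close> lines of the tangent plane at \<open>a\<close>.\<close>

lemma polar_vanishes:
  assumes a: "f a = 0" and z: "B a z = 0"
  shows "B z a = 0"
proof (cases "a = 0")
  case False
  obtain l where l: "cline l" "a \<in> l" using on_cline a False by blast
  note l' = clineD(1)[OF l(1)]
  show ?thesis
  proof (cases "z \<in> l")
    case True
    then show ?thesis using B_on_cline[OF l(1)] l(2) by blast
  next
    case zl: False
    obtain Q where Q: "Q \<in> l" "indep a Q" using line_other_point[OF l' False] .
    obtain R where R: "\<And>Q. Q \<in> l \<Longrightarrow> B Q z = 0 \<longleftrightarrow> (\<exists>c. Q = c *s R)" using vertex[OF l(1) zl] by metis
    have BQ: "B Q z \<noteq> 0" using R[OF Q(1)] R[OF l(2)] z indep_common_scale Q(2) by metis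
    have fQ: "f Q = 0" using clineD(2)[OF l(1) Q(1)] .
    \<comment> \<open>The degree is at most \<open>d - 2\<close>, as the coefficient of t^(d-1) is
      \<open>B Q a = 0\<close>; yet the \<open>d - 1\<close> zeros on the secant
      \<open>z + t *s Q\<close> are roots.\<close>
    let ?p = "linepoly (dirpoly F a) z Q"
    note h = homogeneous_dirpoly[OF hom, of a]
    have "?p = 0"
    proof (rule ccontr)
      assume "?p \<noteq> 0"
      moreover have "coeff ?p n = 0" if "n \<ge> d - 1" for n
        using that coeff_linepoly_above[OF h, of n] coeff_linepoly_top[OF h, of z Q] B_on_cline[OF l(1) Q(1) l(2)]
        by (cases "n = d - 1") (auto simp: eval4_dirpoly)
      ultimately have "card {t. poly ?p t = 0} < d - 1" by (rule roots_card_less)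
      moreover have "card {t. f (z + t *s Q) = 0} \<le> card {t. poly ?p t = 0}"
      proof (intro card_mono subsetI CollectI)
        fix t assume "t \<in> {t. f (z + t *s Q) = 0}"
        moreover have "B a (z + t *s Q) = 0" using z B_on_cline[OF l(1) l(2) Q(1)] by (simp add: B_lin)
        ultimately show "poly ?p t = 0" using B_sym0[OF a] by (simp add: poly_linepoly eval4_dirpoly)
      qed simp
      ultimately show False using secant_count[OF fQ BQ] by simp
    qed
    then show ?thesis using coeff_linepoly_0[of "dirpoly F a" z Q] by (simp add: eval4_dirpoly)
  qed
qed simp

text \<open>Two mutually orthogonal hyperbolic pairs. The lines joining \<open>a\<close> and
  \<open>b\<close> to \<open>a'\<close> and \<open>b'\<close> are contained and are the sides of the
  skew quadrilateral; the pairs span its diagonals.\<close>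

definition frame :: "'k ^ 4 \<Rightarrow> 'k ^ 4 \<Rightarrow> 'k ^ 4 \<Rightarrow> 'k ^ 4 \<Rightarrow> bool" where
  "frame a b a' b' \<longleftrightarrow> f a = 0 \<and> f b = 0 \<and> f a' = 0 \<and> f b' = 0 \<and> B a b \<noteq> 0 \<and> B a' b' \<noteq> 0 \<and>
     B a a' = 0 \<and> B a b' = 0 \<and> B b a' = 0 \<and> B b b' = 0"

lemma frameD:
  assumes "frame a b a' b'"
  shows "f a = 0" "f b = 0" "f a' = 0" "f b' = 0" "B a b \<noteq> 0" "B b a \<noteq> 0" "B a' b' \<noteq> 0" "B b' a' \<noteq> 0"
    "B a a' = 0" "B a b' = 0" "B b a' = 0" "B b b' = 0" "B a' a = 0" "B b' a = 0" "B a' b = 0" "B b' b = 0"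
    "B a a = 0" "B b b = 0" "B a' a' = 0" "B b' b' = 0"
  using assms B_sym[of a b] B_sym[of a' b'] B_sym[of a a'] B_sym[of a b'] B_sym[of b a'] B_sym[of b b']
  unfolding frame_def by (auto simp: B_self)

lemma frame_swap: "frame a b a' b' \<Longrightarrow> frame a' b' a b"
  unfolding frame_def[of a'] by (intro conjI; erule frameD)

text \<open>\<open>a\<close> is the common point of two contained lines \<open>l\<close> and
  \<open>m\<close>, \<open>b\<close> is a surface point outside the tangent plane at
  \<open>a\<close>, and \<open>a'\<close>, \<open>b'\<close> are the points of \<open>l\<close> and
  \<open>m\<close> whose tangent planes contain \<open>b\<close>.\<close>

lemma exists_frame: "\<exists>a b a' b'. frame a b a' b'"
proof -
  obtain l where l: "cline l" using exists_cline by blast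
  note l' = clineD(1)[OF l]
  obtain w where w: "w \<notin> l" using kernel_outside_line[OF l'] .
  obtain a where a: "a \<in> l" "B a w \<noteq> 0" using exists_transversal[OF l w] by blast
  have fa: "f a = 0" "a \<noteq> 0" using clineD(2)[OF l a(1)] a(2) by auto
  have "card {t. f (w + t *s a) = 0} > 0" using secant_count[OF fa(1) a(2)] d2 by simp
  then obtain t where t: "f (w + t *s a) = 0" by (auto simp: card_gt_0_iff)
  define b where "b = w + t *s a"
  have b: "f b = 0" "B a b \<noteq> 0" using t a B_self[OF fa(1)] by (auto simp: b_def B_lin)
  have bl: "b \<notin> l" using B_on_cline[OF l a(1)] b(2) by auto
  have pick: "\<exists>a'\<in>m. a' \<noteq> 0 \<and> B a' b = 0" if m: "cline m" and bm: "b \<notin> m" for m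
  proof -
    obtain P where "P \<in> m" "P \<noteq> 0" "\<And>Q. Q \<in> m \<Longrightarrow> B Q b = 0 \<longleftrightarrow> (\<exists>c. Q = c *s P)"
      using vertex[OF m bm] by metis
    then show ?thesis by (metis vec.scale_one)
  qed
  obtain a' where a': "a' \<in> l" "a' \<noteq> 0" "B a' b = 0" using pick[OF l bl] by blast
  have fa': "f a' = 0" using clineD(2)[OF l a'(1)] .
  have ind: "indep a a'"
    unfolding indep_def
  proof safe
    fix c assume c: "a' = c *s a"
    then have "c \<noteq> 0" using a'(2) by auto
    then show False using a'(3) b(2) c by (simp add: B_scale1)
  qed (use fa in simp)
  \<comment> \<open>The second line \<open>m\<close> through \<open>a\<close> is found in the plane
    through \<open>l\<close> that is tangent at \<open>a\<close>.\<close>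
  obtain w' where w': "w' \<notin> l" "B a w' = 0" using kernel_outside_line[OF l'] .
  obtain P where P: "P \<in> l" "P \<noteq> 0" "\<And>Q. Q \<in> l \<Longrightarrow> B Q w' = 0 \<longleftrightarrow> (\<exists>c. Q = c *s P)"
    "\<And>u t. u \<in> l \<Longrightarrow> f (w' + u) = 0 \<Longrightarrow> f (w' + u + t *s P) = 0"
    using vertex[OF l w'(1)] by metis
  have "aff l w' > 0" using aff_eq[OF l w'(1)] d2 q2 by simp
  then obtain u where u: "u \<in> l" "f (w' + u) = 0" unfolding aff_def by (auto simp: card_gt_0_iff)
  define v where "v = w' + u"
  have v: "f v = 0" "B a v = 0" using u w'(2) B_on_cline[OF l a(1) u(1)] by (auto simp: v_def B_lin)
  have vl: "v \<notin> l" using line_not_scale[OF l' w'(1), of 1 u] u(1) by (auto simp: v_def)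
  have iv: "indep a v" unfolding indep_def using fa vl line_simps(3)[OF l' a(1)] by auto
  define m where "m = join a v"
  have m: "cline m" unfolding m_def
    by (rule cline_join[OF fa(1) _ iv]) (use contained_of_tangent[OF fa(1) v(1) v(2), of _ 1] in \<open>simp add: add.commute\<close>)
  have am: "a \<in> m" by (simp add: m_def join_mem)
  have bm: "b \<notin> m" using B_on_cline[OF m am] b(2) by auto
  obtain b' where b': "b' \<in> m" "b' \<noteq> 0" "B b' b = 0" using pick[OF m bm] by blast
  have fb': "f b' = 0" using clineD(2)[OF m b'(1)] .
  have "a' \<notin> m"
  proof
    assume "a' \<in> m"
    then have "m = join a a'" using line_eq_join[OF clineD(1)[OF m] am _ ind] by blast
    also have "\<dots> = l" using line_eq_join[OF l' a(1) a'(1) ind] by simp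
    finally show False using vl join_mem[of v a] by (simp add: m_def join_mem)
  qed
  moreover have inb: "indep a b'"
    unfolding indep_def
  proof safe
    fix c assume c: "b' = c *s a"
    then have "c \<noteq> 0" using b'(2) by auto
    then show False using b'(3) b(2) c by (simp add: B_scale1)
  qed (use fa in simp)
  \<comment> \<open>In the plane of \<open>m\<close> and \<open>a'\<close> the vertex on
    \<open>m\<close> is \<open>a\<close>, so the plane is not tangent at \<open>b'\<close>.\<close>
  ultimately have nb: "B b' a' \<noteq> 0"
  proof -
    assume "a' \<notin> m"
    then obtain R where R: "\<And>Q. Q \<in> m \<Longrightarrow> B Q a' = 0 \<longleftrightarrow> (\<exists>c. Q = c *s R)" using vertex[OF m] by metis
    have "B a a' = 0" using B_on_cline[OF l a(1) a'(1)] .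
    then show ?thesis using R[OF am] R[OF b'(1)] indep_common_scale inb by metis
  qed
  have "B a' b' \<noteq> 0" using B_sym0[OF fa' fb'] nb by blast
  moreover have "B b a' = 0" "B b b' = 0" using B_sym0[OF fa' b(1) a'(3)] B_sym0[OF fb' b(1) b'(3)] by auto
  ultimately have "frame a b a' b'"
    unfolding frame_def
    by (intro conjI fa(1) b fa' fb' B_on_cline[OF l a(1) a'(1)] B_on_cline[OF m am b'(1)]) auto
  then show ?thesis by blast
qed

end

section \<open>Finite fields\<close>

text \<open>If every polar \<open>B _ u\<close> of a binary form is a multiple of the \<open>s\<close>-th power of the tangent form
  \<open>B u _\<close>, then the \<open>s\<close>-th power map is an additive involution.\<close>

lemma power_map_of_polar_identity:
  fixes c c' \<mu> x y :: "'k::field"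
  assumes c: "c \<noteq> 0" "c' \<noteq> 0" and s: "s \<ge> 1"
    and id: "\<And>\<mu>. \<exists>k. \<forall>x y. c * y ^ s + \<mu> * c' * x ^ s = k * (x * c * \<mu> ^ s + y * c') ^ s"
  shows "c ^ Suc s = c' ^ Suc s" "(\<mu> ^ s) ^ s = \<mu>" "(x + y) ^ s = x ^ s + y ^ s"
proof -
  have z: "(0::'k) ^ s = 0" using s by (simp add: zero_power)
  obtain k where k: "\<And>x y. c * y ^ s + c' * x ^ s = k * (x * c + y * c') ^ s"
    using id[of 1] by auto
  have k1: "c = k * c' ^ s" using k[of 1 0] z by simp
  have k2: "c' = k * c ^ s" using k[of 0 1] z by simp
  have k0: "k \<noteq> 0" using k1 c by auto
  have "k * c ^ Suc s = c * (k * c ^ s)" by (simp add: mult_ac)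
  also have "\<dots> = c' * (k * c' ^ s)" unfolding k1[symmetric] k2[symmetric] by (rule mult.commute)
  also have "\<dots> = k * c' ^ Suc s" by (simp add: mult_ac)
  finally have "k * c ^ Suc s = k * c' ^ Suc s" .
  then show "c ^ Suc s = c' ^ Suc s" using k0 by simp
  obtain k' where k': "\<And>x y. c * y ^ s + \<mu> * c' * x ^ s = k' * (x * c * \<mu> ^ s + y * c') ^ s"
    using id[of \<mu>] by auto
  \<comment> \<open>Comparison at \<open>x = 0\<close> shows that the factor does not depend on
    \<open>\<mu>\<close>.\<close>
  have "c = k' * c' ^ s" using k'[of 1 0] z by simp
  then have "k' * c' ^ s = k * c' ^ s" unfolding k1[symmetric] by (rule sym)
  then have "k' = k" using c by simp
  then have "\<mu> * c' = k * c ^ s * (\<mu> ^ s) ^ s" using k'[of 0 1] z by (simp add: power_mult_distrib)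
  then have "(\<mu> ^ s) ^ s * c' = \<mu> * c'" unfolding k2[symmetric] by (simp only: mult.commute)
  then show "(\<mu> ^ s) ^ s = \<mu>" using c by simp
  \<comment> \<open>Additivity is the case \<open>\<mu> = 1\<close>, rescaled so that the two linear
    terms become \<open>x\<close> and \<open>y\<close>.\<close>
  have "k * (x + y) ^ s = c * (y / c') ^ s + c' * (x / c) ^ s" using k[of "y / c'" "x / c"] c by simp
  also have "c * (y / c') ^ s = k * y ^ s"
  proof -
    have "c * (y / c') ^ s = (k * c' ^ s) * (y / c') ^ s" by (simp only: k1[symmetric])
    then show ?thesis using c by (simp add: power_divide)
  qed
  also have "c' * (x / c) ^ s = k * x ^ s"
  proof -
    have "c' * (x / c) ^ s = (k * c ^ s) * (x / c) ^ s" by (simp only: k2[symmetric])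
    then show ?thesis using c by (simp add: power_divide)
  qed
  finally show "(x + y) ^ s = x ^ s + y ^ s" using k0 by (simp add: add.commute flip: distrib_left)
qed

text \<open>The field is two-dimensional over the fixed set of the involution, with basis 1,
  \<theta> for any \<theta> that is not fixed.\<close>

lemma card_of_involution:
  fixes s :: nat
  assumes add: "\<And>x y::'k::{field,finite}. (x + y) ^ s = x ^ s + y ^ s"
    and inv: "\<And>x::'k. (x ^ s) ^ s = x" and nt: "\<exists>x::'k. x ^ s \<noteq> x"
  shows "CARD('k) = card {x::'k. x ^ s = x} ^ 2"
proof -
  let ?K = "{x::'k. x ^ s = x}"
  have diff: "(x - y) ^ s = x ^ s - y ^ s" for x y :: 'k using add[of "x - y" y] by simp
  obtain \<theta> :: 'k where \<theta>: "\<theta> ^ s \<noteq> \<theta>" using nt by blast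
  have "inj_on (\<lambda>(x, y). x + y * \<theta>) (?K \<times> ?K)"
  proof (rule inj_onI, clarify)
    fix x y x' y' assume K: "x ^ s = x" "y ^ s = y" "x' ^ s = x'" "y' ^ s = y'" and e: "x + y * \<theta> = x' + y' * \<theta>"
    have "(x + y * \<theta>) ^ s = (x' + y' * \<theta>) ^ s" using e by simp
    then have "x + y * \<theta> ^ s = x' + y' * \<theta> ^ s" by (simp add: add power_mult_distrib K)
    then have "y * \<theta> ^ s - y' * \<theta> ^ s = x' - x" by (simp add: algebra_simps)
    moreover have "y * \<theta> - y' * \<theta> = x' - x" using e by (simp add: algebra_simps)
    moreover have "(y - y') * (\<theta> ^ s - \<theta>) = (y * \<theta> ^ s - y' * \<theta> ^ s) - (y * \<theta> - y' * \<theta>)"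
      by (simp add: algebra_simps)
    ultimately have "(y - y') * (\<theta> ^ s - \<theta>) = 0" by simp
    then show "x = x' \<and> y = y'" using \<theta> e by simp
  qed
  moreover have "(\<lambda>(x, y). x + y * \<theta>) ` (?K \<times> ?K) = UNIV"
  proof (intro equalityI subset_UNIV subsetI)
    fix x :: 'k
    \<comment> \<open>If x = u + y \<theta> with \<open>u\<close> and \<open>y\<close> fixed,
      subtracting the conjugate equation leaves this value of \<open>y\<close>.\<close>
    define y where "y = (x - x ^ s) / (\<theta> - \<theta> ^ s)"
    have "y ^ s = (x ^ s - x) / (\<theta> ^ s - \<theta>)" by (simp add: y_def power_divide diff inv)
    also have "\<dots> = y" unfolding y_def by (metis minus_diff_eq minus_divide_divide)
    finally have y: "y ^ s = y" .
    have "y * (\<theta> - \<theta> ^ s) = x - x ^ s" using \<theta> by (simp add: y_def)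
    then have "(x - y * \<theta>) ^ s = x - y * \<theta>" by (simp add: diff power_mult_distrib y algebra_simps)
    then show "x \<in> (\<lambda>(x, y). x + y * \<theta>) ` (?K \<times> ?K)"
      using y by (intro image_eqI[of _ _ "(x - y * \<theta>, y)"]) auto
  qed
  ultimately have "CARD('k) = card (?K \<times> ?K)" using card_image by fastforce
  then show ?thesis by (simp add: card_cartesian_product power2_eq_square)
qed

text \<open>In characteristic 2 every element is a square; otherwise 2 r = (r + 1)^2 - r^2 -
  1.\<close>

lemma squares_generate:
  fixes T :: "'k::{field,finite} set"
  assumes "\<And>r. r ^ 2 \<in> T" "\<And>u v. u \<in> T \<Longrightarrow> v \<in> T \<Longrightarrow> u + v \<in> T" "\<And>u. u \<in> T \<Longrightarrow> - u \<in> T"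
  shows "T = UNIV"
proof (cases "(2::'k) = 0")
  case True
  have "inj (\<lambda>r::'k. r ^ 2)"
  proof (rule injI)
    fix r s :: 'k assume e: "r ^ 2 = s ^ 2"
    have "(r - s) ^ 2 = r ^ 2 + s ^ 2 - 2 * r * s" by (rule power2_diff)
    also have "\<dots> = 2 * s ^ 2" using e True by simp
    finally show "r = s" using True by simp
  qed
  then have "surj (\<lambda>r::'k. r ^ 2)" by (simp add: finite_UNIV_inj_surj)
  then have "range (\<lambda>r::'k. r ^ 2) = UNIV" .
  moreover have "range (\<lambda>r::'k. r ^ 2) \<subseteq> T" using assms(1) by auto
  ultimately show ?thesis by auto
next
  case False
  have "x \<in> T" for x
  proof -
    define r where "r = x / 2"
    have "(r + 1) ^ 2 + - (r ^ 2 + 1 ^ 2) \<in> T" by (intro assms)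
    moreover have "(r + 1) ^ 2 + - (r ^ 2 + 1 ^ 2) = 2 * r" by (simp add: power2_sum)
    ultimately show ?thesis using False by (simp add: r_def)
  qed
  then show ?thesis by auto
qed

section \<open>Hyperbolic frames\<close>

context extremal_surface
begin

lemma join_combo: "m \<in> join a b \<Longrightarrow> \<exists>x y. m = x *s a + y *s b"
  by (auto simp: join_def)

lemma join_closed:
  "u \<in> join a b \<Longrightarrow> v \<in> join a b \<Longrightarrow> u + v \<in> join a b" "u \<in> join a b \<Longrightarrow> c *s u \<in> join a b"
  by (auto simp: vec.subspace_add vec.subspace_scale subspace_join)

lemma frame_coeffs:
  assumes fr: "frame a b a' b'" and z: "x *s a + y *s b + x' *s a' + y' *s b' = 0"
  shows "x = 0" "y = 0" "x' = 0" "y' = 0"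
proof -
  note fD = frameD[OF fr]
  have "B v (x *s a + y *s b + x' *s a' + y' *s b') = 0" for v by (simp only: z dird_zero)
  from this[of a] this[of b] this[of a'] this[of b'] show "x = 0" "y = 0" "x' = 0" "y' = 0"
    by (simp_all add: B_lin fD)
qed

text \<open>\<open>B\<close> is linear only in its second argument, so the relation is first shown
  at \<open>a'\<close> and \<open>b'\<close> and then turned around, which is possible because
  \<open>m\<close> is a zero.\<close>

lemma B_frame_orth:
  assumes fr: "frame a b a' b'" and m: "m \<in> join a b" "f m = 0" and v: "v \<in> join a' b'"
  shows "B m v = 0"
proof -
  note fD = frameD[OF fr]
  have "B a' m = 0" "B b' m = 0" using join_combo[OF m(1)] by (auto simp: B_lin fD)
  then have "B m a' = 0" "B m b' = 0" using B_sym[OF m(2)] fD by auto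
  then show ?thesis using join_combo[OF v] by (auto simp: B_lin)
qed

lemma quadric_on_frame:
  assumes d: "d = 2" and fr: "frame a b a' b'"
  shows "f (x *s a + y *s b + x' *s a' + y' *s b') = x * y * B a b + x' * y' * B a' b'"
proof -
  note fD = frameD[OF fr]
  have add: "f (v + w) = f v + B v w + f w" for v w
  proof -
    have "linepoly F v w = [:f v, B v w, f w:]"
    proof (rule poly_eqI)
      fix n
      show "coeff (linepoly F v w) n = coeff [:f v, B v w, f w:] n"
        using coeff_linepoly_0[of F v w] coeff_linepoly_top[OF hom, of v w] coeff_linepoly_above[OF hom, of n v w]
        by (cases n rule: nat.exhaust; auto simp: d dird_def coeff_pCons numeral_2_eq_2 split: nat.splits)
    qed
    then show ?thesis using poly_linepoly[of F v w 1] by (simp add: add.assoc)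
  qed
  have sym: "B v w = B w v" for v w using add[of v w] add[of w v] by (simp add: add.commute)
  have bin: "f (x *s p + y *s r) = x * y * B p r" if "f p = 0" "f r = 0" for x y p r
    using that by (simp add: add B_lin B_scale1 d f_scale)
  have "B (x *s a + y *s b) (x' *s a' + y' *s b') = 0"
    by (simp add: B_lin sym[of "x *s a + y *s b"] fD)
  then show ?thesis
    using add[of "x *s a + y *s b" "x' *s a' + y' *s b'"] by (simp add: bin fD add.assoc)
qed

text \<open>The polar \<open>B _ c\<close> vanishes on the tangent plane at \<open>c\<close>, hence
  on the line from \<open>v\<close> in direction \<open>z\<close>. Its degree is below q, so the
  restriction and its linear coefficient vanish.\<close>

lemma second_polar_vanishes:
  assumes c: "f c = 0" and v: "B c v = 0" and z: "B c z = 0"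
  shows "dird (dirpoly F c) v z = 0"
proof -
  let ?p = "linepoly (dirpoly F c) v z"
  have "?p = 0"
  proof (rule ccontr)
    assume "?p \<noteq> 0"
    then have "card {t. poly ?p t = 0} < d"
      by (rule roots_card_less) (use coeff_linepoly_above[OF homogeneous_dirpoly[OF hom]] d2 in auto)
    moreover have "poly ?p t = 0" for t
      using polar_vanishes[OF c, of "v + t *s z"] v z by (simp add: poly_linepoly eval4_dirpoly B_lin)
    ultimately show False using dq by (simp add: q_def)
  qed
  then show ?thesis by (simp add: dird_def)
qed

text \<open>If \<open>d - 1\<close> is nonzero in the field, the tangent planes along a contained line depend linearly
  on the point. This confines the affine part of the surface to the quadrics
  \<open>x = \<kappa> x' y' + \<epsilon>\<close> with \<open>\<epsilon> \<in> E\<close>, where \<open>E\<close> has \<open>d - 1\<close> elements; a third line through \<open>a\<close> then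
  shows that \<open>E\<close> is stable under translation by all multiples of squares.\<close>

lemma pred_degree_zero:
  assumes d3: "d \<ge> 3"
  shows "of_nat (d - 1) = (0::'k)"
proof (rule ccontr)
  assume s0: "of_nat (d - 1) \<noteq> (0::'k)"
  obtain a b a' b' where fr: "frame a b a' b'" using exists_frame by blast
  note fD = frameD[OF fr]
  define h where "h z = dird (dirpoly F a') a z" for z
  have hb: "h b = 0" unfolding h_def by (rule second_polar_vanishes) (simp_all add: fD)
  define \<kappa> where "\<kappa> = - h b' / (of_nat (d - 1) * B a b)"
  have fc: "f (a + l *s a') = 0" for l
    using contained_of_tangent[OF fD(1,3,9), of 1 l] by simp
  have Bca: "B (a + l *s a') a = 0" for l
  proof (rule B_of_contained[OF fD(1)])
    show "f (a + l *s a' + t *s a) = 0" for t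
      using contained_of_tangent[OF fD(1,3,9), of "1 + t" l] by (simp add: vec.scale_left_distrib add_ac)
  qed
  \<comment> \<open>The second polar at \<open>a + l *s a'\<close> splits: the part from
    \<open>a\<close> is \<open>d - 1\<close> times \<open>B a\<close> by Euler's relation, the part
    from \<open>a'\<close> is \<open>l\<close> times \<open>h\<close>. This is the linear dependence
    on \<open>l\<close>.\<close>
  have rel: "of_nat (d - 1) * y * B a b + l * y' * h b' = 0"
    if "B (a + l *s a') (y *s b + y' *s b') = 0" for l y y'
  proof -
    have "dird (dirpoly F (a + l *s a')) a (y *s b + y' *s b') = 0"
      by (rule second_polar_vanishes[OF fc Bca that])
    then show ?thesis
      by (simp add: dird_dirpoly_add dird_dirpoly_scale dird_dirpoly_self[OF hom] B_lin fD hb flip: h_def)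
         (simp add: h_def B_lin fD hb[unfolded h_def] mult_ac)
  qed
  have tang: "B (a + l *s a') ((\<kappa> * l) *s b + b') = 0" for l
  proof -
    let ?c = "a + l *s a'"
    have nz: "B ?c b \<noteq> 0" using rel[of l 1 0] s0 fD by auto
    \<comment> \<open>The coefficients \<open>B ?c b'\<close> and \<open>- B ?c b\<close> of
      \<open>b\<close> and \<open>b'\<close> give a vector in the kernel of
      \<open>B ?c\<close>.\<close>
    have "of_nat (d - 1) * B ?c b' * B a b + l * (- B ?c b) * h b' = 0"
      by (rule rel) (simp add: B_lin)
    then have "B ?c b' = - \<kappa> * l * B ?c b" using s0 fD by (simp add: \<kappa>_def field_simps)
    then show ?thesis by (simp add: B_lin)
  qed
  have \<kappa>0: "\<kappa> \<noteq> 0"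
  proof
    assume "\<kappa> = 0"
    then have "B (a + 1 *s a') b' = 0" using tang[of 1] by simp
    then have "B b' (a + 1 *s a') = 0" using B_sym[OF fc fD(4)] by metis
    then show False by (simp add: B_lin fD)
  qed
  define E where "E = {e. f (b + e *s a) = 0}"
  have cE: "card E = d - 1" unfolding E_def by (rule secant_count) (simp_all add: fD)
  have orth: "B (b + e *s a) a' = 0" "B (b + e *s a) b' = 0" if "e \<in> E" for e
  proof -
    have "b + e *s a \<in> join a b" using joinI[of e a 1 b] by (simp add: add.commute)
    moreover have "f (b + e *s a) = 0" using that by (simp add: E_def)
    ultimately have o: "B (b + e *s a) v = 0" if "v \<in> join a' b'" for v
      using B_frame_orth[OF fr] that by blast
    show "B (b + e *s a) a' = 0" "B (b + e *s a) b' = 0" by (rule o[OF join_mem(1)], rule o[OF join_mem(2)])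
  qed
  have pt: "f (b + x *s a' + y *s b' + (\<kappa> * x * y + e) *s a) = 0"
    if e: "e \<in> E" and xy: "x \<noteq> 0" "y \<noteq> 0" for x y e
  proof -
    let ?c = "b + e *s a"
    \<comment> \<open>This \<open>l\<close> makes the coefficient of \<open>b\<close> equal to 1 in
      the point taken on the contained line joining \<open>a + l *s a'\<close> to
      \<open>?g\<close>.\<close>
    define l where "l = 1 / (\<kappa> * y)"
    have l: "\<kappa> * l * y = 1" using \<kappa>0 xy by (simp add: l_def)
    have fcc: "f ?c = 0" using e by (simp add: E_def)
    let ?g = "(\<kappa> * l) *s ?c + b'"
    have fg: "f ?g = 0" using contained_of_tangent[OF fcc fD(4) orth(2)[OF e], of "\<kappa> * l" 1] by simp
    have "?g = ((\<kappa> * l) *s b + b') + (\<kappa> * l * e) *s a" by (simp add: vec_eq_iff algebra_simps)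
    then have "B (a + l *s a') ?g = 0" using tang Bca by (simp add: B_lin)
    then have "f ((\<kappa> * x * y) *s (a + l *s a') + y *s ?g) = 0" by (rule contained_of_tangent[OF fc fg])
    also have "(\<kappa> * x * y) *s (a + l *s a') + y *s ?g
        = (\<kappa> * l * y) *s b + (x * (\<kappa> * l * y)) *s a' + y *s b' + (\<kappa> * x * y + (\<kappa> * l * y) * e) *s a"
      by (simp add: vec_eq_iff algebra_simps)
    finally show ?thesis by (simp add: l)
  qed
  \<comment> \<open>By \<open>pt\<close> the shifted copy of \<open>E\<close> consists of zeros, and
    it already has the \<open>d - 1\<close> elements that the secant allows.\<close>
  have inE: "t - \<kappa> * x * y \<in> E"
    if xy: "x \<noteq> 0" "y \<noteq> 0" and t: "f (b + x *s a' + y *s b' + t *s a) = 0" for x y t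
  proof -
    let ?w = "b + x *s a' + y *s b'"
    have "(\<lambda>e. \<kappa> * x * y + e) ` E \<subseteq> {t. f (?w + t *s a) = 0}" using pt[OF _ xy] by auto
    moreover have "card {t. f (?w + t *s a) = 0} = card ((\<lambda>e. \<kappa> * x * y + e) ` E)"
      by (subst secant_count) (auto simp: fD B_lin cE card_image)
    ultimately have "(\<lambda>e. \<kappa> * x * y + e) ` E = {t. f (?w + t *s a) = 0}"
      by (intro card_subset_eq) auto
    then show ?thesis using t by force
  qed
  \<comment> \<open>Here \<open>d \<ge> 3\<close> enters: the secant has a zero besides
    \<open>t = 0\<close>.\<close>
  have "card {t. f (a' + t *s b') = 0} = d - 1" by (rule secant_count) (simp_all add: fD)
  then have "\<not> {t. f (a' + t *s b') = 0} \<subseteq> {0}" using card_mono[of "{0}" "{t. f (a' + t *s b') = 0}"] d3 by auto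
  then obtain \<nu> where \<nu>: "f (a' + \<nu> *s b') = 0" "\<nu> \<noteq> 0" by auto
  have stable: "e - \<kappa> * \<nu> * r ^ 2 \<in> E" if e: "e \<in> E" for e r
  proof (cases "r = 0")
    case False
    have "f (b + e *s a) = 0" "B (b + e *s a) (a' + \<nu> *s b') = 0" using e orth[OF e] by (auto simp: E_def B_lin)
    from contained_of_tangent[OF this(1) \<nu>(1) this(2), of 1 r]
    have "f (b + r *s a' + (r * \<nu>) *s b' + e *s a) = 0" by (simp add: vec.scale_right_distrib add_ac)
    from inE[OF False _ this] show ?thesis using False \<nu> by (simp add: power2_eq_square mult_ac)
  qed (use e in simp)
  \<comment> \<open>\<open>T\<close> describes the translations preserving \<open>E\<close>. It is
    closed under addition and negation and contains the squares, so it is everything; then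
    \<open>E\<close> is the whole field, which has more than \<open>d - 1\<close> elements.\<close>
  define T where "T = {u. \<forall>e\<in>E. e - \<kappa> * \<nu> * u \<in> E}"
  have "T = UNIV"
  proof (rule squares_generate)
    show "r ^ 2 \<in> T" for r using stable by (simp add: T_def)
    show "u + v \<in> T" if "u \<in> T" "v \<in> T" for u v
      unfolding T_def
    proof safe
      fix e assume "e \<in> E"
      then have "e - \<kappa> * \<nu> * u - \<kappa> * \<nu> * v \<in> E" using that by (auto simp: T_def)
      then show "e - \<kappa> * \<nu> * (u + v) \<in> E" by (simp add: algebra_simps)
    qed
    show "- u \<in> T" if "u \<in> T" for u
    proof -
      have im: "(\<lambda>e. e - \<kappa> * \<nu> * u) ` E = E"
        by (intro endo_inj_surj) (use that in \<open>auto simp: T_def inj_on_def\<close>)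
      have "e - \<kappa> * \<nu> * (- u) \<in> E" if "e \<in> E" for e
      proof -
        have "e \<in> (\<lambda>e. e - \<kappa> * \<nu> * u) ` E" unfolding im by (rule that)
        then obtain e' where "e' \<in> E" "e = e' - \<kappa> * \<nu> * u" by blast
        then show ?thesis by simp
      qed
      then show ?thesis unfolding T_def by blast
    qed
  qed
  moreover have "0 \<in> E" by (simp add: E_def fD)
  ultimately have "0 - \<kappa> * \<nu> * (- e / (\<kappa> * \<nu>)) \<in> E" for e unfolding T_def by blast
  then have "e \<in> E" for e using \<kappa>0 \<nu> by simp
  then have "E = UNIV" by auto
  then show False using cE dq d2 by (simp add: q_def)
qed

text \<open>For a zero \<open>m\<close> this is \<open>polar_vanishes\<close>. In general the two
  sides, as polynomials in the coordinate along \<open>a\<close>, differ by a polynomial of degree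
  below \<open>d - 1\<close> that vanishes at \<open>d - 1\<close> zeros.\<close>

lemma B_frame_self:
  assumes fr: "frame a b a' b'" and m: "m \<in> join a b" and v: "v \<in> join a' b'"
  shows "B (m + v) m = of_nat d * f m"
proof -
  note fD = frameD[OF fr]
  have root: "B (m + v) m = 0" if m: "m \<in> join a b" "f m = 0" for m
    by (rule polar_vanishes[OF m(2)]) (simp add: B_lin B_self[OF m(2)] B_frame_orth[OF fr m v])
  obtain x y where xy: "m = x *s a + y *s b" using join_combo[OF m] by blast
  show ?thesis
  proof (cases "y = 0")
    case True
    then have "f m = 0" by (simp add: xy f_scale fD)
    then show ?thesis using root[OF m] by simp
  next
    case False
    let ?P = "y *s b"
    note h = homogeneous_dirpoly[OF hom]
    let ?p1 = "linepoly (dirpoly F ?P) (?P + v) a" and ?p2 = "linepoly (dirpoly F a) (?P + v) a"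
      and ?p3 = "linepoly F ?P a"
    define D where "D = ?p1 + pCons 0 ?p2 - smult (of_nat d) ?p3"
    have D: "poly D t = B (?P + t *s a + v) (?P + t *s a) - of_nat d * f (?P + t *s a)" for t
      by (simp add: D_def poly_linepoly eval4_dirpoly B_lin add_ac)
    have av: "B a v = 0" by (rule B_frame_orth[OF fr join_mem(1) fD(1) v])
    have top: "coeff ?p2 (d - 2) = of_nat (d - 1) * B a ?P"
    proof -
      have "coeff ?p2 (d - 2) = dird (dirpoly F a) a (?P + v)"
        using d2 by (subst coeff_linepoly_rev[OF h]) (auto simp: dird_def numeral_2_eq_2 Suc_diff_Suc)
      then show ?thesis by (simp add: dird_dirpoly_self[OF hom] B_lin av)
    qed
    \<comment> \<open>The coefficients of t^(d-1) cancel by 1 + (d - 1) = d, and that of t^d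
      vanishes by \<open>B a a = 0\<close>.\<close>
    have "coeff D n = 0" if n: "n \<ge> d - 1" for n
    proof -
      consider "n = d - 1" | "n = d" | "n > d" using n by linarith
      then show ?thesis
      proof cases
        case 1
        have "coeff (pCons 0 ?p2) (d - 1) = coeff ?p2 (d - 2)"
          using d2 by (metis Suc_1 Suc_diff_le coeff_pCons_Suc diff_Suc_Suc)
        then have "coeff D n = B a ?P + of_nat (d - 1) * B a ?P - of_nat d * B a ?P"
          using d2 top coeff_secant(2)[OF fD(1), of ?P] coeff_linepoly_top[OF h[of ?P], of "?P + v" a]
          by (simp add: D_def 1 eval4_dirpoly)
        also have "\<dots> = (1 + of_nat (d - 1) - of_nat d) * B a ?P" by (simp add: algebra_simps)
        also have "(1 + of_nat (d - 1) - of_nat d :: 'k) = 0" using d2 by (cases d) auto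
        finally show ?thesis by simp
      next
        case 2
        have "coeff (pCons 0 ?p2) d = coeff ?p2 (d - 1)" using d2 by (cases d) auto
        then show ?thesis
          using 2 d2 coeff_secant(1)[OF fD(1), of d ?P] coeff_linepoly_top[OF h[of a], of "?P + v" a]
            coeff_linepoly_above[OF h[of ?P], of d "?P + v" a]
          by (simp add: D_def eval4_dirpoly fD)
      next
        case 3
        have "coeff (pCons 0 ?p2) n = coeff ?p2 (n - 1)" using 3 by (cases n) auto
        then show ?thesis
          using 3 d2 coeff_secant(1)[OF fD(1), of n ?P] coeff_linepoly_above[OF h[of a], of "n - 1" "?P + v" a]
            coeff_linepoly_above[OF h[of ?P], of n "?P + v" a]
          by (simp add: D_def)
      qed
    qed
    note top' = this
    have "D = 0"
    proof (rule ccontr)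
      assume "D \<noteq> 0"
      then have "card {t. poly D t = 0} < d - 1" using top' by (rule roots_card_less)
      moreover have "card {t. f (?P + t *s a) = 0} \<le> card {t. poly D t = 0}"
      proof (intro card_mono subsetI CollectI)
        fix t assume "t \<in> {t. f (?P + t *s a) = 0}"
        moreover have "?P + t *s a \<in> join a b" using joinI[of t a y b] by (simp add: add.commute)
        ultimately show "poly D t = 0" using root by (simp add: D)
      qed simp
      moreover have "card {t. f (?P + t *s a) = 0} = d - 1"
        by (rule secant_count) (use False in \<open>simp_all add: fD B_lin\<close>)
      ultimately show False by simp
    qed
    then show ?thesis using D[of x] by (simp add: xy add_ac)
  qed
qed

section \<open>Splitting of the form in degree at least three\<close>

lemma degree_one:
  assumes "d \<ge> 3"
  shows "of_nat d = (1::'k)" "d < q"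
proof -
  have "d = Suc (d - 1)" using d2 by simp
  then show 1: "of_nat d = (1::'k)" using pred_degree_zero[OF assms] by (metis add.right_neutral of_nat_Suc)
  have "d \<noteq> q" using 1 of_nat_CARD[where 'k='k] by (metis q_def zero_neq_one)
  then show "d < q" using dq by simp
qed

text \<open>As \<open>d\<close> is 1 in the field, Euler's relation at \<open>m + v\<close> is the
  sum of the two instances of \<open>B_frame_self\<close>.\<close>

lemma f_split:
  assumes d3: "d \<ge> 3" and fr: "frame a b a' b'" and m: "m \<in> join a b" and v: "v \<in> join a' b'"
  shows "f (m + v) = f m + f v"
  using B_frame_self[OF fr m v] B_frame_self[OF frame_swap[OF fr] v m] dird_self[OF hom, of "m + v"]
  by (simp add: degree_one[OF d3] B_lin add.commute)

text \<open>Since \<open>d < q\<close>, the splitting of values lifts to the restrictions to lines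
  and can be differentiated.\<close>

lemma B_split:
  assumes d3: "d \<ge> 3" and fr: "frame a b a' b'"
    and m: "m \<in> join a b" "m' \<in> join a b" and v: "v \<in> join a' b'" "v' \<in> join a' b'"
  shows "B (m + v) (m' + v') = B m m' + B v v'"
proof -
  let ?p = "linepoly F (m + v) (m' + v') - (linepoly F m m' + linepoly F v v')"
  have "?p = 0"
  proof (rule ccontr)
    assume "?p \<noteq> 0"
    then have "card {t. poly ?p t = 0} < q"
      by (rule roots_card_less) (use coeff_linepoly_above[OF hom] degree_one(2)[OF d3] in auto)
    moreover have "poly ?p t = 0" for t
    proof -
      have "m + v + t *s (m' + v') = (m + t *s m') + (v + t *s v')" by (simp add: vec_eq_iff algebra_simps)
      then show ?thesis
        unfolding poly_diff poly_add poly_linepoly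
        using f_split[OF d3 fr, of "m + t *s m'" "v + t *s v'"] m v by (simp only: join_closed diff_self)
    qed
    ultimately show False by (simp add: q_def)
  qed
  then show ?thesis unfolding dird_def by (metis coeff_add eq_iff_diff_eq_0)
qed

text \<open>\<open>b' + u\<close> lies outside the tangent plane at \<open>a'\<close>, so the secant
  \<open>b' + u + t *s a'\<close> has a zero, which is then split by \<open>f_split\<close>.\<close>

lemma opposite_value:
  assumes d3: "d \<ge> 3" and fr: "frame a b a' b'" and u: "u \<in> join a b" "f u \<noteq> 0"
  shows "\<exists>w\<in>join a' b'. f w = - f u"
proof -
  note fD = frameD[OF fr]
  have "B a' u = 0" using join_combo[OF u(1)] by (auto simp: B_lin fD)
  then have "B a' (b' + u) \<noteq> 0" by (simp add: B_lin fD)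
  from secant_count[OF fD(3) this] have "card {t. f (b' + u + t *s a') = 0} > 0" using d2 by simp
  then obtain t where "f (b' + u + t *s a') = 0" by (auto simp: card_gt_0_iff)
  then have t: "f (u + (t *s a' + b')) = 0" by (simp add: add_ac)
  have j: "t *s a' + b' \<in> join a' b'" using joinI[of t a' 1 b'] by simp
  have "f (t *s a' + b') = - f u" using t f_split[OF d3 fr u(1) j] by (simp add: add_eq_0_iff)
  then show ?thesis using j by blast
qed

text \<open>Complete \<open>u\<close> to a surface point \<open>u + w\<close> with \<open>w\<close>
  in the other pair and move \<open>x\<close> into its tangent plane by a multiple of
  \<open>v\<close>. There \<open>polar_vanishes\<close> applies, and the power arises because
  \<open>B\<close> has degree \<open>d - 1\<close> in its first argument.\<close>

lemma polar_power:
  assumes d3: "d \<ge> 3" and fr: "frame a b a' b'" and u: "u \<in> join a b"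
  shows "\<exists>c. \<forall>x\<in>join a b. B x u = c * B u x ^ (d - 1)"
proof -
  note fD = frameD[OF fr]
  \<comment> \<open>For \<open>f u = 0\<close> the choice \<open>w = 0\<close> would admit no
    \<open>v\<close> with \<open>B w v = 1\<close>, so \<open>a'\<close> is taken; otherwise Euler's
    relation gives \<open>B w w = f w\<close>.\<close>
  obtain w v where w: "w \<in> join a' b'" "f w = - f u" and v: "v \<in> join a' b'" "B w v = 1"
  proof (cases "f u = 0")
    case True
    show ?thesis
    proof (rule that)
      show "a' \<in> join a' b'" by (rule join_mem)
      show "(1 / B a' b') *s b' \<in> join a' b'" by (intro join_closed join_mem)
    qed (simp_all add: True fD B_lin)
  next
    case False
    obtain w where w: "w \<in> join a' b'" "f w = - f u" using opposite_value[OF d3 fr u False] by blast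
    show ?thesis
    proof (rule that[OF w])
      show "(1 / f w) *s w \<in> join a' b'" by (intro join_closed w)
      have "f w \<noteq> 0" using False w(2) by simp
      then show "B w ((1 / f w) *s w) = 1"
        by (simp add: B_lin dird_self[OF hom] degree_one[OF d3])
    qed
  qed
  have fuw: "f (u + w) = 0" using f_split[OF d3 fr u w(1)] w(2) by simp
  have "B x u = - ((- 1) ^ (d - 1) * B v w) * B u x ^ (d - 1)" if x: "x \<in> join a b" for x
  proof -
    define z where "z = x + (- B u x) *s v"
    have zj: "(- B u x) *s v \<in> join a' b'" by (intro join_closed v)
    have "B (u + w) z = B u x + B w ((- B u x) *s v)"
      unfolding z_def by (rule B_split[OF d3 fr u x w(1) zj])
    also have "\<dots> = 0" by (simp only: dird_scale v(2)) simp
    finally have "B z (u + w) = 0" by (rule polar_vanishes[OF fuw])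
    moreover have "B z (u + w) = B x u + B ((- B u x) *s v) w"
      unfolding z_def by (rule B_split[OF d3 fr x u zj w(1)])
    ultimately have "B x u + (- B u x) ^ (d - 1) * B v w = 0" by (simp only: B_scale1)
    then have "B x u = - ((- B u x) ^ (d - 1) * B v w)" by (simp add: add_eq_0_iff2)
    then show ?thesis by (subst (asm) power_minus) (simp add: mult_ac)
  qed
  then show ?thesis by blast
qed

section \<open>The binary forms on a hyperbolic pair\<close>

lemma B_binary:
  assumes d3: "d \<ge> 3" and fr: "frame a b a' b'"
  shows "B (x *s a + y *s b) a = B b a * y ^ (d - 1)" "B (x *s a + y *s b) b = B a b * x ^ (d - 1)"
proof -
  note fD = frameD[OF fr]
  obtain k where k: "\<And>v. v \<in> join a b \<Longrightarrow> B v a = k * B a v ^ (d - 1)"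
    using polar_power[OF d3 fr join_mem(1)] by blast
  show "B (x *s a + y *s b) a = B b a * y ^ (d - 1)"
    using k[OF joinI[of x a y b]] k[OF join_mem(2)] by (simp add: B_lin fD power_mult_distrib mult_ac)
  obtain k where k: "\<And>v. v \<in> join a b \<Longrightarrow> B v b = k * B b v ^ (d - 1)"
    using polar_power[OF d3 fr join_mem(2)] by blast
  show "B (x *s a + y *s b) b = B a b * x ^ (d - 1)"
    using k[OF joinI[of x a y b]] k[OF join_mem(1)] by (simp add: B_lin fD power_mult_distrib mult_ac)
qed

lemma f_binary:
  assumes d3: "d \<ge> 3" and fr: "frame a b a' b'"
  shows "f (x *s a + y *s b) = B b a * x * y ^ (d - 1) + B a b * x ^ (d - 1) * y"
  using dird_self[OF hom, of "x *s a + y *s b"] B_binary[OF d3 fr, of x y]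
  by (simp add: degree_one[OF d3] dird_add dird_scale mult_ac)

lemma power_map:
  assumes d3: "d \<ge> 3" and fr: "frame a b a' b'"
  shows "B b a ^ Suc (d - 1) = B a b ^ Suc (d - 1)"
    "((\<mu>::'k) ^ (d - 1)) ^ (d - 1) = \<mu>" "((x::'k) + y) ^ (d - 1) = x ^ (d - 1) + y ^ (d - 1)"
proof -
  note fD = frameD[OF fr]
  have id: "\<exists>k. \<forall>x y. B b a * y ^ (d - 1) + \<mu> * B a b * x ^ (d - 1)
      = k * (x * B b a * \<mu> ^ (d - 1) + y * B a b) ^ (d - 1)" for \<mu>
  proof -
    have u: "1 *s a + \<mu> *s b \<in> join a b" by (rule joinI)
    obtain k where k: "\<And>v. v \<in> join a b \<Longrightarrow> B v (1 *s a + \<mu> *s b) = k * B (1 *s a + \<mu> *s b) v ^ (d - 1)"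
      using polar_power[OF d3 fr u] by blast
    have "B b a * y ^ (d - 1) + \<mu> * B a b * x ^ (d - 1)
      = k * (x * B b a * \<mu> ^ (d - 1) + y * B a b) ^ (d - 1)" for x y
      using k[OF joinI[of x a y b]] B_binary[OF d3 fr, of 1 \<mu>] B_binary[OF d3 fr, of x y]
      by (simp add: dird_add dird_scale mult_ac)
    then show ?thesis by blast
  qed
  have "d - 1 \<ge> 1" using d2 by simp
  from power_map_of_polar_identity[OF fD(6,5) this id]
  show "B b a ^ Suc (d - 1) = B a b ^ Suc (d - 1)"
    "(\<mu> ^ (d - 1)) ^ (d - 1) = \<mu>" "(x + y) ^ (d - 1) = x ^ (d - 1) + y ^ (d - 1)" .
qed

text \<open>On \<open>b + t *s a\<close> the form is \<open>B b a * t + B a b * t ^ (d - 1)\<close>.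
  Dividing its \<open>d - 1\<close> roots by a nonzero one gives exactly the fixed elements of the
  involution.\<close>

lemma q_square:
  assumes d3: "d \<ge> 3"
  shows "q = (d - 1) ^ 2"
proof -
  obtain a b a' b' where fr: "frame a b a' b'" using exists_frame by blast
  note fD = frameD[OF fr]
  let ?R = "{t. f (b + t *s a) = 0}"
  have R: "t \<in> ?R \<longleftrightarrow> B b a * t + B a b * t ^ (d - 1) = 0" for t
    using f_binary[OF d3 fr, of t 1] by (simp add: add.commute)
  have cR: "card ?R = d - 1" by (rule secant_count) (simp_all add: fD)
  then have "\<not> ?R \<subseteq> {0}" using card_mono[of "{0}" ?R] d3 by auto
  then obtain t0 where t0: "t0 \<in> ?R" "t0 \<noteq> 0" by auto
  have b: "B b a = - B a b * t0 ^ (d - 1) / t0"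
    using t0 R[of t0] by (simp add: field_simps add_eq_0_iff)
  have iff: "t * t0 \<in> ?R \<longleftrightarrow> t ^ (d - 1) = t" for t
  proof -
    have "B b a * (t * t0) + B a b * (t * t0) ^ (d - 1) = (B a b * t0 ^ (d - 1)) * (t ^ (d - 1) - t)"
      using t0(2) by (simp add: b power_mult_distrib algebra_simps)
    then show ?thesis unfolding R using t0(2) fD by simp
  qed
  have iff': "(t / t0) ^ (d - 1) = t / t0" if "t \<in> ?R" for t
    using iff[of "t / t0"] that t0(2) by simp
  have "bij_betw (\<lambda>t. t * t0) {t::'k. t ^ (d - 1) = t} ?R"
  proof (rule bij_betw_byWitness[where f' = "\<lambda>t. t / t0"])
    show "(\<lambda>t. t * t0) ` {t. t ^ (d - 1) = t} \<subseteq> ?R" using iff by blast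
    show "(\<lambda>t. t / t0) ` ?R \<subseteq> {t. t ^ (d - 1) = t}" using iff' by blast
  qed (use t0(2) in auto)
  from bij_betw_same_card[OF this] have K: "card {t::'k. t ^ (d - 1) = t} = d - 1" by (simp only: cR)
  have "\<exists>x::'k. x ^ (d - 1) \<noteq> x"
  proof (rule ccontr)
    assume "\<not> ?thesis"
    then have "{t::'k. t ^ (d - 1) = t} = UNIV" by auto
    then show False using K dq d2 by (simp add: q_def)
  qed
  from card_of_involution[OF power_map(3)[OF d3 fr] power_map(2)[OF d3 fr] this]
  show ?thesis unfolding K q_def .
qed

text \<open>After division by a nonzero value of the form, the coefficients in each hyperbolic pair are
  conjugate under \<open>x \<mapsto> x ^ (d - 1)\<close>.\<close>

lemma hermitian_on_frame:
  assumes d3: "d \<ge> 3" and fr: "frame a b a' b'"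
  obtains \<phi> c c' where "\<phi> \<noteq> 0" "c \<noteq> 0" "c' \<noteq> 0"
    "\<And>x y x' y'. f (x *s a + y *s b + x' *s a' + y' *s b') =
      \<phi> * (c * x * y ^ (d - 1) + (c * x) ^ (d - 1) * y + c' * x' * y' ^ (d - 1) + (c' * x') ^ (d - 1) * y')"
proof -
  note fD = frameD[OF fr] and fr' = frame_swap[OF fr]
  define s where "s = d - 1"
  note add = power_map(3)[OF d3 fr, folded s_def] and inv = power_map(2)[OF d3 fr, folded s_def]
    and fb = f_binary[OF d3, folded s_def] and pm = power_map(1)[OF d3, folded s_def]
  have s1: "s \<ge> 1" using d2 by (simp add: s_def)
  have minus: "(- x) ^ s = - (x ^ s)" for x :: 'k
    using add[of x "- x"] s1 by (simp add: zero_power eq_neg_iff_add_eq_0 add.commute)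
  have conj: "\<exists>k. k * B b a = B a b ^ s \<and> k * B a b = B b a ^ s \<and> k \<noteq> 0 \<and> (\<forall>m\<in>join a b. f m ^ s = k * f m)"
    if fr: "frame a b a' b'" for a b a' b'
  proof -
    note fD = frameD[OF fr]
    define k where "k = B a b ^ s / B b a"
    have k1: "k * B b a = B a b ^ s" using fD by (simp add: k_def)
    have "k * B a b = B b a ^ s"
      using pm[OF fr] fD by (simp add: k_def field_simps)
    moreover have "k \<noteq> 0" using fD by (simp add: k_def)
    moreover have "f m ^ s = k * f m" if m: "m \<in> join a b" for m
    proof -
      obtain x y where "m = x *s a + y *s b" using join_combo[OF m] by blast
      then show ?thesis
        using k1 calculation(1) by (simp add: fb[OF fr] add power_mult_distrib inv distrib_left flip: mult.assoc)
    qed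
    ultimately show ?thesis using k1 by blast
  qed
  have "\<exists>u\<in>join a b. f u \<noteq> 0"
  proof (rule ccontr)
    assume no: "\<not> ?thesis"
    have "b + t *s a \<in> join a b" for t using joinI[of t a 1 b] by (simp add: add.commute)
    then have "{t. f (b + t *s a) = 0} = UNIV" using no by auto
    moreover have "card {t. f (b + t *s a) = 0} = d - 1" by (rule secant_count) (simp_all add: fD)
    ultimately show False using dq d2 by (simp add: q_def)
  qed
  then obtain u where u: "u \<in> join a b" "f u \<noteq> 0" by blast
  obtain w where w: "w \<in> join a' b'" "f w = - f u" using opposite_value[OF d3 fr u] by blast
  obtain k where k: "k * B a b = B b a ^ s" "k \<noteq> 0" "\<And>m. m \<in> join a b \<Longrightarrow> f m ^ s = k * f m"
    using conj[OF fr] by blast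
  obtain k' where k': "k' * B a' b' = B b' a' ^ s" "\<And>m. m \<in> join a' b' \<Longrightarrow> f m ^ s = k' * f m"
    using conj[OF fr'] by blast
  define \<phi> where "\<phi> = f u"
  have \<phi>: "\<phi> \<noteq> 0" "\<phi> ^ s = k * \<phi>" using u k(3) by (auto simp: \<phi>_def)
  \<comment> \<open>Opposite values of \<open>f\<close> at \<open>u\<close> and \<open>w\<close>
    force the conjugation factors of the two pairs to agree.\<close>
  have kk: "k' = k" using k'(2)[OF w(1)] \<phi> by (simp add: w(2) minus \<phi>_def)
  have "(B b' a' / \<phi>) ^ s = (k * B a' b') / (k * \<phi>)" "(B b a / \<phi>) ^ s = (k * B a b) / (k * \<phi>)"
    by (simp_all only: power_divide \<phi>(2) k'(1)[symmetric] kk k(1))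
  then have cc: "(B b' a' / \<phi>) ^ s = B a' b' / \<phi>" "(B b a / \<phi>) ^ s = B a b / \<phi>"
    using k(2) by simp_all
  show ?thesis
  proof (rule that[OF \<phi>(1), of "B b a / \<phi>" "B b' a' / \<phi>", folded s_def])
    fix x y x' y'
    have "f (x *s a + y *s b + x' *s a' + y' *s b') = f (x *s a + y *s b) + f (x' *s a' + y' *s b')"
      using f_split[OF d3 fr joinI[of x a y b] joinI[of x' a' y' b']] by (simp add: add.assoc)
    then show "f (x *s a + y *s b + x' *s a' + y' *s b') =
      \<phi> * (B b a / \<phi> * x * y ^ s + (B b a / \<phi> * x) ^ s * y + B b' a' / \<phi> * x' * y' ^ s + (B b' a' / \<phi> * x') ^ s * y')"
      unfolding power_mult_distrib cc fb[OF fr] fb[OF fr']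
      using \<phi>(1) by (simp add: field_simps)
  qed (use \<phi>(1) fD in auto)
qed

end

section \<open>Counting rational points\<close>

lemma equiv_proj_rel: "equiv (UNIV - {0}) (proj_rel :: ('k::field ^ 4) rel)"
proof (rule equivI)
  show "proj_rel \<subseteq> (UNIV - {0}) \<times> (UNIV - {0 :: 'k ^ 4})" by (auto simp: proj_rel_def)
  show "refl_on (UNIV - {0}) (proj_rel :: ('k ^ 4) rel)"
    unfolding refl_on_def proj_rel_def by (auto intro: exI[of _ 1])
  show "sym (proj_rel :: ('k ^ 4) rel)"
  proof (rule symI)
    fix v w :: "'k ^ 4" assume "(v, w) \<in> proj_rel"
    then obtain c where "v \<noteq> 0" "w \<noteq> 0" "c \<noteq> 0" "w = c *s v" by (auto simp: proj_rel_def)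
    then show "(w, v) \<in> proj_rel" by (auto simp: proj_rel_def intro: exI[of _ "1 / c"])
  qed
  show "trans (proj_rel :: ('k ^ 4) rel)"
  proof (rule transI)
    fix u v w :: "'k ^ 4" assume "(u, v) \<in> proj_rel" "(v, w) \<in> proj_rel"
    then obtain c e where "u \<noteq> 0" "v \<noteq> 0" "w \<noteq> 0" "c \<noteq> 0" "e \<noteq> 0" "v = c *s u" "w = e *s v"
      by (auto simp: proj_rel_def)
    then show "(u, w) \<in> proj_rel" by (auto simp: proj_rel_def intro: exI[of _ "e * c"])
  qed
qed

lemma proj_class: "v \<noteq> 0 \<Longrightarrow> proj_rel `` {v} = (\<lambda>c. c *s v) ` (UNIV - {0})"
  by (auto simp: proj_rel_def)

text \<open>Each point has q - 1 representatives, and the origin is added.\<close>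

lemma card_zeros:
  fixes F :: "'k::{field,finite} poly4"
  assumes h: "homogeneous d F" and d: "d \<ge> 1"
  shows "card {v. eval4 F v = 0} = (CARD('k) - 1) * num_points F + 1"
proof -
  let ?S = "surface_points F"
  have sub: "?S \<subseteq> (UNIV - {0}) // proj_rel" by (auto simp: surface_points_def proj_space_def)
  have "(CARD('k) - 1) * card ?S = card (\<Union>?S)"
  proof (rule card_partition)
    fix c assume "c \<in> ?S"
    then have "c \<in> (UNIV - {0}) // proj_rel" using sub by blast
    then obtain v where "v \<noteq> 0" "c = proj_rel `` {v}" by (auto elim: quotientE)
    then have v: "v \<noteq> 0" "c = (\<lambda>c. c *s v) ` (UNIV - {0})" by (simp_all only: proj_class not_False_eq_True)
    then have "inj_on (\<lambda>c. c *s v) (UNIV - {0})" by (auto simp: inj_on_def)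
    then show "card c = CARD('k) - 1" using v by (simp add: card_image)
  next
    fix c1 c2 assume "c1 \<in> ?S" "c2 \<in> ?S" "c1 \<noteq> c2"
    then show "c1 \<inter> c2 = {}" using quotient_disj[OF equiv_proj_rel] sub by blast
  qed simp_all
  moreover have "\<Union>?S = {v. eval4 F v = 0} - {0}"
  proof (intro equalityI subsetI)
    fix v assume "v \<in> \<Union>?S"
    then obtain c where c: "c \<in> ?S" "v \<in> c" by blast
    then have "c \<subseteq> UNIV - {0}" using sub Union_quotient[OF equiv_proj_rel] by blast
    then show "v \<in> {v. eval4 F v = 0} - {0}" using c by (auto simp: surface_points_def)
  next
    fix v assume "v \<in> {v. eval4 F v = 0} - {0}"
    then have v: "eval4 F v = 0" "v \<noteq> 0" by auto
    have "proj_rel `` {v} \<in> ?S"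
      unfolding surface_points_def proj_space_def
      by (auto simp: proj_class[OF v(2)] eval4_scale[OF h] v intro: quotientI)
         (metis DiffI UNIV_I empty_iff insert_iff proj_class quotientI v(2))
    moreover have "v \<in> proj_rel `` {v}" using v(2) by (auto simp: proj_class intro: image_eqI[of _ _ 1])
    ultimately show "v \<in> \<Union>?S" by blast
  qed
  moreover have "0 \<in> {v. eval4 F v = 0}" using eval4_0[OF h] d by simp
  then have "card {v. eval4 F v = 0} = card ({v. eval4 F v = 0} - {0}) + 1"
    by (metis Suc_eq_plus1 card_Suc_Diff1 finite)
  ultimately show ?thesis by (simp add: num_points_def)
qed

section \<open>Coordinates\<close>

lemma four_eq_zero: "(4::4) = 0"
  by simp

lemma sum_UNIV4: "(\<Sum>i\<in>(UNIV::4 set). g i) = g 0 + g 1 + g 2 + g 3"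
  unfolding sum_4 four_eq_zero by (simp add: add_ac)

lemma vec4_eq_zero: "v $ 0 = 0 \<Longrightarrow> v $ 1 = 0 \<Longrightarrow> v $ 2 = 0 \<Longrightarrow> v $ 3 = 0 \<Longrightarrow> v = (0 :: 'a::zero ^ 4)"
  unfolding vec_eq_iff forall_4 four_eq_zero by simp

lemma matrix_of_vectors:
  fixes p0 p1 p2 p3 :: "'k::field ^ 4"
  assumes ind: "\<And>x0 x1 x2 x3. x0 *s p0 + x1 *s p1 + x2 *s p2 + x3 *s p3 = 0 \<Longrightarrow> x0 = 0 \<and> x1 = 0 \<and> x2 = 0 \<and> x3 = 0"
  obtains A :: "'k ^ 4 ^ 4" where "invertible A"
    "\<And>v. A *v v = v $ 0 *s p0 + v $ 1 *s p1 + v $ 2 *s p2 + v $ 3 *s p3"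
proof -
  define A :: "'k ^ 4 ^ 4" where
    "A = (\<chi> i j. (if j = 0 then p0 else if j = 1 then p1 else if j = 2 then p2 else p3) $ i)"
  have A: "A *v v = v $ 0 *s p0 + v $ 1 *s p1 + v $ 2 *s p2 + v $ 3 *s p3" for v
    by (simp add: vec_eq_iff matrix_vector_mult_def A_def sum_UNIV4 mult.commute)
  have "v = 0" if "A *v v = 0" for v
  proof -
    have "v $ 0 = 0 \<and> v $ 1 = 0 \<and> v $ 2 = 0 \<and> v $ 3 = 0" using that by (intro ind) (simp add: A)
    then show ?thesis using vec4_eq_zero by blast
  qed
  then have "invertible A"
    using matrix_left_invertible_ker[of A] invertible_left_inverse[of A] by blast
  then show ?thesis using that A by blast
qed

text \<open>Forms of degree at most q are determined by their values, so evaluating in the new basis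
  suffices.\<close>

lemma proj_equivalentI:
  fixes F G :: "'k::{field,finite} poly4"
  assumes ind: "\<And>x0 x1 x2 x3. x0 *s p0 + x1 *s p1 + x2 *s p2 + x3 *s p3 = 0 \<Longrightarrow> x0 = 0 \<and> x1 = 0 \<and> x2 = 0 \<and> x3 = 0"
    and h: "homogeneous d F" "homogeneous d G" and d: "d \<le> CARD('k)" and c: "c \<noteq> 0"
    and eq: "\<And>v. eval4 F (v $ 0 *s p0 + v $ 1 *s p1 + v $ 2 *s p2 + v $ 3 *s p3) = c * eval4 G v"
  shows "proj_equivalent F G"
proof -
  obtain A :: "'k ^ 4 ^ 4" where A: "invertible A"
    "\<And>v. A *v v = v $ 0 *s p0 + v $ 1 *s p1 + v $ 2 *s p2 + v $ 3 *s p3"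
    using matrix_of_vectors[OF ind] by blast
  have "linear_change A F = Const c * G"
    by (rule eq_of_eval4_eq[OF homogeneous_linear_change[OF h(1)] homogeneous_Const_mult[OF h(2)] d])
       (simp add: eval4_linear_change A(2) eq eval4_simps)
  then show ?thesis using A(1) c by (auto simp: proj_equivalent_def)
qed

section \<open>Norms and traces\<close>

text \<open>Over the fixed field of \<open>s\<close> elements, \<rho> has trace 1 and \<beta> has
  norm -1. The first is an element divided by its nonzero trace; the second exists by
  counting.\<close>

lemma norm_trace_witnesses:
  fixes s :: nat
  assumes q: "CARD('k::{field,finite}) = s ^ 2" and s: "s \<ge> 2"
    and add: "\<And>x y::'k. (x + y) ^ s = x ^ s + y ^ s" and inv: "\<And>x::'k. (x ^ s) ^ s = x"
  obtains \<rho> \<beta> :: "'k::{field,finite}" where "\<rho> + \<rho> ^ s = 1" "\<beta> * \<beta> ^ s = -1"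
proof -
  obtain e where "s = e + 2" using s by (metis add.commute le_Suc_ex)
  then have sq: "s + 1 \<le> CARD('k)" by (simp add: q power2_eq_square)
  have few: "card {x::'k. a * x + x ^ s = 0} < s + 1" for a
  proof -
    let ?p = "[:0, a:] + monom 1 s"
    have "card {x. poly ?p x = 0} < s + 1"
    proof (rule roots_card_less)
      have "coeff ?p s = 1" using s by (simp add: coeff_pCons split: nat.splits)
      then show "?p \<noteq> 0" by (metis coeff_0 zero_neq_one)
      show "coeff ?p n = 0" if "n \<ge> s + 1" for n using s that by (simp add: coeff_pCons split: nat.splits)
    qed
    then show ?thesis by (simp add: poly_monom mult.commute)
  qed
  have nontriv: "\<exists>x::'k. a * x + x ^ s \<noteq> 0" for a
  proof (rule ccontr)
    assume "\<not> ?thesis"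
    then have "{x::'k. a * x + x ^ s = 0} = UNIV" by auto
    then show False using few[of a] sq by simp
  qed
  obtain r :: 'k where r: "r + r ^ s \<noteq> 0" using nontriv[of 1] by auto
  define \<rho> where "\<rho> = r / (r + r ^ s)"
  have "(r + r ^ s) ^ s = r + r ^ s" by (simp add: add inv add.commute)
  then have "\<rho> + \<rho> ^ s = r / (r + r ^ s) + r ^ s / (r + r ^ s)" by (simp add: \<rho>_def power_divide)
  also have "\<dots> = 1" using r by (simp flip: add_divide_distrib)
  finally have \<rho>: "\<rho> + \<rho> ^ s = 1" .
  let ?K = "{x::'k. x ^ s = x}"
  have "\<exists>x::'k. x ^ s \<noteq> x" using nontriv[of "-1"] by auto
  from card_of_involution[OF add inv this] have cK: "card ?K = s" by (simp add: q)
  have z: "(0::'k) ^ s = 0" using s by (simp add: zero_power)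
  have m1: "(-1::'k) ^ s = -1" using add[of 1 "-1"] z by (simp add: eq_neg_iff_add_eq_0 add.commute)
  have "\<exists>b::'k. b * b ^ s = -1"
  proof (rule ccontr)
    assume no: "\<not> ?thesis"
    \<comment> \<open>If -1 is no norm, the s^2 - 1 nonzero elements have at most s - 2 norms with
      at most s + 1 preimages each, which is too few.\<close>
    let ?Y = "?K - {0, -1}"
    have "UNIV - {0::'k} \<subseteq> (\<Union>y\<in>?Y. {x. x * x ^ s = y})"
    proof
      fix x :: 'k assume "x \<in> UNIV - {0}"
      then show "x \<in> (\<Union>y\<in>?Y. {x. x * x ^ s = y})" using no by (auto simp: power_mult_distrib inv)
    qed
    then have "card (UNIV - {0::'k}) \<le> card (\<Union>y\<in>?Y. {x. x * x ^ s = y})" by (intro card_mono) auto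
    also have "\<dots> \<le> (\<Sum>y\<in>?Y. card {x. x * x ^ s = y})" by (rule card_UN_le) simp
    also have "\<dots> \<le> (\<Sum>y\<in>?Y. s + 1)"
    proof (rule sum_mono)
      fix y :: 'k
      let ?p = "monom 1 (s + 1) - [:y:]"
      have "card {x. poly ?p x = 0} < s + 2"
      proof (rule roots_card_less)
        have "coeff ?p (s + 1) = 1" by simp
        then show "?p \<noteq> 0" by (metis coeff_0 zero_neq_one)
        show "coeff ?p n = 0" if "n \<ge> s + 2" for n using that by (simp add: coeff_pCons split: nat.splits)
      qed
      then show "card {x. x * x ^ s = y} \<le> s + 1" by (simp add: poly_monom)
    qed
    also have "\<dots> = (s - 2) * (s + 1)"
    proof -
      have "{0, -1} \<subseteq> ?K" using z m1 by auto
      moreover have "card {0, -1::'k} = 2" by simp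
      ultimately have "card ?Y = s - 2" by (simp add: card_Diff_subset cK)
      then show ?thesis by simp
    qed
    finally have "s * s - 1 \<le> (s - 2) * (s + 1)" by (simp add: q power2_eq_square)
    then show False using \<open>s = e + 2\<close> by (simp add: algebra_simps)
  qed
  then show ?thesis using that \<rho> by blast
qed

section \<open>Normal forms\<close>

context extremal_surface
begin

lemma quadric_case:
  assumes "d = 2"
  shows "proj_equivalent F (Var 0 * Var 1 - Var 2 * Var 3)"
proof -
  obtain a b a' b' where fr: "frame a b a' b'" using exists_frame by blast
  note fD = frameD[OF fr]
  show ?thesis
  proof (rule proj_equivalentI[of "(1 / B a b) *s a" b "(- 1 / B a' b') *s a'" b' d _ _ 1])
    fix x0 x1 x2 x3
    assume "x0 *s ((1 / B a b) *s a) + x1 *s b + x2 *s ((- 1 / B a' b') *s a') + x3 *s b' = 0"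
    then show "x0 = 0 \<and> x1 = 0 \<and> x2 = 0 \<and> x3 = 0"
      using frame_coeffs[OF fr, of "x0 * (1 / B a b)" x1 "x2 * (- 1 / B a' b')" x3] fD(5,7) by simp
  next
    have "homogeneous (1 + 1) (Var 0 * Var 1 - Var 2 * Var 3 :: 'k poly4)"
      by (intro homogeneous_diff homogeneous_mult homogeneous_Var)
    then show "homogeneous d (Var 0 * Var 1 - Var 2 * Var 3 :: 'k poly4)" by (simp add: assms numeral_2_eq_2)
  next
    fix v :: "'k ^ 4"
    show "f (v $ 0 *s ((1 / B a b) *s a) + v $ 1 *s b + v $ 2 *s ((- 1 / B a' b') *s a') + v $ 3 *s b') =
      1 * eval4 (Var 0 * Var 1 - Var 2 * Var 3) v"
      using quadric_on_frame[OF assms fr, of "v $ 0 * (1 / B a b)" "v $ 1" "v $ 2 * (- 1 / B a' b')" "v $ 3"] fD(5,7)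
      by (simp add: eval4_simps)
  qed (use hom dq q_def in auto)
qed

text \<open>The substitution \<open>x = X + \<beta> Y\<close>, \<open>y = \<rho> X - \<beta> \<rho> ^ s Y\<close> with \<open>\<rho>\<close> of trace \<open>1\<close> and
  \<open>\<beta>\<close> of norm \<open>-1\<close> turns \<open>x y ^ s + x ^ s y\<close> into \<open>X ^ (s + 1) + Y ^ (s + 1)\<close>.\<close>

lemma hermitian_case:
  assumes d3: "d \<ge> 3"
  shows "proj_equivalent F (Var 0 ^ d + Var 1 ^ d + Var 2 ^ d + Var 3 ^ d)"
proof -
  obtain a b a' b' where fr: "frame a b a' b'" using exists_frame by blast
  define s where "s = d - 1"
  have ds: "d = Suc s" and s2: "s \<ge> 2" using d3 by (auto simp: s_def)
  note add = power_map(3)[OF d3 fr, folded s_def] and inv = power_map(2)[OF d3 fr, folded s_def]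
  have qs: "CARD('k) = s ^ 2" using q_square[OF d3] by (simp add: q_def s_def)
  obtain \<rho> \<beta> :: 'k where \<rho>: "\<rho> + \<rho> ^ s = 1" and \<beta>: "\<beta> * \<beta> ^ s = -1"
    using norm_trace_witnesses[OF qs s2 add inv] by blast
  obtain \<phi> c c' where c: "\<phi> \<noteq> 0" "c \<noteq> 0" "c' \<noteq> 0"
    and form: "\<And>x y x' y'. f (x *s a + y *s b + x' *s a' + y' *s b') =
      \<phi> * (c * x * y ^ s + (c * x) ^ s * y + c' * x' * y' ^ s + (c' * x') ^ s * y')"
    using hermitian_on_frame[OF d3 fr, folded s_def] by metis
  have \<beta>0: "\<beta> \<noteq> 0" using \<beta> by auto
  have minus: "(- x) ^ s = - (x ^ s)" for x :: 'k
    using add[of x "- x"] s2 by (simp add: zero_power eq_neg_iff_add_eq_0 add.commute)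
  have id: "(X + \<beta> * Y) * (\<rho> * X - \<beta> * \<rho> ^ s * Y) ^ s + (X + \<beta> * Y) ^ s * (\<rho> * X - \<beta> * \<rho> ^ s * Y)
    = X ^ Suc s + Y ^ Suc s" for X Y
  proof -
    have e1: "(\<rho> * X - \<beta> * \<rho> ^ s * Y) ^ s = \<rho> ^ s * X ^ s - \<beta> ^ s * \<rho> * Y ^ s"
      using add[of "\<rho> * X" "- (\<beta> * \<rho> ^ s * Y)"] by (simp add: minus power_mult_distrib inv)
    have e2: "(X + \<beta> * Y) ^ s = X ^ s + \<beta> ^ s * Y ^ s" by (simp add: add power_mult_distrib)
    have "(X + \<beta> * Y) * (\<rho> ^ s * X ^ s - \<beta> ^ s * \<rho> * Y ^ s) + (X ^ s + \<beta> ^ s * Y ^ s) * (\<rho> * X - \<beta> * \<rho> ^ s * Y)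
      = (\<rho> + \<rho> ^ s) * (X * X ^ s) - (\<beta> * \<beta> ^ s) * (\<rho> + \<rho> ^ s) * (Y * Y ^ s)"
      by (simp add: algebra_simps)
    then show ?thesis unfolding e1 e2 \<rho> \<beta> by simp
  qed
  \<comment> \<open>The substitution has determinant -\<beta> (\<rho> + \<rho>^s) = -\<beta>, up to
    the division by \<open>e\<close>, and is therefore invertible.\<close>
  have solve: "X = 0 \<and> Y = 0" if "(X + \<beta> * Y) / e = 0" "\<rho> * X - \<beta> * \<rho> ^ s * Y = 0" "e \<noteq> 0" for X Y e
  proof -
    have X: "X = - \<beta> * Y" using that by (simp add: add_eq_0_iff2)
    then have "- (\<beta> * (\<rho> + \<rho> ^ s) * Y) = 0" using that(2) by (simp add: algebra_simps)
    then have "Y = 0" using \<rho> \<beta>0 by simp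
    then show ?thesis using X by simp
  qed
  \<comment> \<open>The divisions by \<open>c\<close> and \<open>c'\<close> absorb the coefficients
    of the Hermitian form.\<close>
  let ?p0 = "(1 / c) *s a + \<rho> *s b" and ?p1 = "(\<beta> / c) *s a - (\<beta> * \<rho> ^ s) *s b"
    and ?p2 = "(1 / c') *s a' + \<rho> *s b'" and ?p3 = "(\<beta> / c') *s a' - (\<beta> * \<rho> ^ s) *s b'"
  have combo: "x0 *s ?p0 + x1 *s ?p1 + x2 *s ?p2 + x3 *s ?p3
    = ((x0 + \<beta> * x1) / c) *s a + (\<rho> * x0 - \<beta> * \<rho> ^ s * x1) *s b
      + ((x2 + \<beta> * x3) / c') *s a' + (\<rho> * x2 - \<beta> * \<rho> ^ s * x3) *s b'" for x0 x1 x2 x3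
    by (simp add: vec_eq_iff algebra_simps add_divide_distrib)
  show ?thesis
  proof (rule proj_equivalentI[of ?p0 ?p1 ?p2 ?p3 d _ _ \<phi>])
    fix x0 x1 x2 x3
    assume "x0 *s ?p0 + x1 *s ?p1 + x2 *s ?p2 + x3 *s ?p3 = 0"
    from frame_coeffs[OF fr this[unfolded combo]]
    show "x0 = 0 \<and> x1 = 0 \<and> x2 = 0 \<and> x3 = 0" using solve[OF _ _ c(2)] solve[OF _ _ c(3)] by blast
  next
    have "homogeneous (d * 1) (Var 0 ^ d + Var 1 ^ d + Var 2 ^ d + Var 3 ^ d :: 'k poly4)"
      by (intro homogeneous_add homogeneous_power homogeneous_Var)
    then show "homogeneous d (Var 0 ^ d + Var 1 ^ d + Var 2 ^ d + Var 3 ^ d :: 'k poly4)" by simp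
  next
    fix v :: "'k ^ 4"
    show "f (v $ 0 *s ?p0 + v $ 1 *s ?p1 + v $ 2 *s ?p2 + v $ 3 *s ?p3) =
      \<phi> * eval4 (Var 0 ^ d + Var 1 ^ d + Var 2 ^ d + Var 3 ^ d) v"
    proof -
      have cx: "c * (x / c) = x" "c' * (x / c') = x" for x using c by simp_all
      have "f (v $ 0 *s ?p0 + v $ 1 *s ?p1 + v $ 2 *s ?p2 + v $ 3 *s ?p3)
        = \<phi> * ((v $ 0 ^ Suc s + v $ 1 ^ Suc s) + (v $ 2 ^ Suc s + v $ 3 ^ Suc s))"
        unfolding combo form cx id[symmetric] by (simp only: add.assoc)
      then show ?thesis by (simp add: eval4_simps ds add.assoc)
    qed
  qed (use hom dq q_def c in auto)
qed

end

section \<open>Surfaces containing all rational points\<close>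

lemma linepoly_linear: "homogeneous 1 L \<Longrightarrow> linepoly L v w = [:eval4 L v, eval4 L w:]"
proof (rule poly_eqI)
  fix n assume h: "homogeneous 1 L"
  show "coeff (linepoly L v w) n = coeff [:eval4 L v, eval4 L w:] n"
    using coeff_linepoly_0[of L v w] coeff_linepoly_top[OF h, of v w] coeff_linepoly_above[OF h, of n v w]
    by (auto simp: coeff_pCons split: nat.splits)
qed

text \<open>Derivatives of q-th powers vanish and q-th powers of values are the values themselves,
  so only the derivatives of the linear factors survive.\<close>

lemma dird_skew:
  fixes L M :: "'k::{field,finite} poly4"
  assumes "homogeneous 1 L" "homogeneous 1 M"
  shows "dird (L * M ^ CARD('k) - L ^ CARD('k) * M) v w = eval4 L w * eval4 M v - eval4 L v * eval4 M w"
proof -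
  have "poly (pderiv (p * r ^ CARD('k) - p ^ CARD('k) * r)) 0
      = poly (pderiv p) 0 * poly r 0 - poly p 0 * poly (pderiv r) 0" for p r :: "'k poly"
    by (simp add: pderiv_diff pderiv_mult pderiv_power of_nat_CARD power_CARD mult.commute)
  moreover have "poly (linepoly L v w) 0 = eval4 L v" "poly (pderiv (linepoly L v w)) 0 = eval4 L w"
    if "homogeneous 1 L" for L :: "'k poly4"
    by (simp_all add: linepoly_linear[OF that] pderiv_pCons)
  ultimately show ?thesis by (simp only: dird_pderiv linepoly_simps assms)
qed

lemma dird_Const_mult: "dird (Const c * F) v w = c * dird F v w"
  by (simp add: dird_def linepoly_simps)

lemma dird_plus: "dird (F + G) v w = dird F v w + dird G v w"
  by (simp add: dird_def linepoly_simps)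

lemma homogeneous_skew:
  fixes L M :: "'k::{field,finite} poly4"
  assumes "homogeneous 1 L" "homogeneous 1 M"
  shows "homogeneous (CARD('k) + 1) (L * M ^ CARD('k) - L ^ CARD('k) * M)"
proof -
  have "homogeneous (1 + CARD('k) * 1) (L * M ^ CARD('k))" "homogeneous (CARD('k) * 1 + 1) (L ^ CARD('k) * M)"
    by (intro homogeneous_mult homogeneous_power assms)+
  then show ?thesis by (intro homogeneous_diff) (simp_all add: add.commute)
qed

lemma space_filling_case:
  fixes F :: "'k::{field,finite} poly4"
  defines "q \<equiv> CARD('k)"
  assumes hom: "homogeneous (q + 1) F" and F0: "F \<noteq> 0"
    and noplane: "\<And>c D. eval4 (linform c) D \<noteq> 0 \<Longrightarrow> \<not> linform c dvd F"
    and all: "\<And>v. eval4 F v = 0"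
  shows "proj_equivalent F (Var 0 * Var 1 ^ q - Var 0 ^ q * Var 1 + Var 2 * Var 3 ^ q - Var 2 ^ q * Var 3)"
proof -
  let ?B = "dird F"
  have q2: "q \<ge> 2" using card_field_ge2[where 'k='k] by (simp add: q_def)
  have hom': "homogeneous (CARD('k) + 1) F" using hom by (simp add: q_def)
  have self: "?B v v = 0" for v by (simp add: dird_self[OF hom] all)
  have shift: "?B (x + t *s y) y = ?B x y" for x y t
  proof -
    let ?p = "linepoly F x y"
    define c where "c = coeff ?p q"
    \<comment> \<open>The restriction vanishes at all q parameters and has degree at most q, so it
      is a multiple of t^q - t and its derivative is constant.\<close>
    let ?r = "?p - smult c (monom 1 q - [:0, 1:])"
    have "?r = 0"
    proof (rule ccontr)
      assume "?r \<noteq> 0"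
      moreover have "coeff ?r n = 0" if n: "n \<ge> q" for n
      proof -
        consider "n = q" | "n = q + 1" | "n > q + 1" using n by linarith
        then show ?thesis
          using coeff_linepoly_top[OF hom, of x y] coeff_linepoly_above[OF hom, of n x y] q2
          by cases (auto simp: c_def all coeff_pCons split: nat.splits)
      qed
      ultimately have "card {t. poly ?r t = 0} < q" by (rule roots_card_less)
      then show False by (simp add: poly_linepoly all poly_monom power_CARD q_def)
    qed
    then have "?p = smult c (monom 1 q - [:0, 1:])" by simp
    then have "pderiv ?p = [:- c:]"
      by (simp add: pderiv_smult pderiv_diff pderiv_monom pderiv_pCons q_def of_nat_CARD)
    then show ?thesis using dird_shift[of F x t y] dird_shift[of F x 0 y] by simp
  qed
  have anti: "?B y x = - ?B x y" for x y
  proof -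
    have "?B (x + y) y = ?B x y" "?B (x + y) x = ?B y x"
      using shift[of x 1 y] shift[of y 1 x] by (simp_all add: add.commute)
    then show ?thesis using self[of "x + y"] by (simp add: dird_add add_eq_0_iff)
  qed
  have lin1: "?B (x + x') y = ?B x y + ?B x' y" "?B (x - x') y = ?B x y - ?B x' y" "?B (e *s x) y = e * ?B x y" for x x' y e
    by (simp_all only: anti[of "x + x'" y] anti[of "x - x'" y] anti[of "e *s x" y] anti[of x y] anti[of x' y]
        dird_add dird_minus dird_scale) simp_all
  note lin = lin1 dird_add dird_minus dird_scale
  have "\<exists>a b. ?B a b \<noteq> 0"
  proof (rule ccontr)
    assume "\<not> ?thesis"
    then have "F = 0"
      by (intro eq_of_dird_eq[OF hom']) (auto simp: dird_def linepoly_simps)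
    then show False using F0 by simp
  qed
  then obtain a b0 where ab0: "?B a b0 \<noteq> 0" by blast
  define b where "b = (1 / ?B a b0) *s b0"
  have ab1: "?B a b = 1" using ab0 by (simp add: b_def dird_scale)
  then have ab: "?B a b = 1" "?B b a = -1" using anti[of b a] by simp_all
  \<comment> \<open>Projection onto the orthogonal complement of the hyperbolic pair
    \<open>a\<close>, \<open>b\<close>.\<close>
  define pr where "pr v = v - ?B a v *s b + ?B b v *s a" for v
  have pr: "?B a (pr v) = 0" "?B b (pr v) = 0" for v by (simp_all add: pr_def lin ab self)
  have pr': "?B (pr v) a = 0" "?B (pr v) b = 0" for v using anti[of "pr v"] pr by simp_all
  show ?thesis
  proof (cases "\<exists>v w. ?B (pr v) (pr w) \<noteq> 0")
    case True
    then obtain v w where vw: "?B (pr v) (pr w) \<noteq> 0" by blast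
    define a' where "a' = pr v"
    define b' where "b' = (1 / ?B (pr v) (pr w)) *s pr w"
    have ab': "?B a' b' = 1" using vw by (simp add: a'_def b'_def lin)
    have ba': "?B b' a' = -1" using anti[of b' a'] ab' by simp
    have o: "?B a a' = 0" "?B a b' = 0" "?B b a' = 0" "?B b b' = 0" "?B a' a = 0" "?B a' b = 0" "?B b' a = 0" "?B b' b = 0"
      by (simp_all add: a'_def b'_def lin pr pr')
    note tab = o ab ab' ba' self
    have ind: "x0 = 0 \<and> x1 = 0 \<and> x2 = 0 \<and> x3 = 0" if z: "x0 *s a + x1 *s b + x2 *s a' + x3 *s b' = 0" for x0 x1 x2 x3
    proof -
      have "?B u (x0 *s a + x1 *s b + x2 *s a' + x3 *s b') = 0" for u by (simp only: z dird_zero)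
      from this[of a] this[of b] this[of a'] this[of b'] show ?thesis by (simp add: lin tab)
    qed
    obtain A :: "'k ^ 4 ^ 4" where A: "invertible A"
      "\<And>v. A *v v = v $ 0 *s a + v $ 1 *s b + v $ 2 *s a' + v $ 3 *s b'"
      using matrix_of_vectors[OF ind] by blast
    let ?G = "(Var 0 * Var 1 ^ q - Var 0 ^ q * Var 1) + (Var 2 * Var 3 ^ q - Var 2 ^ q * Var 3) :: 'k poly4"
    \<comment> \<open>The basis is symplectic; the sign comes from \<open>dird_skew\<close>, whose
      form is the negative of \<open>?B\<close> in these coordinates.\<close>
    have "linear_change A F = Const (-1) * ?G"
    proof (rule eq_of_dird_eq)
      show "homogeneous (CARD('k) + 1) (linear_change A F)" by (rule homogeneous_linear_change[OF hom'])
      show "homogeneous (CARD('k) + 1) (Const (-1) * ?G)"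
        unfolding q_def by (intro homogeneous_Const_mult homogeneous_add homogeneous_skew homogeneous_Var)
      fix v w
      have "dird ?G v w = (w $ 0 * v $ 1 - v $ 0 * w $ 1) + (w $ 2 * v $ 3 - v $ 2 * w $ 3)"
        by (simp add: dird_plus q_def dird_skew homogeneous_Var[simplified])
      moreover have "?B (A *v v) (A *v w) = - ((w $ 0 * v $ 1 - v $ 0 * w $ 1) + (w $ 2 * v $ 3 - v $ 2 * w $ 3))"
        by (simp add: A(2) lin tab)
      ultimately show "dird (linear_change A F) v w = dird (Const (-1) * ?G) v w"
        by (simp add: dird_linear_change dird_Const_mult)
    qed
    moreover have "?G = Var 0 * Var 1 ^ q - Var 0 ^ q * Var 1 + Var 2 * Var 3 ^ q - Var 2 ^ q * Var 3"
      by (simp add: algebra_simps)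
    ultimately have "linear_change A F = Const (-1) *
        (Var 0 * Var 1 ^ q - Var 0 ^ q * Var 1 + Var 2 * Var 3 ^ q - Var 2 ^ q * Var 3)" by (simp only:)
    moreover have "(-1 :: 'k) \<noteq> 0" by simp
    ultimately show ?thesis using A(1) unfolding proj_equivalent_def by blast
  next
    case False
    \<comment> \<open>If the form is zero on the complement, it is the skew product of the linear
      forms \<open>L a\<close> and \<open>L b\<close>, and \<open>F\<close> acquires the factor
      \<open>L a\<close>.\<close>
    define L where "L u = linform (\<lambda>i. eval4 (pd i F) u)" for u
    have L: "eval4 (L u) v = ?B u v" for u v by (simp add: L_def eval4_linform dird_eq_pd mult.commute)
    have hL: "homogeneous 1 (L u)" for u unfolding L_def by (rule homogeneous_linform)
    have "F = L a * (Const (-1) * L b ^ q) - L a ^ q * (Const (-1) * L b)"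
    proof -
      have "F = Const (-1) * (L a * L b ^ q - L a ^ q * L b)"
      proof (rule eq_of_dird_eq[OF hom'])
        show "homogeneous (CARD('k) + 1) (Const (-1) * (L a * L b ^ q - L a ^ q * L b))"
          unfolding q_def by (intro homogeneous_Const_mult homogeneous_skew hL)
        fix v w
        have "?B (pr v + (?B a v *s b - ?B b v *s a)) (pr w + (?B a w *s b - ?B b w *s a))
          = ?B a v * ?B b w - ?B b v * ?B a w"
          using False by (simp add: lin pr pr' ab self)
        moreover have "pr v + (?B a v *s b - ?B b v *s a) = v" for v by (simp add: pr_def)
        ultimately have "?B v w = ?B a v * ?B b w - ?B b v * ?B a w" by metis
        then show "?B v w = dird (Const (-1) * (L a * L b ^ q - L a ^ q * L b)) v w"
          unfolding q_def dird_Const_mult dird_skew[OF hL hL] L by simp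
      qed
      then show ?thesis by (simp add: algebra_simps)
    qed
    moreover have "L a dvd L a ^ q" using q2 by (simp add: dvd_power)
    ultimately have "L a dvd F" by (metis dvd_diff dvd_mult2 dvd_triv_left)
    moreover have "eval4 (L a) b \<noteq> 0" by (simp add: L ab)
    ultimately show ?thesis using noplane unfolding L_def by blast
  qed
qed

theorem theorem1:
  fixes F :: "'k::{field,finite} poly4" and d q :: nat
  assumes "q = CARD('k)"
    and "surface d F"
    and "without_plane_components F"
    and "num_points F = (d - 1) * q ^ 2 + d * q + 1"
  shows "(d = 2 \<or> (\<exists>s. q = s ^ 2 \<and> d = s + 1) \<or> d = q + 1) \<and>
    (d = 2 \<longrightarrow> proj_equivalent F (Var 0 * Var 1 - Var 2 * Var 3)) \<and>
    (\<forall>s. q = s ^ 2 \<and> d = s + 1 \<longrightarrow>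
       proj_equivalent F (Var 0 ^ (s + 1) + Var 1 ^ (s + 1) + Var 2 ^ (s + 1) + Var 3 ^ (s + 1))) \<and>
    (d = q + 1 \<longrightarrow>
       proj_equivalent F (Var 0 * Var 1 ^ q - Var 0 ^ q * Var 1 + Var 2 * Var 3 ^ q - Var 2 ^ q * Var 3))"
proof -
  have hom: "homogeneous d F" and d1: "d \<ge> 1" and F0: "F \<noteq> 0"
    using assms(2) by (auto simp: surface_def)
  have q2: "q \<ge> 2" using card_field_ge2[where 'k='k] assms(1) by simp
  have noplane: "\<not> linform c dvd F" if "eval4 (linform c) D \<noteq> 0" for c D
  proof -
    have "linform c \<noteq> 0" using that by (auto simp: eval4_simps)
    then show ?thesis using assms(3) homogeneous_linform[of c] by (auto simp: without_plane_components_def)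
  qed
  \<comment> \<open>In degree one \<open>F\<close> would be its own linear factor.\<close>
  have "d \<noteq> 1" using assms(3) hom F0 by (auto simp: without_plane_components_def)
  then have d2: "d \<ge> 2" using d1 by simp
  obtain r where r: "q = r + 1" using q2 by (metis add.commute le_Suc_ex Suc_1 add_Suc_right plus_1_eq_Suc)
  obtain e where e: "d = e + 1" using d1 by (metis add.commute le_Suc_ex)
  have Z: "card {v. eval4 F v = 0} = (q - 1) * ((d - 1) * q ^ 2 + d * q + 1) + 1"
    using card_zeros[OF hom d1] assms(1,4) by simp
  have count: "card {v. eval4 F v = 0} + d * q = (d - 1) * q ^ 3 + q ^ 2 + q"
    unfolding Z by (simp add: r e power2_eq_square power3_eq_cube algebra_simps)
  have q4: "card {v. eval4 F v = 0} \<le> q ^ 4"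
    using card_mono[of UNIV "{v. eval4 F v = 0}"] by (simp add: CARD_space assms(1))
  \<comment> \<open>In larger degree the assumed number of zeros would exceed the q^4 vectors of the
    space.\<close>
  have dq1: "d \<le> q + 1"
  proof (rule ccontr)
    assume "\<not> ?thesis"
    then have "d \<ge> q + 2" by simp
    then have "(q - 1) * ((q + 1) * q ^ 2 + (q + 2) * q + 1) + 1 \<le> q ^ 4"
      by (intro order_trans[OF _ q4[unfolded Z]] add_mono mult_mono) auto
    then show False using q2 by (simp add: r algebra_simps power_numeral_reduce)
  qed
  show ?thesis
  proof (cases "d = q + 1")
    case True
    \<comment> \<open>For \<open>d = q + 1\<close> the count is exactly q^4, so every vector is a
      zero.\<close>
    have "card {v. eval4 F v = 0} = card (UNIV :: ('k ^ 4) set)"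
      unfolding Z CARD_space True by (simp add: r algebra_simps power_numeral_reduce flip: assms(1))
    then have "{v. eval4 F v = 0} = UNIV" by (intro card_subset_eq) auto
    then have all: "eval4 F v = 0" for v by blast
    have "proj_equivalent F (Var 0 * Var 1 ^ q - Var 0 ^ q * Var 1 + Var 2 * Var 3 ^ q - Var 2 ^ q * Var 3)"
      unfolding assms(1) by (rule space_filling_case[OF _ F0 noplane all]) (use hom True assms(1) in auto)
    \<comment> \<open>The three degrees are distinct: \<open>s + 1 = q + 1\<close> would give
      \<open>s = s ^ 2\<close>, hence \<open>q \<le> 1\<close>.\<close>
    moreover have "s \<noteq> s ^ 2" if "q = s ^ 2" for s
    proof
      assume "s = s ^ 2"
      then have "s = 0 \<or> s = 1" by (auto simp: power2_eq_square)
      then show False using that q2 by auto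
    qed
    ultimately show ?thesis using True q2 by auto
  next
    case False
    then have dq: "d \<le> q" using dq1 by simp
    interpret extremal_surface F d q
      by unfold_locales (use assms(1) hom d2 dq noplane count in auto)
    show ?thesis
    proof (cases "d = 2")
      case True
      have "s \<noteq> 1" if "q = s ^ 2" for s using that q2 by auto
      then show ?thesis using quadric_case[OF True] True False q2 by auto
    next
      case d: False
      then have d3: "d \<ge> 3" using d2 by simp
      have "q = (d - 1) ^ 2 \<and> d = (d - 1) + 1" using q_square[OF d3] d2 by simp
      then have "\<exists>s. q = s ^ 2 \<and> d = s + 1" by blast
      then show ?thesis using hermitian_case[OF d3] d False by auto
    qed
  qed
qed

end
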